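(* Let $X$ be a real hereditarily indecomposable (HI) Banach space having type $\mathbb{R}$. Then $\mathrm{GL}(X)$ has exactly four connected components, listed below: - $\mathrm{GL}_0^+(X) := \{T \in \mathrm{GL}(X) \mid \pi_X(T) > 0 \text{ and } p^{(-\infty, 0)}(T) = 0\}$, containing $\mathrm{Id}_X$; - $\mathrm{GL}_1^+(X) := \{T \in \mathrm{GL}(X) \mid \pi_X(T) > 0 \text{ and } p^{(-\infty, 0)}(T) = 1\}$, containing all reflections of $X$; - $\mathrm{GL}_0^-(X) := \{T \in \mathrm{GL}(X) \mid \pi_X(T) < 0 \text{ and } p^{(0, +\infty)}(T) = 0\}$, containing $-\mathrm{Id}_X$; - $\mathrm{GL}_1^-(X) := \{T \in \mathrm{GL}(X) \mid \pi_X(T) < 0 \text{ and } p^{(0, +\infty)}(T) = 1\}$, containing all antireflections of $X$.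
   Context: Banach spaces are infinite-dimensional. A subspace of a Banach space means an infinite-dimensional closed subspace; operators are bounded and linear; hyperplanes are closed subspaces of codimension $1$. A Banach space is hereditarily indecomposable (HI) if it contains no topological direct sum of two subspaces, i.e. there are no infinite-dimensional closed subspaces $Y,Z$ with $Y\cap Z=\{0\}$ and $Y+Z$ closed. $\mathcal{L}(X)$ is the algebra of operators on $X$ and $\mathrm{GL}(X)$ its group of invertible elements, both with the operator norm topology. An operator on $X$ is strictly singular if it induces no isomorphism between two subspaces of $X$; the set $\mathcal{S}(X)$ of these is a closed two-sided ideal of $\mathcal{L}(X)$, and $\pi_X\colon\mathcal{L}(X)\to\mathcal{L}(X)/\mathcal{S}(X)$ is the projection. The subalgebra of $\mathcal{L}(X)/\mathcal{S}(X)$ generated by the image of the identity is identified with $\mathbb{R}$. A real HI space $X$ has type $\mathbb{R}$ if $\mathcal{L}(X)/\mathcal{S}(X)$ is isomorphic, as a unital Banach algebra, to $\mathbb{R}$; in this case $\pi_X$ takes values in $\mathbb{R}$, and $\pi_X(T)\neq 0$ for $T\in\mathrm{GL}(X)$. The spectrum $\sigma(T)\subseteq\mathbb{C}$ of $T\in\mathcal{L}(X)$, its eigenvalues and their multiplicities, are those of the complexification $T^{\mathbb{C}}(x+iy)=T(x)+iT(y)$ acting on the complexification $X^{\mathbb{C}}$ of $X$ (formal sums $x+iy$, $x,y\in X$, with norm $\|x+iy\|=\sup_{\theta\in\mathbb{R}}\|\cos\theta\cdot x+\sin\theta\cdot y\|$); multiplicity means algebraic multiplicity. For an open interval $I$ of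 $\mathbb{R}$, with boundary $\partial I$ in $\mathbb{R}$, $\mathrm{NS}^I(X)$ is the set of $T\in\mathcal{L}(X)$ with $\pi_X(T)\notin I$ and $\sigma(T)\cap\partial I=\varnothing$. For $T\in\mathrm{NS}^I(X)$, $\sigma(T)\cap I$ consists of finitely many isolated eigenvalues with finite multiplicities, and $p^I(T)\in\mathbb{Z}/2\mathbb{Z}$ denotes the parity of the sum of the multiplicities of the eigenvalues of $T$ contained in $I$. A reflection of $X$ is an operator $R\in\mathcal{L}(X)$ for which there exist a hyperplane $H\subseteq X$ and $x_0\in X\setminus\{0\}$ with $R(x)=x$ for all $x\in H$ and $R(x_0)=-x_0$. An antireflection is an operator of the form $-R$ with $R$ a reflection. *)

theory Defs
  imports
    "HOL-Analysis.Analysis"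
    "HOL-Algebra.QuotRing"
    "HOL-Library.Z2"
begin

section \<open>Infinite-dimensional subspaces and hereditary indecomposability\<close>

definition infinite_dimensional :: "'a::real_vector set \<Rightarrow> bool" where
  "infinite_dimensional S \<longleftrightarrow> \<not> (\<exists>B. finite B \<and> S \<subseteq> span B)"

definition inf_closed_subspace :: "'a::real_normed_vector set \<Rightarrow> bool" where
  "inf_closed_subspace Y \<longleftrightarrow> subspace Y \<and> closed Y \<and> infinite_dimensional Y"

definition hereditarily_indecomposable :: "'a::banach itself \<Rightarrow> bool" where
  "hereditarily_indecomposable _ \<longleftrightarrow>
     \<not> (\<exists>Y Z :: 'a set. inf_closed_subspace Y \<and> inf_closed_subspace Z \<and>
          Y \<inter> Z = {0} \<and> closed {y + z | y z. y \<in> Y \<and> z \<in> Z})"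


section \<open>The algebra of operators and its quotient by the strictly singular ones\<close>

definition GL :: "('a::real_normed_vector \<Rightarrow>\<^sub>L 'a) set" where
  "GL = {T. \<exists>S. S o\<^sub>L T = id_blinfun \<and> T o\<^sub>L S = id_blinfun}"

definition strictly_singular :: "('a::real_normed_vector \<Rightarrow>\<^sub>L 'a) set" where
  "strictly_singular =
     {T. \<not> (\<exists>Y Z g. inf_closed_subspace Y \<and> inf_closed_subspace Z \<and>
              homeomorphism Y Z (blinfun_apply T) g)}"

definition operator_ring :: "('a::real_normed_vector \<Rightarrow>\<^sub>L 'a) ring" where
  "operator_ring = \<lparr>carrier = UNIV, mult = (o\<^sub>L), one = id_blinfun, zero = 0, add = (+)\<rparr>"

definition real_ring :: "real ring" where
  "real_ring = \<lparr>carrier = UNIV, mult = (*), one = 1, zero = 0, add = (+)\<rparr>"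

definition op_class ::
  "('a::real_normed_vector \<Rightarrow>\<^sub>L 'a) \<Rightarrow> ('a \<Rightarrow>\<^sub>L 'a) set" where
  "op_class T = strictly_singular +>\<^bsub>operator_ring\<^esub> T"

definition quotient_norm :: "('a::real_normed_vector \<Rightarrow>\<^sub>L 'a) set \<Rightarrow> real" where
  "quotient_norm A = (INF T\<in>A. norm T)"

text \<open>
  An isomorphism of unital Banach algebras is a unital algebra isomorphism that is bounded
  with bounded inverse. Ring isomorphisms in \<^const>\<open>ring_iso\<close> preserve the unit; real
  homogeneity and the two norm estimates are added.
\<close>

definition type_R :: "'a::banach itself \<Rightarrow> bool" where
  "type_R _ \<longleftrightarrow>
     (\<exists>h \<in> ring_iso ((operator_ring :: ('a \<Rightarrow>\<^sub>L 'a) ring) Quot strictly_singular) real_ring.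
        (\<forall>r T. h (op_class (r *\<^sub>R T)) = r * h (op_class T)) \<and>
        (\<exists>K. \<forall>T. \<bar>h (op_class T)\<bar> \<le> K * quotient_norm (op_class T)) \<and>
        (\<exists>K. \<forall>T. quotient_norm (op_class T) \<le> K * \<bar>h (op_class T)\<bar>))"

text \<open>
  The class of \<open>r\<close> times the identity is identified with the real number \<open>r\<close>; for a space of
  type \<open>R\<close> every class has this form for exactly one \<open>r\<close>, see \<open>type_R_ex1\<close> below.
\<close>

definition pi_X :: "('a::real_normed_vector \<Rightarrow>\<^sub>L 'a) \<Rightarrow> real" where
  "pi_X T = (THE r. op_class T = op_class (r *\<^sub>R id_blinfun))"

lemma type_R_ex1:
  fixes T :: "'a::banach \<Rightarrow>\<^sub>L 'a"
  assumes "type_R TYPE('a)"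
  shows "\<exists>!r. op_class T = op_class (r *\<^sub>R id_blinfun)"
proof -
  let ?Q = "(operator_ring :: ('a \<Rightarrow>\<^sub>L 'a) ring) Quot strictly_singular"
  obtain h where h: "h \<in> ring_iso ?Q real_ring"
    and lin: "\<And>r T. h (op_class (r *\<^sub>R T)) = r * h (op_class T)"
    using assms unfolding type_R_def by blast
  have carr: "op_class S \<in> carrier ?Q" for S :: "'a \<Rightarrow>\<^sub>L 'a"
    by (auto simp: FactRing_def A_RCOSETS_def' a_r_coset_def' op_class_def operator_ring_def)
  have inj: "inj_on h (carrier ?Q)"
    using h by (simp add: ring_iso_def bij_betw_def)
  have "h (one ?Q) = 1"
    using ring_iso_memE(4)[OF h] by (simp add: real_ring_def)
  then have one: "h (op_class id_blinfun) = 1"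
    by (simp add: FactRing_def op_class_def operator_ring_def)
  have id: "h (op_class (r *\<^sub>R id_blinfun)) = r" for r
    by (simp add: lin one)
  show ?thesis
  proof (rule ex1I)
    show "op_class T = op_class (h (op_class T) *\<^sub>R id_blinfun)"
      by (rule inj_onD[OF inj _ carr carr]) (simp add: id)
    show "r = h (op_class T)" if "op_class T = op_class (r *\<^sub>R id_blinfun)" for r
      using id[of r] that by simp
  qed
qed


section \<open>Complexification, spectrum and multiplicities\<close>

text \<open>
  The formal sum \<open>x + iy\<close> is the pair \<open>(x, y)\<close>. The complex scalar multiplication and the norm
  are the ones given here; the norm of the library's product type is not used.
\<close>

definition cscale :: "complex \<Rightarrow> 'a::real_vector \<times> 'a \<Rightarrow> 'a \<times> 'a" where
  "cscale c z = (Re c *\<^sub>R fst z - Im c *\<^sub>R snd z, Im c *\<^sub>R fst z + Re c *\<^sub>R snd z)"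

definition cnorm :: "'a::real_normed_vector \<times> 'a \<Rightarrow> real" where
  "cnorm z = (SUP \<theta>::real. norm (cos \<theta> *\<^sub>R fst z + sin \<theta> *\<^sub>R snd z))"

definition coperator :: "('a::real_normed_vector \<times> 'a \<Rightarrow> 'a \<times> 'a) \<Rightarrow> bool" where
  "coperator S \<longleftrightarrow>
     Vector_Spaces.linear cscale cscale S \<and> (\<exists>K. \<forall>z. cnorm (S z) \<le> K * cnorm z)"

definition complexify ::
  "('a::real_normed_vector \<Rightarrow>\<^sub>L 'a) \<Rightarrow> 'a \<times> 'a \<Rightarrow> 'a \<times> 'a" where
  "complexify T z = (T (fst z), T (snd z))"

definition shifted ::
  "('a::real_normed_vector \<Rightarrow>\<^sub>L 'a) \<Rightarrow> complex \<Rightarrow> 'a \<times> 'a \<Rightarrow> 'a \<times> 'a" where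
  "shifted T \<mu> z = complexify T z - cscale \<mu> z"

definition spectrum :: "('a::real_normed_vector \<Rightarrow>\<^sub>L 'a) \<Rightarrow> complex set" where
  "spectrum T = {\<mu>. \<not> (\<exists>S. coperator S \<and> S \<circ> shifted T \<mu> = id \<and> shifted T \<mu> \<circ> S = id)}"

definition eigenvalue :: "('a::real_normed_vector \<Rightarrow>\<^sub>L 'a) \<Rightarrow> complex \<Rightarrow> bool" where
  "eigenvalue T \<mu> \<longleftrightarrow> (\<exists>z. z \<noteq> 0 \<and> complexify T z = cscale \<mu> z)"

lemma vector_space_cscale: "vector_space cscale"
  by unfold_locales (auto simp: cscale_def algebra_simps)

text \<open>
  Algebraic multiplicity: the complex dimension of the generalized eigenspace. Note that the
  library's dimension of an infinite-dimensional space is \<open>0\<close>.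
\<close>

definition alg_multiplicity :: "('a::real_normed_vector \<Rightarrow>\<^sub>L 'a) \<Rightarrow> complex \<Rightarrow> nat" where
  "alg_multiplicity T \<mu> = vector_space.dim cscale {z. \<exists>n. (shifted T \<mu> ^^ n) z = 0}"


section \<open>The parity and the four subsets of the general linear group\<close>

definition NS :: "real set \<Rightarrow> ('a::real_normed_vector \<Rightarrow>\<^sub>L 'a) set" where
  "NS I = {T. pi_X T \<notin> I \<and> spectrum T \<inter> complex_of_real ` frontier I = {}}"

text \<open>
  Only meaningful for operators in \<open>NS I\<close>, where the sum and the multiplicities are finite. The
  lemmas \<open>GL_NS_neg\<close> and \<open>GL_NS_pos\<close> below show that this is the case wherever it is used.
\<close>

definition eigen_parity :: "real set \<Rightarrow> ('a::real_normed_vector \<Rightarrow>\<^sub>L 'a) \<Rightarrow> bit" where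
  "eigen_parity I T =
     of_nat (\<Sum>\<mu>\<in>{\<mu>. eigenvalue T \<mu> \<and> \<mu> \<in> complex_of_real ` I}. alg_multiplicity T \<mu>)"

definition GL_plus :: "bit \<Rightarrow> ('a::real_normed_vector \<Rightarrow>\<^sub>L 'a) set" where
  "GL_plus k = {T \<in> GL. pi_X T > 0 \<and> eigen_parity {..<0} T = k}"

definition GL_minus :: "bit \<Rightarrow> ('a::real_normed_vector \<Rightarrow>\<^sub>L 'a) set" where
  "GL_minus k = {T \<in> GL. pi_X T < 0 \<and> eigen_parity {0<..} T = k}"

lemma bdd_above_cnorm:
  "bdd_above (range (\<lambda>\<theta>. norm (cos \<theta> *\<^sub>R x + sin \<theta> *\<^sub>R (y::'a::real_normed_vector))))"
proof (rule bdd_aboveI2)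
  fix \<theta> :: real
  have "norm (cos \<theta> *\<^sub>R x + sin \<theta> *\<^sub>R y) \<le> \<bar>cos \<theta>\<bar> * norm x + \<bar>sin \<theta>\<bar> * norm y"
    by (metis norm_scaleR norm_triangle_ineq)
  also have "\<dots> \<le> 1 * norm x + 1 * norm y"
    by (intro add_mono mult_right_mono) auto
  finally show "norm (cos \<theta> *\<^sub>R x + sin \<theta> *\<^sub>R y) \<le> norm x + norm y"
    by simp
qed

lemma coperator_complexify: "coperator (complexify T)"
proof -
  have "cnorm (complexify T z) \<le> norm T * cnorm z" for z
    unfolding cnorm_def
  proof (rule cSUP_least)
    fix \<theta> :: real
    have "norm (cos \<theta> *\<^sub>R fst (complexify T z) + sin \<theta> *\<^sub>R snd (complexify T z))
        = norm (T (cos \<theta> *\<^sub>R fst z + sin \<theta> *\<^sub>R snd z))"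
      by (simp add: complexify_def blinfun.bilinear_simps)
    also have "\<dots> \<le> norm T * norm (cos \<theta> *\<^sub>R fst z + sin \<theta> *\<^sub>R snd z)"
      by (rule norm_blinfun)
    also have "\<dots> \<le> norm T * (SUP \<theta>. norm (cos \<theta> *\<^sub>R fst z + sin \<theta> *\<^sub>R snd z))"
      by (intro mult_left_mono cSUP_upper bdd_above_cnorm) auto
    finally show "norm (cos \<theta> *\<^sub>R fst (complexify T z) + sin \<theta> *\<^sub>R snd (complexify T z))
        \<le> norm T * (SUP \<theta>. norm (cos \<theta> *\<^sub>R fst z + sin \<theta> *\<^sub>R snd z))" .
  qed simp
  moreover have "Vector_Spaces.linear cscale cscale (complexify T)"
    unfolding Vector_Spaces.linear_iff
    by (auto simp: vector_space_cscale complexify_def cscale_def blinfun.bilinear_simps)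
  ultimately show ?thesis
    unfolding coperator_def by blast
qed

lemma GL_zero_notin_spectrum:
  assumes "T \<in> GL"
  shows "0 \<notin> spectrum T"
proof -
  obtain S where S: "S o\<^sub>L T = id_blinfun" "T o\<^sub>L S = id_blinfun"
    using assms unfolding GL_def by blast
  have "S (T x) = x" "T (S x) = x" for x
    by (metis S blinfun_apply_blinfun_compose blinfun_apply_id_blinfun)+
  then have "complexify S \<circ> shifted T 0 = id" "shifted T 0 \<circ> complexify S = id"
    by (auto simp: fun_eq_iff shifted_def complexify_def cscale_def zero_prod_def)
  then show ?thesis
    unfolding spectrum_def using coperator_complexify by blast
qed

lemma GL_NS_neg: "T \<in> GL \<Longrightarrow> pi_X T > 0 \<Longrightarrow> T \<in> NS {..<0}"
  using GL_zero_notin_spectrum by (auto simp: NS_def)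

lemma GL_NS_pos: "T \<in> GL \<Longrightarrow> pi_X T < 0 \<Longrightarrow> T \<in> NS {0<..}"
  using GL_zero_notin_spectrum by (auto simp: NS_def)


section \<open>Reflections\<close>

definition is_hyperplane :: "'a::real_normed_vector set \<Rightarrow> bool" where
  "is_hyperplane H \<longleftrightarrow> subspace H \<and> closed H \<and> (\<exists>v. v \<notin> H \<and> span (insert v H) = UNIV)"

definition reflections :: "('a::real_normed_vector \<Rightarrow>\<^sub>L 'a) set" where
  "reflections =
     {R :: 'a \<Rightarrow>\<^sub>L 'a. \<exists>H x0. is_hyperplane H \<and> x0 \<noteq> 0 \<and> (\<forall>x\<in>H. R x = x) \<and> R x0 = - x0}"

definition antireflections :: "('a::real_normed_vector \<Rightarrow>\<^sub>L 'a) set" where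
  "antireflections = uminus ` reflections"

end

theory Submission
  imports Defs "Jordan_Normal_Form.Determinant"
begin

text \<open>
  Since the space has type \<open>R\<close>, every operator is a scalar plus a strictly singular operator, and
  with nonzero scalar part it is an invertible operator plus one of finite rank. If \<open>pi_X T > 0\<close>,
  the spectrum of \<open>T\<close> in \<open>(-\<infinity>, 0]\<close> therefore consists of finitely many eigenvalues of finite multiplicity.
  Reflecting their generalized eigenspaces gives \<open>T = T' J\<close>, where \<open>T'\<close> has no spectrum in \<open>(-\<infinity>, 0]\<close>,
  so that the segment from \<open>T'\<close> to the identity is invertible, and \<open>J\<close> is a product of as many rank-one
  reflections as the sum of the multiplicities. Rank-one reflections lie in a single component and
  are involutions, so the component of \<open>T\<close> depends only on the parity of that number.

  Conversely, if \<open>T = T' J\<close> with both \<open>T\<close> and \<open>T'\<close> without spectrum in \<open>(-\<infinity>, 0]\<close>, then \<open>J\<close> is joined to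
  the identity by invertible finite-rank perturbations of the identity, so it has positive
  determinant and the number of reflections is even. Hence the parity of any such factorization is
  determined by \<open>T\<close>, and it is locally constant because having no spectrum in \<open>(-\<infinity>, 0]\<close> is an open condition.
\<close>

section \<open>Norming functionals\<close>

text \<open>The scalars are real, so spectral projections are not taken from contour integrals; they
  come from the kernels of powers of the shifts T + t with t real. Strict singularity only excludes
  lower bounds on subspaces. It becomes an estimate: for c nonzero, c + S is bounded below up to
  finitely many functionals, since otherwise c + S would be small on some infinite-dimensional
  subspace and S bounded below there. The estimate holds along the whole line c + s S. Operators
  that are invertible plus finite rank form an open set, relatively closed among the operators with
  the estimate, so the property passes from c to c + S. Finiteness of the nonpositive spectrum rests
  on a dichotomy at each t \<ge> 0. If the kernels of the powers of T + t stabilize, all other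
  nearby shifts are invertible; if not, all nearby shifts have eigenvectors. Both cases are open in
  t and the first holds for large t, so it holds throughout. Determinants are taken only of matrices
  over a finite biorthogonal system that carries the functionals of the reflections. The case of
  negative scalar part follows through T \<mapsto> - T.\<close>

text \<open>Only an inequality for positive scalars is demanded, because that is what passes to
  infima. Equality follows by using it for c and for its inverse.\<close>

definition sublinear :: "('a::real_vector \<Rightarrow> real) \<Rightarrow> bool" where
  "sublinear p \<longleftrightarrow> (\<forall>x y. p (x + y) \<le> p x + p y) \<and> (\<forall>c x. c > 0 \<longrightarrow> p (c *\<^sub>R x) \<le> c * p x)"

lemma sublinear_add: "sublinear p \<Longrightarrow> p (x + y) \<le> p x + p y"
  by (simp add: sublinear_def)

lemma sublinear_zero: "sublinear p \<Longrightarrow> p 0 = 0"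
proof -
  assume p: "sublinear p"
  then have *: "\<forall>c x. c > 0 \<longrightarrow> p (c *\<^sub>R x) \<le> c * p x"
    by (simp add: sublinear_def)
  show ?thesis using *[rule_format, of 2 0] *[rule_format, of "1/2" 0] by simp
qed

lemma sublinear_scaleR:
  assumes "sublinear p" "c \<ge> 0"
  shows "p (c *\<^sub>R x) = c * p x"
proof (cases "c = 0")
  case False
  then have c: "c > 0" using assms by simp
  have "p (c *\<^sub>R x) \<le> c * p x" using assms c by (simp add: sublinear_def)
  moreover have "p (inverse c *\<^sub>R (c *\<^sub>R x)) \<le> inverse c * p (c *\<^sub>R x)"
    using assms c inverse_positive_iff_positive unfolding sublinear_def by blast
  then have "c * p x \<le> p (c *\<^sub>R x)" using c by (simp add: field_simps)
  ultimately show ?thesis by simp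
qed (use assms in \<open>simp add: sublinear_zero\<close>)

lemma sublinear_ge: "sublinear p \<Longrightarrow> - p (- x) \<le> p x"
  using sublinear_add[of p x "- x"] sublinear_zero[of p] by simp

text \<open>The lowering step in the proof of Hahn-Banach by minimal sublinear functionals. The
  result is still sublinear and below p, and its value at - v is at most - p v, the value there of
  any linear functional that agrees with p at v.\<close>

definition lowered :: "('a::real_vector \<Rightarrow> real) \<Rightarrow> 'a \<Rightarrow> 'a \<Rightarrow> real" where
  "lowered p v x = (INF t\<in>{0..}. p (x + t *\<^sub>R v) - t * p v)"

lemma lowered_le:
  assumes "sublinear p" "t \<ge> 0"
  shows "lowered p v x \<le> p (x + t *\<^sub>R v) - t * p v"
  unfolding lowered_def
proof (rule cINF_lower)
  show "bdd_below ((\<lambda>t. p (x + t *\<^sub>R v) - t * p v) ` {0..})"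
  proof (rule bdd_belowI2)
    fix t :: real assume "t \<in> {0..}"
    then have "t * p v = p (t *\<^sub>R v)" using sublinear_scaleR[OF assms(1)] by simp
    also have "\<dots> \<le> p (x + t *\<^sub>R v) + p (- x)"
      using sublinear_add[OF assms(1), of "x + t *\<^sub>R v" "- x"] by simp
    finally show "- p (- x) \<le> p (x + t *\<^sub>R v) - t * p v" by simp
  qed
qed (use assms in auto)

text \<open>Parameters s and t for two summands give the parameter t + s for the sum, and scaling
  the vector by c scales the parameter by c.\<close>

lemma lowered_sublinear:
  assumes p: "sublinear p"
  shows "sublinear (lowered p v)"
  unfolding sublinear_def
proof (intro conjI allI impI)
  fix x y
  have "lowered p v (x + y) - lowered p v x \<le> lowered p v y"
    unfolding lowered_def[of p v y]
  proof (rule cINF_greatest)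
    fix s :: real assume s: "s \<in> {0..}"
    have "lowered p v (x + y) - (p (y + s *\<^sub>R v) - s * p v) \<le> lowered p v x"
      unfolding lowered_def[of p v x]
    proof (rule cINF_greatest)
      fix t :: real assume t: "t \<in> {0..}"
      have "lowered p v (x + y) \<le> p ((x + y) + (t + s) *\<^sub>R v) - (t + s) * p v"
        by (rule lowered_le[OF p]) (use s t in auto)
      also have "(x + y) + (t + s) *\<^sub>R v = (x + t *\<^sub>R v) + (y + s *\<^sub>R v)"
        by (simp add: algebra_simps)
      also have "p \<dots> \<le> p (x + t *\<^sub>R v) + p (y + s *\<^sub>R v)" by (rule sublinear_add[OF p])
      finally show "lowered p v (x + y) - (p (y + s *\<^sub>R v) - s * p v) \<le> p (x + t *\<^sub>R v) - t * p v"
        by (simp add: algebra_simps)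
    qed simp
    then show "lowered p v (x + y) - lowered p v x \<le> p (y + s *\<^sub>R v) - s * p v"
      by simp
  qed simp
  then show "lowered p v (x + y) \<le> lowered p v x + lowered p v y" by simp
next
  fix c :: real and x assume c: "c > 0"
  have "lowered p v (c *\<^sub>R x) / c \<le> lowered p v x"
    unfolding lowered_def[of p v x]
  proof (rule cINF_greatest)
    fix t :: real assume t: "t \<in> {0..}"
    have "lowered p v (c *\<^sub>R x) \<le> p (c *\<^sub>R x + (c * t) *\<^sub>R v) - (c * t) * p v"
      by (rule lowered_le[OF p]) (use c t in auto)
    also have "c *\<^sub>R x + (c * t) *\<^sub>R v = c *\<^sub>R (x + t *\<^sub>R v)" by (simp add: algebra_simps)
    also have "p \<dots> = c * p (x + t *\<^sub>R v)" using sublinear_scaleR[OF p] c by simp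
    finally show "lowered p v (c *\<^sub>R x) / c \<le> p (x + t *\<^sub>R v) - t * p v"
      using c by (simp add: field_simps)
  qed simp
  then show "lowered p v (c *\<^sub>R x) \<le> c * lowered p v x" using c by (simp add: field_simps)
qed

lemma lowered_le_self: "sublinear p \<Longrightarrow> lowered p v x \<le> p x"
  using lowered_le[of p 0 v x] by simp

lemma lowered_minus: "sublinear p \<Longrightarrow> lowered p v (- v) \<le> - p v"
  using lowered_le[of p 1 v "- v"] sublinear_zero[of p] by simp

text \<open>The common upper bound q keeps the infimum finite, since every member is at least - q (-
  x) at x. Subadditivity of the infimum needs the chain: two members, one for each summand, are
  replaced by the smaller of them.\<close>

lemma sublinear_INF_chain:
  fixes q :: "'a::real_vector \<Rightarrow> real"
  assumes C: "C \<noteq> {}" "\<And>p. p \<in> C \<Longrightarrow> sublinear p" "\<And>p. p \<in> C \<Longrightarrow> p \<le> q"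
    and chain: "\<And>p p'. p \<in> C \<Longrightarrow> p' \<in> C \<Longrightarrow> p \<le> p' \<or> p' \<le> p"
  shows "sublinear (\<lambda>x. INF p\<in>C. p x)" and "\<And>p. p \<in> C \<Longrightarrow> (\<lambda>x. INF p\<in>C. p x) \<le> p"
proof -
  have lo: "(INF p\<in>C. p x) \<le> p x" if "p \<in> C" for p x
  proof (rule cINF_lower[OF _ that])
    show "bdd_below ((\<lambda>p. p x) ` C)"
    proof (rule bdd_belowI2)
      fix p assume p: "p \<in> C"
      have "- q (- x) \<le> - p (- x)" using C(3)[OF p] by (simp add: le_fun_def)
      also have "\<dots> \<le> p x" by (rule sublinear_ge[OF C(2)[OF p]])
      finally show "- q (- x) \<le> p x" .
    qed
  qed
  show "sublinear (\<lambda>x. INF p\<in>C. p x)"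
    unfolding sublinear_def
  proof (intro conjI allI impI)
    fix x y
    have "(INF p\<in>C. p (x + y)) - (INF p\<in>C. p x) \<le> (INF p\<in>C. p y)"
    proof (rule cINF_greatest[OF C(1)])
      fix p assume p: "p \<in> C"
      have "(INF p\<in>C. p (x + y)) - p y \<le> (INF p\<in>C. p x)"
      proof (rule cINF_greatest[OF C(1)])
        fix p' assume p': "p' \<in> C"
        obtain r where r: "r \<in> C" "r \<le> p" "r \<le> p'" using chain[OF p p'] p p' by blast
        have "(INF p\<in>C. p (x + y)) \<le> r (x + y)" by (rule lo[OF r(1)])
        also have "\<dots> \<le> r x + r y" by (rule sublinear_add[OF C(2)[OF r(1)]])
        also have "\<dots> \<le> p' x + p y" using r(2,3) by (simp add: le_fun_def add_mono)
        finally show "(INF p\<in>C. p (x + y)) - p y \<le> p' x" by simp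
      qed
      then show "(INF p\<in>C. p (x + y)) - (INF p\<in>C. p x) \<le> p y" by simp
    qed
    then show "(INF p\<in>C. p (x + y)) \<le> (INF p\<in>C. p x) + (INF p\<in>C. p y)" by simp
  next
    fix c :: real and x assume c: "c > 0"
    have "(INF p\<in>C. p (c *\<^sub>R x)) / c \<le> (INF p\<in>C. p x)"
    proof (rule cINF_greatest[OF C(1)])
      fix p assume p: "p \<in> C"
      have "(INF p\<in>C. p (c *\<^sub>R x)) \<le> p (c *\<^sub>R x)" by (rule lo[OF p])
      also have "\<dots> = c * p x" using sublinear_scaleR[OF C(2)[OF p]] c by simp
      finally show "(INF p\<in>C. p (c *\<^sub>R x)) / c \<le> p x" using c by (simp add: field_simps)
    qed
    then show "(INF p\<in>C. p (c *\<^sub>R x)) \<le> c * (INF p\<in>C. p x)" using c by (simp add: field_simps)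
  qed
  show "(\<lambda>x. INF p\<in>C. p x) \<le> p" if "p \<in> C" for p
    using lo[OF that] by (simp add: le_fun_def)
qed

text \<open>A minimal sublinear functional agrees with each of its lowerings, hence is odd, hence linear.\<close>

lemma sublinear_dominates_linear:
  fixes q :: "'a::real_vector \<Rightarrow> real"
  assumes q: "sublinear q"
  obtains f where "linear f" "\<And>x. f x \<le> q x"
proof -
  define A where "A = {p. sublinear p \<and> p \<le> q}"
  \<comment> \<open>The order is reversed so that the maximal element supplied by Zorn's lemma is a
    minimal sublinear functional.\<close>
  define R where "R = (\<lambda>p p' :: 'a \<Rightarrow> real. p' \<le> p)"
  have "\<exists>m\<in>A. \<forall>p\<in>A. R m p \<longrightarrow> p = m"
  proof (rule predicate_Zorn)
    show "partial_order_on A (relation_of R A)"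
      by (rule partial_order_on_relation_ofI) (auto simp: R_def)
    fix C assume C: "C \<in> Chains (relation_of R A)"
    have CA: "p \<in> A" if "p \<in> C" for p
      using C that by (auto simp: Chains_def relation_of_def)
    show "\<exists>u\<in>A. \<forall>p\<in>C. R p u"
    proof (cases "C = {}")
      case True then show ?thesis using q by (auto simp: A_def)
    next
      case False
      have ch: "p \<le> p' \<or> p' \<le> p" if "p \<in> C" "p' \<in> C" for p p'
        using C that by (auto simp: Chains_def relation_of_def R_def)
      let ?u = "\<lambda>x. INF p\<in>C. p x"
      have sl: "sublinear p" and pq: "p \<le> q" if "p \<in> C" for p
        using CA[OF that] by (auto simp: A_def)
      note u = sublinear_INF_chain[OF False sl pq ch]
      have "?u \<in> A" using u(1) u(2) False pq by (auto simp: A_def intro: order_trans)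
      then show ?thesis using u(2) by (auto simp: R_def)
    qed
  qed
  then obtain f where fA: "f \<in> A" and min: "\<And>p. p \<in> A \<Longrightarrow> p \<le> f \<Longrightarrow> p = f"
    unfolding R_def by blast
  have f: "sublinear f" and fq: "f \<le> q" using fA by (auto simp: A_def)
  have odd: "f (- v) = - f v" for v
  proof -
    have le: "lowered f v \<le> f" using lowered_le_self[OF f] by (simp add: le_fun_def)
    have "lowered f v = f"
      by (rule min) (use le fq lowered_sublinear[OF f] in \<open>auto simp: A_def\<close>)
    then have "f (- v) \<le> - f v" using lowered_minus[OF f, of v] by simp
    then show ?thesis using sublinear_ge[OF f, of v] by simp
  qed
  have add: "f (x + y) = f x + f y" for x y
  proof -
    have "f (- x + - y) \<le> f (- x) + f (- y)" by (rule sublinear_add[OF f])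
    then have "f (- (x + y)) \<le> f (- x) + f (- y)" by simp
    then have "f x + f y \<le> f (x + y)" by (simp add: odd del: minus_add_distrib)
    then show ?thesis using sublinear_add[OF f, of x y] by simp
  qed
  have sc: "f (c *\<^sub>R x) = c *\<^sub>R f x" for c x
  proof (cases "c \<ge> 0")
    case False
    then have "f (c *\<^sub>R x) = - f ((- c) *\<^sub>R x)" using odd[of "(- c) *\<^sub>R x"] by simp
    also have "\<dots> = c * f x" using sublinear_scaleR[OF f, of "- c" x] False by simp
    finally show ?thesis by simp
  qed (simp add: sublinear_scaleR[OF f])
  show thesis
    by (rule that[of f]) (use add sc fq in \<open>auto simp: linear_iff le_fun_def\<close>)
qed

text \<open>No extension from a line is needed: a linear functional dominated by
  \<open>lowered norm v\<close> satisfies f (- v) \<le> - norm v, hence attains the norm at v, and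
  it is still dominated by the norm.\<close>

lemma norming_functional:
  fixes v :: "'a::real_normed_vector"
  obtains f :: "'a \<Rightarrow>\<^sub>L real" where "f v = norm v" "\<And>x. \<bar>f x\<bar> \<le> norm x"
proof -
  have n: "sublinear (norm :: 'a \<Rightarrow> real)"
    by (auto simp: sublinear_def norm_triangle_ineq)
  obtain f where lin: "linear f" and le: "\<And>x. f x \<le> lowered norm v x"
    using sublinear_dominates_linear[OF lowered_sublinear[OF n, of v]] by blast
  have fx: "f x \<le> norm x" for x using le[of x] lowered_le_self[OF n, of v x] by linarith
  have abs: "\<bar>f x\<bar> \<le> norm x" for x
    using fx[of x] fx[of "- x"] linear_neg[OF lin, of x] by simp
  have "bounded_linear f"
    by (rule bounded_linear_intro[where K=1]) (use lin abs in \<open>auto simp: linear_add linear_cmul\<close>)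
  then have bl: "blinfun_apply (Blinfun f) = f" by (rule bounded_linear_Blinfun_apply)
  have "- f v \<le> - norm v"
    using le[of "- v"] lowered_minus[OF n, of v] linear_neg[OF lin, of v] by simp
  then have "f v = norm v" using fx[of v] by simp
  then show thesis using that[of "Blinfun f"] abs bl by simp
qed

lemma functional_eq_1:
  fixes v :: "'a::real_normed_vector"
  assumes "v \<noteq> 0"
  obtains f :: "'a \<Rightarrow>\<^sub>L real" where "f v = 1"
proof -
  obtain f :: "'a \<Rightarrow>\<^sub>L real" where f: "f v = norm v" by (rule norming_functional)
  show thesis
    by (rule that[of "(1 / norm v) *\<^sub>R f"]) (use assms f in \<open>simp add: blinfun.bilinear_simps\<close>)
qed

section \<open>The general linear group\<close>

lemma GL_I:
  fixes S T :: "'a::real_normed_vector \<Rightarrow>\<^sub>L 'a"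
  assumes "\<And>x. S (T x) = x" "\<And>x. T (S x) = x"
  shows "T \<in> GL"
  unfolding GL_def using assms by (auto intro!: exI[of _ S] blinfun_eqI)

lemma GL_E:
  fixes T :: "'a::real_normed_vector \<Rightarrow>\<^sub>L 'a"
  assumes "T \<in> GL"
  obtains S where "S \<in> GL" "\<And>x. S (T x) = x" "\<And>x. T (S x) = x"
proof -
  obtain S where S: "S o\<^sub>L T = id_blinfun" "T o\<^sub>L S = id_blinfun"
    using assms unfolding GL_def by blast
  have *: "S (T x) = x" "T (S x) = x" for x
    by (metis S blinfun_apply_blinfun_compose blinfun_apply_id_blinfun)+
  show thesis by (rule that[OF GL_I[of T S]]) (rule *)+
qed

lemma GL_id: "id_blinfun \<in> GL"
  by (rule GL_I[of id_blinfun]) auto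

lemma GL_compose:
  assumes "A \<in> GL" "B \<in> GL"
  shows "A o\<^sub>L B \<in> GL"
proof -
  obtain A' where A: "A' \<in> GL" "\<And>x. blinfun_apply A' (A x) = x" "\<And>x. A (A' x) = x"
    using GL_E[OF assms(1)] by metis
  obtain B' where B: "B' \<in> GL" "\<And>x. blinfun_apply B' (B x) = x" "\<And>x. B (B' x) = x"
    using GL_E[OF assms(2)] by metis
  show ?thesis by (rule GL_I[of "B' o\<^sub>L A'"]) (simp_all add: A B)
qed

lemma GL_scaleR:
  assumes "A \<in> GL" "c \<noteq> 0"
  shows "c *\<^sub>R A \<in> GL"
proof -
  obtain A' where A: "A' \<in> GL" "\<And>x. blinfun_apply A' (A x) = x" "\<And>x. A (A' x) = x"
    using GL_E[OF assms(1)] by metis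
  show ?thesis
    by (rule GL_I[of "(1/c) *\<^sub>R A'"]) (simp_all add: A assms(2) blinfun.scaleR_left blinfun.scaleR_right)
qed

lemma GL_uminus_iff: "- A \<in> GL \<longleftrightarrow> A \<in> GL"
proof -
  have "- B \<in> GL" if "B \<in> GL" for B :: "'a \<Rightarrow>\<^sub>L 'a"
    using GL_scaleR[OF that, of "-1"] by simp
  from this[of A] this[of "- A"] show ?thesis by auto
qed

lemma GL_eq_0_iff:
  assumes "A \<in> GL"
  shows "A x = 0 \<longleftrightarrow> x = 0"
proof -
  obtain S where S: "\<And>x. blinfun_apply S (A x) = x" using GL_E[OF assms] by metis
  show ?thesis using S[of x] by (auto simp: blinfun.zero_right)
qed

section \<open>Lower bounds, successive approximation and perturbation of invertible
  operators\<close>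

lemma GL_bounded_below_surj:
  assumes c: "c > 0" "\<And>x. c * norm x \<le> norm (blinfun_apply A x)" and surj: "\<And>y. \<exists>x. A x = y"
  shows "A \<in> GL"
proof -
  define g where "g = (\<lambda>y. SOME x. A x = y)"
  have Ag: "A (g y) = y" for y unfolding g_def by (rule someI_ex[OF surj])
  have inj: "x = y" if "A x = A y" for x y
    using c(2)[of "x - y"] c(1) that by (simp add: blinfun.diff_right mult_le_0_iff)
  have gA: "g (A x) = x" for x by (rule inj) (simp add: Ag)
  have "bounded_linear g"
  proof (rule bounded_linear_intro[where K="1/c"])
    show "g (x + y) = g x + g y" for x y by (rule inj) (simp add: Ag blinfun.add_right)
    show "g (r *\<^sub>R x) = r *\<^sub>R g x" for r x by (rule inj) (simp add: Ag blinfun.scaleR_right)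
    show "norm (g x) \<le> norm x * (1/c)" for x using c(2)[of "g x"] c(1) by (simp add: Ag field_simps)
  qed
  then show ?thesis by (intro GL_I[of "Blinfun g"]) (auto simp: bounded_linear_Blinfun_apply Ag gA)
qed

lemma GL_bounded_below:
  assumes "A \<in> GL"
  obtains c where "c > 0" "\<And>x. c * norm x \<le> norm (blinfun_apply A x)"
proof -
  obtain S where S: "\<And>x. blinfun_apply S (A x) = x" using GL_E[OF assms] by metis
  have "norm x \<le> (norm S + 1) * norm (A x)" for x
  proof -
    have "norm x = norm (S (A x))" by (simp add: S)
    also have "\<dots> \<le> norm S * norm (A x)" by (rule norm_blinfun)
    also have "\<dots> \<le> (norm S + 1) * norm (A x)" by (intro mult_right_mono) auto
    finally show ?thesis .
  qed
  then show thesis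
    by (intro that[of "1 / (norm S + 1)"]) (auto simp: field_simps add_pos_nonneg add_nonneg_pos)
qed

text \<open>The iteration behind the open mapping theorem. Residuals halve at each step, so the
  corrections are dominated by a geometric series and sum to an element of the closed subspace M;
  the factor 2 is the sum of that series. The set Y only has to contain all residuals, so the same
  lemma serves for the closure of an image and for the whole space.\<close>

lemma approx_surj:
  fixes B :: "'a::banach \<Rightarrow>\<^sub>L 'b::real_normed_vector"
  assumes M: "subspace M" "closed M" and C: "C \<ge> 0" and y: "y \<in> Y"
    and approx: "\<And>y. y \<in> Y \<Longrightarrow> \<exists>x\<in>M. y - B x \<in> Y \<and> norm x \<le> C * norm y \<and> norm (y - B x) \<le> norm y / 2"
  shows "\<exists>x\<in>M. B x = y \<and> norm x \<le> 2 * C * norm y"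
proof -
  obtain g where g: "\<And>y. y \<in> Y \<Longrightarrow> g y \<in> M \<and> y - B (g y) \<in> Y \<and> norm (g y) \<le> C * norm y \<and> norm (y - B (g y)) \<le> norm y / 2"
    using approx by metis
  define r where "r n = ((\<lambda>y. y - B (g y)) ^^ n) y" for n
  have rS: "r (Suc n) = r n - B (g (r n))" for n by (simp add: r_def)
  have rY: "r n \<in> Y" for n
  proof (induction n)
    case (Suc n) then show ?case unfolding rS using g by blast
  qed (simp add: r_def y)
  note gr = g[OF rY]
  have rn: "norm (r n) \<le> norm y * (1/2)^n" for n
  proof (induction n)
    case (Suc n)
    have "norm (r (Suc n)) \<le> norm (r n) / 2" unfolding rS using gr by blast
    with Suc show ?case by simp
  qed (simp add: r_def)
  have gn: "norm (g (r n)) \<le> C * norm y * (1/2)^n" for n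
    using gr[of n] mult_left_mono[OF rn[of n] C] by (simp add: mult.assoc)
  have geo: "(\<lambda>n. C * norm y * (1/2)^n) sums (C * norm y * 2)"
    using sums_mult[OF geometric_sums[of "1/2 :: real"], of "C * norm y"] by simp
  have sumg: "summable (\<lambda>n. norm (g (r n)))"
    by (rule summable_comparison_test[OF _ sums_summable[OF geo]]) (use gn in auto)
  define x where "x = (\<Sum>n. g (r n))"
  have sx: "(\<lambda>n. g (r n)) sums x"
    unfolding x_def by (rule summable_sums[OF summable_norm_cancel[OF sumg]])
  have "x \<in> M"
    using sx unfolding sums_def
    by (rule closed_sequentially[OF M(2), rotated]) (intro subspace_sum[OF M(1)], use gr in blast)
  have "(\<lambda>n. B (g (r n))) sums B x"
    by (rule bounded_linear.sums[OF blinfun.bounded_linear_right sx])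
  moreover have "(\<lambda>n. r n - r (Suc n)) sums (r 0 - 0)"
  proof (rule telescope_sums')
    have "(\<lambda>n. norm y * (1/2)^n) \<longlonglongrightarrow> 0"
      by (rule tendsto_mult_right_zero[OF LIMSEQ_power_zero]) simp
    then show "r \<longlonglongrightarrow> 0"
      by (rule Lim_null_comparison[rotated]) (use rn in auto)
  qed
  ultimately have "B x = y" by (simp add: rS sums_iff) (simp add: r_def)
  moreover have "norm x \<le> 2 * C * norm y"
  proof -
    have "norm x \<le> (\<Sum>n. norm (g (r n)))" unfolding x_def by (rule summable_norm[OF sumg])
    also have "\<dots> \<le> (\<Sum>n. C * norm y * (1/2)^n)" by (rule suminf_le[OF gn sumg sums_summable[OF geo]])
    also have "\<dots> = 2 * C * norm y" using geo by (simp add: sums_iff)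
    finally show ?thesis .
  qed
  ultimately show ?thesis using \<open>x \<in> M\<close> by blast
qed

text \<open>Subtracting D costs at most norm D in the lower bound. For surjectivity, a solution of
  (B + D) x = y is a fixed point of the map sending x to the B-preimage of y - D x, which contracts
  by the factor norm D / c.\<close>

lemma GL_perturb:
  fixes B :: "'a::banach \<Rightarrow>\<^sub>L 'a"
  assumes "B \<in> GL" and c: "\<And>x. c * norm x \<le> norm (B x)" and D: "norm D < c"
  shows "B + D \<in> GL"
proof (rule GL_bounded_below_surj)
  have c0: "c > 0" using D norm_ge_zero[of D] by linarith
  show "c - norm D > 0" using D by simp
  show low: "(c - norm D) * norm x \<le> norm ((B + D) x)" for x
  proof -
    have "c * norm x \<le> norm (B x)" by (rule c)
    also have "\<dots> = norm ((B + D) x - D x)" by (simp add: blinfun.bilinear_simps)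
    also have "\<dots> \<le> norm ((B + D) x) + norm (D x)" by (rule norm_triangle_ineq4)
    also have "\<dots> \<le> norm ((B + D) x) + norm D * norm x" by (intro add_left_mono norm_blinfun)
    finally show ?thesis by (simp add: algebra_simps)
  qed
  fix y
  obtain S where S: "\<And>x. blinfun_apply S (B x) = x" "\<And>x. B (S x) = x" using GL_E[OF assms(1)] by metis
  have Sle: "norm (S z) \<le> norm z / c" for z using c[of "S z"] c0 by (simp add: S field_simps)
  define q where "q = norm D / c"
  have q: "0 \<le> q" "q < 1" using D c0 by (auto simp: q_def)
  have "\<exists>!x. S (y - D x) = x"
  proof (rule banach_fix_type[OF q], intro allI)
    fix x x'
    have "dist (S (y - D x)) (S (y - D x')) = norm (S (D (x' - x)))"
      by (simp add: dist_norm blinfun.bilinear_simps)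
    also have "\<dots> \<le> norm (D (x' - x)) / c" by (rule Sle)
    also have "\<dots> \<le> norm D * norm (x' - x) / c"
      using c0 by (intro divide_right_mono norm_blinfun) auto
    finally show "dist (S (y - D x)) (S (y - D x')) \<le> q * dist x x'"
      by (simp add: q_def dist_norm norm_minus_commute)
  qed
  then obtain x where "S (y - D x) = x" by blast
  then have "y - D x = B x" using S(2)[of "y - D x"] by simp
  then show "\<exists>x. (B + D) x = y" by (intro exI[of _ x]) (simp add: blinfun.bilinear_simps algebra_simps)
qed

lemma open_GL: "open (GL :: ('a::banach \<Rightarrow>\<^sub>L 'a) set)"
  unfolding open_dist
proof
  fix B :: "'a \<Rightarrow>\<^sub>L 'a" assume B: "B \<in> GL"
  obtain c where c: "c > 0" "\<And>x. c * norm x \<le> norm (B x)" using GL_bounded_below[OF B] by blast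
  have "A \<in> GL" if "dist A B < c" for A
    using GL_perturb[OF B c(2), of "A - B"] that by (simp add: dist_norm)
  then show "\<exists>e>0. \<forall>A. dist A B < e \<longrightarrow> A \<in> GL" using c(1) by blast
qed

lemma GL_large_shift:
  fixes T :: "'a::banach \<Rightarrow>\<^sub>L 'a"
  assumes "norm T < \<bar>t\<bar>"
  shows "T + t *\<^sub>R id_blinfun \<in> GL"
proof -
  have "t *\<^sub>R id_blinfun + T \<in> GL"
    by (rule GL_perturb[where c="\<bar>t\<bar>", OF GL_scaleR[OF GL_id]]) (use assms norm_ge_zero[of T] in \<open>auto simp: blinfun.bilinear_simps\<close>)
  then show ?thesis by (simp add: add.commute)
qed

section \<open>Finite-dimensional spans\<close>

lemma infinite_dimensional_mono:
  "infinite_dimensional S \<Longrightarrow> S \<subseteq> T \<Longrightarrow> infinite_dimensional T"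
  unfolding infinite_dimensional_def by blast

lemma infinite_dimensional_kernel:
  fixes f :: "'a::real_normed_vector \<Rightarrow>\<^sub>L real"
  assumes Y: "subspace Y" "infinite_dimensional Y"
  shows "infinite_dimensional {y \<in> Y. f y = 0}"
proof (cases "\<exists>u\<in>Y. f u \<noteq> 0")
  case True
  then obtain u where u: "u \<in> Y" "f u \<noteq> 0" by blast
  show ?thesis
    unfolding infinite_dimensional_def
  proof (rule notI, elim exE conjE)
    fix B assume B: "finite B" "{y \<in> Y. f y = 0} \<subseteq> span B"
    have "Y \<subseteq> span (insert u B)"
    proof
      fix y assume y: "y \<in> Y"
      have "y - (f y / f u) *\<^sub>R u \<in> {y \<in> Y. f y = 0}"
        using y u Y(1) by (simp add: subspace_diff subspace_scale blinfun.bilinear_simps)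
      then show "y \<in> span (insert u B)" using B(2) by (auto simp: span_breakdown_eq)
    qed
    then show False using Y(2) B(1) unfolding infinite_dimensional_def by (metis finite_insert)
  qed
next
  case False
  then have "{y \<in> Y. f y = 0} = Y" by auto
  then show ?thesis using Y(2) by simp
qed

lemma inf_closed_subspace_kernel:
  fixes f :: "'a::real_normed_vector \<Rightarrow>\<^sub>L real"
  assumes "inf_closed_subspace Y"
  shows "inf_closed_subspace {y \<in> Y. f y = 0}"
proof -
  have "closed (Y \<inter> f -` {0})"
    using assms by (intro closed_Int continuous_closed_vimage) (auto simp: inf_closed_subspace_def intro!: continuous_intros)
  moreover have "Y \<inter> f -` {0} = {y \<in> Y. f y = 0}" by auto
  ultimately show ?thesis
    using assms infinite_dimensional_kernel[of Y f]
    by (auto simp: inf_closed_subspace_def subspace_def blinfun.bilinear_simps)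
qed

lemma inf_closed_subspace_kernels:
  fixes fs :: "('a::real_normed_vector \<Rightarrow>\<^sub>L real) list"
  assumes "inf_closed_subspace Y"
  shows "inf_closed_subspace {y \<in> Y. \<forall>f\<in>set fs. f y = 0}"
proof (induction fs)
  case (Cons f fs)
  have "{y \<in> Y. \<forall>g\<in>set (f # fs). g y = 0} = {y \<in> {y \<in> Y. \<forall>f\<in>set fs. f y = 0}. f y = 0}" by auto
  then show ?case using inf_closed_subspace_kernel[OF Cons] by simp
qed (use assms in simp)

lemma finite_span_of_injective_image:
  fixes S :: "'a::real_normed_vector \<Rightarrow>\<^sub>L 'b::real_normed_vector"
  assumes Y: "subspace Y" and inj: "\<And>y. y \<in> Y \<Longrightarrow> S y = 0 \<Longrightarrow> y = 0"
    and B: "finite B" "S ` Y \<subseteq> span B"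
  shows "\<exists>B'. finite B' \<and> Y \<subseteq> span B'"
proof -
  obtain C where C: "C \<subseteq> Y" "independent C" "Y \<subseteq> span C" using basis_exists[of Y] by metis
  have lin: "linear S" by (simp add: blinfun.bounded_linear_right bounded_linear.linear)
  have "span C \<subseteq> Y" using C(1) Y by (rule span_minimal)
  then have "inj_on S (span C)"
    using inj linear_injective_on_subspace_0[OF lin, of "span C"] by blast
  then have "independent (S ` C)" by (rule linear_independent_injective_image[OF lin C(2)])
  moreover have "S ` C \<subseteq> span B" using C(1) B(2) by blast
  ultimately have "finite (S ` C)" using independent_span_bound[OF B(1)] by blast
  moreover have "inj_on S C" using \<open>inj_on S (span C)\<close> inj_on_subset span_superset by blast
  ultimately have "finite C" using finite_imageD by blast
  then show ?thesis using C(3) by blast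
qed

lemma subspace_closure:
  fixes S :: "'a::real_normed_vector set"
  assumes S: "subspace S"
  shows "subspace (closure S)"
proof (rule subspaceI)
  show "0 \<in> closure S" using subspace_0[OF S] closure_subset by blast
next
  fix x y assume "x \<in> closure S" "y \<in> closure S"
  then obtain a b where "\<forall>n. a n \<in> S" "a \<longlonglongrightarrow> x" "\<forall>n. b n \<in> S" "b \<longlonglongrightarrow> y"
    unfolding closure_sequential by blast
  then show "x + y \<in> closure S"
    unfolding closure_sequential
    by (intro exI[of _ "\<lambda>n. a n + b n"]) (auto intro: tendsto_add subspace_add[OF S])
next
  fix c x assume "x \<in> closure S"
  then obtain a where "\<forall>n. a n \<in> S" "a \<longlonglongrightarrow> x"
    unfolding closure_sequential by blast
  then show "c *\<^sub>R x \<in> closure S"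
    unfolding closure_sequential
    by (intro exI[of _ "\<lambda>n. c *\<^sub>R a n"]) (auto intro: tendsto_scaleR subspace_scale[OF S])
qed

section \<open>Operators bounded below up to finitely many functionals\<close>

definition fsum :: "('a::real_normed_vector \<Rightarrow>\<^sub>L real) list \<Rightarrow> 'a \<Rightarrow> real" where
  "fsum fs x = (\<Sum>f\<leftarrow>fs. \<bar>blinfun_apply f x\<bar>)"

text \<open>On a closed subspace M of a Banach space this says that the restriction of A is upper
  semi-Fredholm (finite-dimensional kernel, closed image), in quantitative form. The functionals are
  kept in a list so that they can be removed one at a time by induction.\<close>

definition semi_est :: "('a::real_normed_vector \<Rightarrow>\<^sub>L 'b::real_normed_vector) \<Rightarrow> 'a set \<Rightarrow> bool" where
  "semi_est A M \<longleftrightarrow> (\<exists>(fs :: ('a \<Rightarrow>\<^sub>L real) list) C. C \<ge> 0 \<and>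
     (\<forall>x\<in>M. norm x \<le> C * (norm (A x) + fsum fs x)))"

lemma fsum_Nil [simp]: "fsum [] x = 0"
  by (simp add: fsum_def)

lemma fsum_Cons [simp]: "fsum (f # fs) x = \<bar>f x\<bar> + fsum fs x"
  by (simp add: fsum_def)

lemma fsum_nonneg: "0 \<le> fsum fs x"
  by (induction fs) auto

lemma fsum_eq_0: "(\<And>f. f \<in> set fs \<Longrightarrow> blinfun_apply f x = 0) \<Longrightarrow> fsum fs x = 0"
  by (induction fs) auto

lemma fsum_triangle: "fsum fs (x + c *\<^sub>R u) \<le> fsum fs x + \<bar>c\<bar> * fsum fs u"
proof (induction fs)
  case (Cons f fs)
  have "\<bar>f (x + c *\<^sub>R u)\<bar> \<le> \<bar>f x\<bar> + \<bar>c\<bar> * \<bar>f u\<bar>"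
    by (simp add: blinfun.bilinear_simps flip: abs_mult)
  with Cons show ?case by (simp add: algebra_simps)
qed simp

text \<open>A lower bound on the common kernel of finitely many functionals extends to M at the
  price of these functionals. If f u = 1, then x - f x u lies in the kernel of f, and the correction
  f x u is controlled by the new term |f x|. The contrapositive yields vectors killed by prescribed
  functionals on which A is small.\<close>

lemma semi_est_of_kernels:
  fixes A :: "'a::real_normed_vector \<Rightarrow>\<^sub>L 'b::real_normed_vector"
    and fs :: "('a \<Rightarrow>\<^sub>L real) list"
  assumes "subspace M" "C \<ge> 0"
    and "\<And>x. x \<in> M \<Longrightarrow> (\<And>f. f \<in> set fs \<Longrightarrow> f x = 0) \<Longrightarrow> norm x \<le> C * norm (A x)"
  shows "semi_est A M"
  using assms
proof (induction fs arbitrary: M)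
  case Nil
  then show ?case unfolding semi_est_def by (intro exI[of _ "[]"] exI[of _ C]) auto
next
  case (Cons f fs)
  show ?case
  proof (cases "\<exists>u\<in>M. f u \<noteq> 0")
    case False
    have "semi_est A {x \<in> M. True}"
      by (rule Cons.IH) (use Cons.prems False in auto)
    then show ?thesis by simp
  next
    case True
    then obtain u0 where u0: "u0 \<in> M" "f u0 \<noteq> 0" by blast
    define u where "u = (1 / f u0) *\<^sub>R u0"
    have u: "u \<in> M" "f u = 1"
      using u0 Cons.prems(1) by (auto simp: u_def subspace_scale blinfun.bilinear_simps)
    have "semi_est A {x \<in> M. f x = 0}"
    proof (rule Cons.IH)
      show "subspace {x \<in> M. f x = 0}"
        using Cons.prems(1) by (auto simp: subspace_def blinfun.bilinear_simps)
    qed (use Cons.prems in auto)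
    then obtain gs :: "('a \<Rightarrow>\<^sub>L real) list" and D where D: "D \<ge> 0"
      "\<And>x. x \<in> M \<Longrightarrow> f x = 0 \<Longrightarrow> norm x \<le> D * (norm (A x) + fsum gs x)"
      unfolding semi_est_def by auto
    define b where "b = norm (A u) + fsum gs u"
    have b: "b \<ge> 0" by (simp add: b_def fsum_nonneg)
    have "norm x \<le> (D + D * b + norm u) * (norm (A x) + fsum (f # gs) x)" if x: "x \<in> M" for x
    proof -
      let ?s = "fsum gs x"
      have s: "?s \<ge> 0" by (rule fsum_nonneg)
      define x' where "x' = x + (- f x) *\<^sub>R u"
      have "x' \<in> M" unfolding x'_def using x u Cons.prems(1) by (intro subspace_add subspace_scale)
      moreover have "f x' = 0" using u by (simp add: x'_def blinfun.bilinear_simps)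
      ultimately have "norm x' \<le> D * (norm (A x') + fsum gs x')" by (rule D(2))
      also have "\<dots> \<le> D * ((norm (A x) + \<bar>f x\<bar> * norm (A u)) + (?s + \<bar>f x\<bar> * fsum gs u))"
      proof (intro mult_left_mono add_mono)
        show "norm (A x') \<le> norm (A x) + \<bar>f x\<bar> * norm (A u)"
          unfolding x'_def by (simp only: blinfun.add_right blinfun.scaleR_right)
            (metis norm_triangle_ineq norm_scaleR abs_minus_cancel)
        show "fsum gs x' \<le> ?s + \<bar>f x\<bar> * fsum gs u"
          unfolding x'_def using fsum_triangle[where c="- f x"] by simp
      qed (rule D(1))
      also have "\<dots> = D * (norm (A x) + ?s) + D * b * \<bar>f x\<bar>" by (simp add: b_def algebra_simps)
      finally have 1: "norm x' \<le> D * (norm (A x) + ?s) + D * b * \<bar>f x\<bar>" .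
      have "x = x' + f x *\<^sub>R u" by (simp add: x'_def)
      then have "norm x \<le> norm x' + \<bar>f x\<bar> * norm u" by (metis norm_triangle_ineq norm_scaleR)
      also have "\<dots> \<le> D * (norm (A x) + ?s) + (D * b + norm u) * \<bar>f x\<bar>" using 1 by (simp add: algebra_simps)
      also have "\<dots> \<le> (D + D * b + norm u) * (norm (A x) + ?s) + (D + D * b + norm u) * \<bar>f x\<bar>"
        using D(1) b s by (intro add_mono mult_right_mono) auto
      finally show ?thesis by (simp add: algebra_simps)
    qed
    then show ?thesis
      unfolding semi_est_def using D(1) b
      by (intro exI[of _ "f # gs"] exI[of _ "D + D * b + norm u"]) auto
  qed
qed

text \<open>Applying f n to the sum leaves a n plus terms with smaller index. Hence |a n| is at most
  the norm of the sum plus the bounds for the earlier coefficients, and 1 + (1 + 2 + ... + 2^(n-1))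
  = 2^n.\<close>

lemma triangular_coefficient_bound:
  fixes x :: "nat \<Rightarrow> 'a::real_normed_vector" and f :: "nat \<Rightarrow> 'a \<Rightarrow>\<^sub>L real"
  assumes f1: "\<And>n. f n (x n) = 1" and f0: "\<And>m n. m < n \<Longrightarrow> f m (x n) = 0"
    and nf: "\<And>n z. \<bar>f n z\<bar> \<le> norm z" and nx: "\<And>n. norm (x n) = 1"
  shows "n < N \<Longrightarrow> \<bar>a n\<bar> \<le> 2 ^ n * norm (\<Sum>k<N. a k *\<^sub>R x k)"
proof (induction n rule: less_induct)
  case (less n)
  let ?y = "\<Sum>k<N. a k *\<^sub>R x k"
  have "f n ?y = (\<Sum>k<N. a k * f n (x k))" by (simp add: blinfun.sum_right blinfun.scaleR_right)
  also have "\<dots> = (\<Sum>k\<in>insert n {..<n}. a k * f n (x k))"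
    by (rule sum.mono_neutral_right) (use less.prems f0 in \<open>auto simp: not_less less_le\<close>)
  also have "\<dots> = a n + (\<Sum>k<n. a k * f n (x k))" by (simp add: f1)
  finally have "a n = f n ?y - (\<Sum>k<n. a k * f n (x k))" by simp
  then have "\<bar>a n\<bar> \<le> \<bar>f n ?y\<bar> + \<bar>\<Sum>k<n. a k * f n (x k)\<bar>" by simp
  also have "\<dots> \<le> norm ?y + (\<Sum>k<n. 2 ^ k * norm ?y)"
  proof (intro add_mono nf order_trans[OF sum_abs] sum_mono)
    fix k assume k: "k \<in> {..<n}"
    have "\<bar>a k * f n (x k)\<bar> \<le> \<bar>a k\<bar> * 1"
      unfolding abs_mult using nf[of n "x k"] nx[of k] by (intro mult_left_mono) auto
    also have "\<dots> \<le> 2 ^ k * norm ?y" using less.IH[of k] less.prems k by simp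
    finally show "\<bar>a k * f n (x k)\<bar> \<le> 2 ^ k * norm ?y" .
  qed
  also have "\<dots> = (1 + (\<Sum>k<n. 2 ^ k)) * norm ?y" by (simp add: algebra_simps sum_distrib_right sum_distrib_left)
  also have "1 + (\<Sum>k<n. 2 ^ k) = (2 ^ n :: real)" by (induction n) auto
  finally show ?case .
qed

text \<open>
  If no estimate holds, one picks unit vectors \<open>x n\<close> on which \<open>A\<close> is tiny and which are killed by
  norming functionals of the previous ones; the coefficients of a combination of these vectors
  are then controlled by its norm.
\<close>

lemma small_on_subspace:
  fixes A :: "'a::real_normed_vector \<Rightarrow>\<^sub>L 'b::real_normed_vector"
  assumes Y: "subspace Y" "closed Y" and nest: "\<not> semi_est A Y" and d: "d > 0"
  obtains Z where "Z \<subseteq> Y" "inf_closed_subspace Z" "\<And>z. z \<in> Z \<Longrightarrow> norm (A z) \<le> d * norm z"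
proof -
  have ex: "\<exists>x. x \<in> Y \<and> norm x = 1 \<and> (\<forall>f\<in>set fs. f x = 0) \<and> norm (A x) < e" if e: "e > 0"
    for fs :: "('a \<Rightarrow>\<^sub>L real) list" and e :: real
  proof -
    obtain x where x: "x \<in> Y" "\<And>f. f \<in> set fs \<Longrightarrow> f x = 0" "\<not> norm x \<le> (1/e) * norm (A x)"
      using semi_est_of_kernels[of Y "1/e" fs A] nest Y e by auto
    have nx: "norm x > 0" using x(3) e by (cases "x = 0") (auto simp: blinfun.zero_right)
    show ?thesis
      by (rule exI[of _ "(1 / norm x) *\<^sub>R x"])
        (use x nx e Y in \<open>auto simp: subspace_scale blinfun.bilinear_simps field_simps\<close>)
  qed
  \<comment> \<open>Multiplied by the coefficient bound 2^n norm z, this leaves (1/2)^n times d / 2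
    times norm z, which sums to at most d norm z.\<close>
  define e where "e n = d / (2 * 4 ^ n)" for n :: nat
  have e: "e n > 0" for n using d by (simp add: e_def)
  have "\<exists>pick :: nat \<Rightarrow> ('a \<Rightarrow>\<^sub>L real) list \<Rightarrow> 'a. \<forall>n fs. pick n fs \<in> Y \<and> norm (pick n fs) = 1 \<and>
      (\<forall>f\<in>set fs. blinfun_apply f (pick n fs) = 0) \<and> norm (A (pick n fs)) < e n"
    by (intro choice allI ex e)
  then obtain pick :: "nat \<Rightarrow> ('a \<Rightarrow>\<^sub>L real) list \<Rightarrow> 'a" where pick: "\<And>n (fs :: ('a \<Rightarrow>\<^sub>L real) list). pick n fs \<in> Y \<and> norm (pick n fs) = 1 \<and>
      (\<forall>f\<in>set fs. f (pick n fs) = 0) \<and> norm (A (pick n fs)) < e n"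
    by blast
  obtain fn :: "'a \<Rightarrow> 'a \<Rightarrow>\<^sub>L real" where fn: "\<And>v. fn v v = norm v" "\<And>v z. \<bar>fn v z\<bar> \<le> norm z"
    using norming_functional by metis
  define hist where "hist = rec_nat [] (\<lambda>n fs. fn (pick n fs) # fs)"
  define x where "x n = pick n (hist n)" for n
  define f where "f n = fn (x n)" for n
  have hist_Suc: "hist (Suc n) = f n # hist n" for n by (simp add: hist_def f_def x_def)
  have hist_set: "f m \<in> set (hist n)" if "m < n" for m n
    using that by (induction n) (auto simp: hist_Suc less_Suc_eq)
  have xY: "x n \<in> Y" and nx: "norm (x n) = 1" and Ax: "norm (A (x n)) < e n" for n
    using pick by (auto simp: x_def)
  have f0: "f m (x n) = 0" if "m < n" for m n
    using pick hist_set[OF that] by (auto simp: x_def)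
  have f1: "f n (x n) = 1" for n using fn(1) nx by (simp add: f_def)
  have nf: "\<bar>f n z\<bar> \<le> norm z" for n z using fn(2) by (simp add: f_def)
  have coef: "\<bar>a n\<bar> \<le> 2 ^ n * norm (\<Sum>k<N. a k *\<^sub>R x k)" if "n < N" for a n N
    by (rule triangular_coefficient_bound[OF f1 _ nf nx that]) (rule f0)
  have injx: "inj x"
  proof (rule injI)
    fix m n assume eq: "x m = x n"
    show "m = n"
    proof (rule ccontr)
      assume "m \<noteq> n"
      then consider "m < n" | "n < m" by linarith
      then show False using f0[of m n] f0[of n m] f1[of m] f1[of n] eq by cases auto
    qed
  qed
  have bound: "norm (A z) \<le> d * norm z" if z: "z \<in> span (range x)" for z
  proof -
    obtain t r where t: "finite t" "t \<subseteq> range x" "z = (\<Sum>v\<in>t. r v *\<^sub>R v)"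
      using z unfolding span_explicit by blast
    obtain K where K: "finite K" "t = x ` K" using finite_subset_image[OF t(1,2)] by blast
    obtain N where N: "K \<subseteq> {..<N}" using finite_nat_iff_bounded K(1) by blast
    define a where "a k = (if k \<in> K then r (x k) else 0)" for k
    have zs: "z = (\<Sum>k<N. a k *\<^sub>R x k)"
    proof -
      have "z = (\<Sum>k\<in>K. r (x k) *\<^sub>R x k)"
        unfolding t(3) K(2) by (rule sum.reindex[unfolded comp_def]) (rule inj_on_subset[OF injx], simp)
      also have "\<dots> = (\<Sum>k<N. a k *\<^sub>R x k)"
        by (rule sum.mono_neutral_cong_left) (use N K(1) in \<open>auto simp: a_def\<close>)
      finally show ?thesis .
    qed
    have "norm (A z) = norm (\<Sum>k<N. a k *\<^sub>R A (x k))" by (simp add: zs blinfun.sum_right blinfun.scaleR_right)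
    also have "\<dots> \<le> (\<Sum>k<N. \<bar>a k\<bar> * norm (A (x k)))" using norm_sum by (metis (no_types, lifting) norm_scaleR sum.cong)
    also have "\<dots> \<le> (\<Sum>k<N. (2 ^ k * norm z) * e k)"
      using coef Ax by (intro sum_mono mult_mono) (auto simp: zs less_imp_le)
    also have "\<dots> = (\<Sum>k<N. (1/2) ^ k) * (d * norm z / 2)"
    proof -
      have "(2 ^ k * norm z) * e k = (1/2) ^ k * (d * norm z / 2)" for k
      proof -
        have "(4::real) ^ k = 2 ^ k * 2 ^ k" by (metis mult_2_right numeral_Bit0 power_mult_distrib mult.commute num_double numeral_times_numeral)
        then show ?thesis by (simp add: e_def field_simps)
      qed
      then have "(\<Sum>k<N. (2 ^ k * norm z) * e k) = (\<Sum>k<N. (1/2) ^ k * (d * norm z / 2))"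
        by (intro sum.cong refl)
      then show ?thesis by (simp only: sum_distrib_right)
    qed
    also have "\<dots> \<le> 2 * (d * norm z / 2)"
    proof (rule mult_right_mono)
      have "(\<Sum>k<N. (1/2::real) ^ k) \<le> (\<Sum>k. (1/2) ^ k)"
        by (rule sum_le_suminf) (auto intro: summable_geometric)
      then show "(\<Sum>k<N. (1/2::real) ^ k) \<le> 2" using suminf_geometric[of "1/2::real"] by simp
    qed (use d in auto)
    finally show ?thesis by simp
  qed
  define Z where "Z = closure (span (range x))"
  have "closed {z. norm (A z) \<le> d * norm z}"
    by (intro closed_Collect_le continuous_intros)
  then have "Z \<subseteq> {z. norm (A z) \<le> d * norm z}"
    unfolding Z_def using bound by (intro closure_minimal) auto
  then have 1: "norm (A z) \<le> d * norm z" if "z \<in> Z" for z using that by blast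
  have 2: "Z \<subseteq> Y"
    unfolding Z_def by (rule closure_minimal[OF span_minimal]) (use xY Y in auto)
  have "infinite_dimensional (span (range x))"
    unfolding infinite_dimensional_def
  proof (rule notI, elim exE conjE)
    fix B :: "'a set" assume B: "finite B" "span (range x) \<subseteq> span B"
    let ?N = "Suc (card B)"
    have "independent (x ` {..<?N})"
    proof (rule independent_if_scalars_zero)
      fix r v assume s: "(\<Sum>v\<in>x ` {..<?N}. r v *\<^sub>R v) = 0" and v: "v \<in> x ` {..<?N}"
      then obtain n where n: "v = x n" "n < ?N" by blast
      have "(\<Sum>k<?N. r (x k) *\<^sub>R x k) = 0"
        using s by (subst (asm) sum.reindex) (auto intro: inj_on_subset[OF injx])
      then show "r v = 0" using coef[OF n(2), of "\<lambda>k. r (x k)"] n(1) by simp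
    qed simp
    moreover have "x ` {..<?N} \<subseteq> span B"
      using B(2) span_superset[of "range x"] image_mono[of "{..<?N}" UNIV x] by (meson order_trans subset_UNIV)
    ultimately have "card (x ` {..<?N}) \<le> card B" using independent_span_bound[OF B(1)] by blast
    moreover have "card (x ` {..<?N}) = ?N" by (subst card_image) (auto intro: inj_on_subset[OF injx])
    ultimately show False by simp
  qed
  then have "inf_closed_subspace Z"
    unfolding inf_closed_subspace_def Z_def
    using infinite_dimensional_mono closure_subset subspace_closure subspace_span closed_closure by metis
  with 1 2 show thesis using that by blast
qed

section \<open>Strictly singular operators\<close>

text \<open>For a linear map, continuity of the inverse at 0 already gives a lower bound by
  rescaling. Conversely, a lower bound makes the inverse Lipschitz, turns Cauchy sequences in the
  image into Cauchy sequences in Y, so that the image is closed, and keeps the image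
  infinite-dimensional.\<close>

lemma strictly_singular_iff:
  fixes S :: "'a::banach \<Rightarrow>\<^sub>L 'a"
  shows "S \<in> strictly_singular \<longleftrightarrow>
    \<not> (\<exists>Y c. inf_closed_subspace Y \<and> c > 0 \<and> (\<forall>y\<in>Y. c * norm y \<le> norm (S y)))" (is "_ \<longleftrightarrow> \<not> ?R")
proof -
  have "(\<exists>Y Z g. inf_closed_subspace Y \<and> inf_closed_subspace Z \<and> homeomorphism Y Z S g) \<longleftrightarrow> ?R"
  proof (intro iffI; elim exE conjE)
    fix Y Z g assume Y: "inf_closed_subspace Y" and Z: "inf_closed_subspace Z"
      and h: "homeomorphism Y Z (blinfun_apply S) g"
    have sY: "subspace Y" and sZ: "subspace Z" using Y Z by (auto simp: inf_closed_subspace_def)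
    have g: "\<And>y. y \<in> Y \<Longrightarrow> g (S y) = y" "\<And>y. y \<in> Y \<Longrightarrow> S y \<in> Z" "continuous_on Z g"
      using h by (auto simp: homeomorphism_def)
    have "g 0 = 0" using g(1)[OF subspace_0[OF sY]] by (simp add: blinfun.zero_right)
    then obtain \<delta> where \<delta>: "\<delta> > 0" "\<And>z. z \<in> Z \<Longrightarrow> norm z < \<delta> \<Longrightarrow> norm (g z) < 1"
      using g(3)[unfolded continuous_on_iff, rule_format, OF subspace_0[OF sZ], of 1]
      by (auto simp: dist_norm)
    have "\<delta> / 2 * norm y \<le> norm (S y)" if y: "y \<in> Y" for y
    proof (rule ccontr)
      assume "\<not> ?thesis"
      then have lt: "norm (S y) < \<delta> / 2 * norm y" by simp
      then have ny: "norm y > 0" by (cases "y = 0") (auto simp: blinfun.zero_right)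
      let ?y = "(1 / norm y) *\<^sub>R y"
      have yY: "?y \<in> Y" by (rule subspace_scale[OF sY y])
      have "norm (S y) < \<delta> * norm y"
      proof (rule less_trans[OF lt])
        show "\<delta> / 2 * norm y < \<delta> * norm y" using ny \<delta>(1) by simp
      qed
      then have "norm (S ?y) < \<delta>" using ny by (simp add: blinfun.bilinear_simps divide_less_eq)
      then have "norm (g (S ?y)) < 1" using \<delta>(2) g(2)[OF yY] by blast
      then show False using g(1)[OF yY] ny by simp
    qed
    then show ?R using Y \<delta>(1) by (intro exI[of _ Y] exI[of _ "\<delta>/2"]) auto
  next
    fix Y c assume Y: "inf_closed_subspace Y" and c: "c > 0" "\<forall>y\<in>Y. c * norm y \<le> norm (S y)"
    have sY: "subspace Y" and cY: "closed Y" and iY: "infinite_dimensional Y"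
      using Y by (auto simp: inf_closed_subspace_def)
    have low: "c * norm (y - y') \<le> norm (S y - S y')" if "y \<in> Y" "y' \<in> Y" for y y'
      using c(2)[rule_format, OF subspace_diff[OF sY that]] by (simp add: blinfun.diff_right)
    have inj: "inj_on S Y"
    proof (rule inj_onI)
      fix y y' assume "y \<in> Y" "y' \<in> Y" "S y = S y'"
      then show "y = y'" using low[of y y'] c(1) by (simp add: mult_le_0_iff)
    qed
    define g where "g = the_inv_into Y S"
    have gS: "g (S y) = y" if "y \<in> Y" for y unfolding g_def by (rule the_inv_into_f_f[OF inj that])
    have "continuous_on (S ` Y) g"
      unfolding continuous_on_iff
    proof (intro ballI allI impI)
      fix z e :: _ assume z: "z \<in> S ` Y" and e: "(e::real) > 0"
      then obtain y where y: "y \<in> Y" "z = S y" by blast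
      have "dist (g z') (g z) < e" if z': "z' \<in> S ` Y" "dist z' z < c * e" for z'
      proof -
        obtain y' where y': "y' \<in> Y" "z' = S y'" using z'(1) by blast
        have "c * norm (y' - y) < c * e" using low[OF y'(1) y(1)] z'(2) y y' by (simp add: dist_norm)
        then show ?thesis using c(1) y y' by (simp add: gS dist_norm)
      qed
      then show "\<exists>d>0. \<forall>x'\<in>S ` Y. dist x' z < d \<longrightarrow> dist (g x') (g z) < e"
        using e c(1) by (intro exI[of _ "c * e"]) auto
    qed
    then have h: "homeomorphism Y (S ` Y) S g"
      unfolding homeomorphism_def by (auto simp: gS image_iff intro!: continuous_intros)
    have "closed (S ` Y)"
    proof (rule complete_imp_closed, rule completeI)
      fix z assume z: "\<forall>n. z n \<in> S ` Y" "Cauchy z"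
      then obtain y where y: "\<And>n. y n \<in> Y" "\<And>n. z n = S (y n)"
        unfolding image_iff by metis
      have "Cauchy y"
      proof (rule metric_CauchyI)
        fix e :: real assume "e > 0"
        then obtain M where M: "\<And>m n. m \<ge> M \<Longrightarrow> n \<ge> M \<Longrightarrow> dist (z m) (z n) < c * e"
          using metric_CauchyD[OF z(2), of "c * e"] c(1) by auto
        have "dist (y m) (y n) < e" if "m \<ge> M" "n \<ge> M" for m n
        proof -
          have "c * dist (y m) (y n) < c * e"
            using low[OF y(1)[of m] y(1)[of n]] M[OF that] y(2) by (simp add: dist_norm)
          then show ?thesis using c(1) by simp
        qed
        then show "\<exists>M. \<forall>m\<ge>M. \<forall>n\<ge>M. dist (y m) (y n) < e" by blast
      qed
      then obtain l where l: "y \<longlonglongrightarrow> l" using Cauchy_convergent_iff convergent_def by blast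
      have "l \<in> Y" using closed_sequentially[OF cY _ l] y(1) by blast
      moreover have "z \<longlonglongrightarrow> S l" unfolding y(2)[abs_def] using l by (intro tendsto_intros)
      ultimately show "\<exists>l\<in>S ` Y. z \<longlonglongrightarrow> l" by blast
    qed
    moreover have "subspace (S ` Y)"
      by (intro linear_subspace_image sY) (simp add: blinfun.bounded_linear_right bounded_linear.linear)
    moreover have "infinite_dimensional (S ` Y)"
    proof -
      have "y = 0" if "y \<in> Y" "S y = 0" for y using c(1) c(2)[rule_format, OF that(1)] that by (simp add: mult_le_0_iff)
      then have "\<And>B. finite B \<Longrightarrow> S ` Y \<subseteq> span B \<Longrightarrow> \<exists>B'. finite B' \<and> Y \<subseteq> span B'"
        by (intro finite_span_of_injective_image[OF sY, of S])
      then show ?thesis using iY unfolding infinite_dimensional_def by metis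
    qed
    ultimately show "\<exists>Y Z g. inf_closed_subspace Y \<and> inf_closed_subspace Z \<and> homeomorphism Y Z S g"
      using Y h by (auto simp: inf_closed_subspace_def)
  qed
  then show ?thesis unfolding strictly_singular_def mem_Collect_eq by (rule arg_cong)
qed

text \<open>If S satisfied the estimate on Y, it would be bounded below on the common kernel in Y of
  the functionals involved, which is again closed and infinite-dimensional. So
  \<open>small_on_subspace\<close> applies inside every Y.\<close>

lemma strictly_singular_small:
  fixes S :: "'a::banach \<Rightarrow>\<^sub>L 'a"
  assumes S: "S \<in> strictly_singular" and Y: "inf_closed_subspace Y" and d: "d > 0"
  obtains Z where "Z \<subseteq> Y" "inf_closed_subspace Z" "\<And>z. z \<in> Z \<Longrightarrow> norm (S z) \<le> d * norm z"
proof -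
  have "\<not> semi_est S Y"
  proof
    assume "semi_est S Y"
    then obtain fs :: "('a \<Rightarrow>\<^sub>L real) list" and C where C: "C \<ge> 0"
      "\<And>x. x \<in> Y \<Longrightarrow> norm x \<le> C * (norm (S x) + fsum fs x)" unfolding semi_est_def by blast
    let ?Z = "{y \<in> Y. \<forall>f\<in>set fs. f y = 0}"
    have "(1 / (C + 1)) * norm z \<le> norm (S z)" if z: "z \<in> ?Z" for z
    proof -
      have "fsum fs z = 0" using z by (intro fsum_eq_0) auto
      then have "norm z \<le> C * norm (S z)" using C(2)[of z] z by simp
      also have "\<dots> \<le> (C + 1) * norm (S z)" by (simp add: mult_right_mono)
      finally show ?thesis using C(1) by (simp add: field_simps)
    qed
    then show False
      using S inf_closed_subspace_kernels[OF Y, of fs] C(1) unfolding strictly_singular_iff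
      by (auto dest!: spec[of _ ?Z] spec[of _ "1 / (C + 1)"])
  qed
  then show thesis using small_on_subspace[of Y S d] that Y d by (auto simp: inf_closed_subspace_def)
qed

text \<open>The small subspace for T is chosen inside the one for S, so both operators are at most
  c/4 there. Their sum is then at most c/2, which against the lower bound c forces the subspace to
  be zero.\<close>

lemma strictly_singular_add:
  fixes S T :: "'a::banach \<Rightarrow>\<^sub>L 'a"
  assumes S: "S \<in> strictly_singular" and T: "T \<in> strictly_singular"
  shows "S + T \<in> strictly_singular"
  unfolding strictly_singular_iff
proof (rule notI, elim exE conjE)
  fix Y c assume Y: "inf_closed_subspace Y" and c: "c > 0" and low: "\<forall>y\<in>Y. c * norm y \<le> norm ((S + T) y)"
  obtain Z where Z: "Z \<subseteq> Y" "inf_closed_subspace Z" "\<And>z. z \<in> Z \<Longrightarrow> norm (S z) \<le> (c/4) * norm z"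
    using strictly_singular_small[OF S Y, of "c/4"] c by auto
  obtain W where W: "W \<subseteq> Z" "inf_closed_subspace W" "\<And>z. z \<in> W \<Longrightarrow> norm (T z) \<le> (c/4) * norm z"
    using strictly_singular_small[OF T Z(2), of "c/4"] c by auto
  have "w = 0" if w: "w \<in> W" for w
  proof -
    have "c * norm w \<le> norm (S w + T w)" using low w W(1) Z(1) by (auto simp: blinfun.add_left)
    also have "\<dots> \<le> norm (S w) + norm (T w)" by (rule norm_triangle_ineq)
    also have "\<dots> \<le> (c/4) * norm w + (c/4) * norm w" using w W Z by (intro add_mono) auto
    finally show "w = 0" using c by simp
  qed
  then have "W \<subseteq> span {}" by auto
  then show False using W(2) unfolding inf_closed_subspace_def infinite_dimensional_def by blast
qed

lemma strictly_singular_scaleR: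
  fixes S :: "'a::banach \<Rightarrow>\<^sub>L 'a"
  assumes S: "S \<in> strictly_singular" "r \<noteq> 0"
  shows "r *\<^sub>R S \<in> strictly_singular"
  unfolding strictly_singular_iff
proof (rule notI, elim exE conjE)
  fix Y c assume Y: "inf_closed_subspace Y" and c: "c > 0" and low: "\<forall>y\<in>Y. c * norm y \<le> norm ((r *\<^sub>R S) y)"
  have "\<forall>y\<in>Y. (c / \<bar>r\<bar>) * norm y \<le> norm (S y)"
    using low assms(2) by (auto simp: blinfun.scaleR_left field_simps)
  then show False using S Y c unfolding strictly_singular_iff by (metis divide_pos_pos zero_less_abs_iff)
qed

lemma finite_range_strictly_singular:
  fixes K :: "'a::banach \<Rightarrow>\<^sub>L 'a"
  assumes "finite B" "\<And>x. K x \<in> span B"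
  shows "K \<in> strictly_singular"
  unfolding strictly_singular_def infinite_dimensional_def inf_closed_subspace_def homeomorphism_def
  using assms by blast

lemma zero_strictly_singular: "(0 :: 'a::banach \<Rightarrow>\<^sub>L 'a) \<in> strictly_singular"
  by (rule finite_range_strictly_singular[of "{}"]) (auto simp: blinfun.zero_left)

lemma GL_not_strictly_singular:
  fixes T :: "'a::banach \<Rightarrow>\<^sub>L 'a"
  assumes "infinite_dimensional (UNIV :: 'a set)" "T \<in> GL"
  shows "T \<notin> strictly_singular"
  unfolding strictly_singular_iff not_not
  by (rule exI[of _ UNIV]) (use GL_bounded_below[OF assms(2)] assms(1) in \<open>auto simp: inf_closed_subspace_def\<close>)

text \<open>Without the estimate, c + S is at most |c|/2 on some infinite-dimensional closed
  subspace. There S differs from - c by at most half of |c|, so it is bounded below, against strict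
  singularity.\<close>

lemma semi_est_scalar_plus_strictly_singular:
  fixes S :: "'a::banach \<Rightarrow>\<^sub>L 'a"
  assumes S: "S \<in> strictly_singular" and c: "c \<noteq> 0"
  shows "semi_est (c *\<^sub>R id_blinfun + S) UNIV"
proof (rule ccontr)
  assume n: "\<not> ?thesis"
  obtain Z where Z: "inf_closed_subspace Z"
    "\<And>z. z \<in> Z \<Longrightarrow> norm ((c *\<^sub>R id_blinfun + S) z) \<le> (\<bar>c\<bar>/2) * norm z"
    using small_on_subspace[OF subspace_UNIV closed_UNIV n, of "\<bar>c\<bar>/2"] c by auto
  have "(\<bar>c\<bar>/2) * norm z \<le> norm (S z)" if z: "z \<in> Z" for z
  proof -
    have "\<bar>c\<bar> * norm z = norm ((c *\<^sub>R id_blinfun + S) z - S z)" by (simp add: blinfun.bilinear_simps)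
    also have "\<dots> \<le> norm ((c *\<^sub>R id_blinfun + S) z) + norm (S z)" by (rule norm_triangle_ineq4)
    also have "\<dots> \<le> (\<bar>c\<bar>/2) * norm z + norm (S z)" using Z(2)[OF z] by simp
    finally show ?thesis by simp
  qed
  then show False
    using S Z(1) c unfolding strictly_singular_iff by (metis half_gt_zero zero_less_abs_iff)
qed

section \<open>Finite-rank operators\<close>

definition rank_one :: "'a::real_normed_vector \<Rightarrow> ('a \<Rightarrow>\<^sub>L real) \<Rightarrow> 'a \<Rightarrow>\<^sub>L 'a" where
  "rank_one u f = blinfun_scaleR_left u o\<^sub>L f"

lemma rank_one_apply [simp]: "rank_one u f x = f x *\<^sub>R u"
  by (simp add: rank_one_def)

text \<open>Encoded as a linear span, so that properties follow by induction on sums of rank-one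
  operators with bounded functionals. Both the finite-dimensional range and the bound by finitely
  many functionals are read off this way.\<close>

definition finite_rank :: "('a::real_normed_vector \<Rightarrow>\<^sub>L 'a) set" where
  "finite_rank = span {rank_one u f | u f. True}"

lemma rank_one_finite_rank: "rank_one u f \<in> finite_rank"
  unfolding finite_rank_def by (intro span_base) blast

lemma finite_rank_zero: "0 \<in> finite_rank"
  and finite_rank_add: "K \<in> finite_rank \<Longrightarrow> L \<in> finite_rank \<Longrightarrow> K + L \<in> finite_rank"
  and finite_rank_diff: "K \<in> finite_rank \<Longrightarrow> L \<in> finite_rank \<Longrightarrow> K - L \<in> finite_rank"
  and finite_rank_scaleR: "K \<in> finite_rank \<Longrightarrow> c *\<^sub>R K \<in> finite_rank"
  and finite_rank_uminus: "K \<in> finite_rank \<Longrightarrow> - K \<in> finite_rank"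
  by (simp_all add: finite_rank_def span_zero span_add span_diff span_scale span_neg)

lemma finite_rank_induct [consumes 1, case_names zero add]:
  assumes "K \<in> finite_rank" and "P 0" and "\<And>c u f K. P K \<Longrightarrow> P (c *\<^sub>R rank_one u f + K)"
  shows "P K"
  using assms(1) unfolding finite_rank_def
  by (induction rule: span_induct_alt) (use assms(2,3) in auto)

lemma finite_rank_compose_left: "K \<in> finite_rank \<Longrightarrow> A o\<^sub>L K \<in> finite_rank"
proof (induction rule: finite_rank_induct)
  case zero then show ?case by (simp add: finite_rank_zero)
next
  case (add c u f K)
  have "A o\<^sub>L (c *\<^sub>R rank_one u f + K) = c *\<^sub>R rank_one (A u) f + (A o\<^sub>L K)"
    by (rule blinfun_eqI) (simp add: blinfun.bilinear_simps)
  then show ?case using add by (simp add: finite_rank_add finite_rank_scaleR rank_one_finite_rank)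
qed

lemma finite_rank_compose_right: "K \<in> finite_rank \<Longrightarrow> K o\<^sub>L A \<in> finite_rank"
proof (induction rule: finite_rank_induct)
  case zero then show ?case by (simp add: finite_rank_zero)
next
  case (add c u f K)
  have "(c *\<^sub>R rank_one u f + K) o\<^sub>L A = c *\<^sub>R rank_one u (f o\<^sub>L A) + (K o\<^sub>L A)"
    by (rule blinfun_eqI) (simp add: blinfun.bilinear_simps)
  then show ?case using add by (simp add: finite_rank_add finite_rank_scaleR rank_one_finite_rank)
qed

lemma finite_rank_range:
  "K \<in> finite_rank \<Longrightarrow> \<exists>B. finite B \<and> (\<forall>x. K x \<in> span B)"
proof (induction rule: finite_rank_induct)
  case zero then show ?case by (intro exI[of _ "{}"]) (simp add: blinfun.zero_left)
next
  case (add c u f K)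
  then obtain B where B: "finite B" "\<And>x. K x \<in> span B" by blast
  have "(c *\<^sub>R rank_one u f + K) x \<in> span (insert u B)" for x
  proof -
    have "K x \<in> span (insert u B)" using B(2)[of x] span_mono[of B "insert u B"] by auto
    moreover have "(c * f x) *\<^sub>R u \<in> span (insert u B)" by (intro span_scale span_base) simp
    ultimately show ?thesis using span_add by (fastforce simp: blinfun.bilinear_simps)
  qed
  then show ?case using B(1) by blast
qed

lemma finite_rank_fsum:
  fixes K :: "'a::real_normed_vector \<Rightarrow>\<^sub>L 'a"
  shows "K \<in> finite_rank \<Longrightarrow> \<exists>fs C. C \<ge> 0 \<and> (\<forall>x. norm (K x) \<le> C * fsum fs x)"
proof (induction rule: finite_rank_induct)
  case zero then show ?case by (intro exI[of _ "[]"] exI[of _ 0]) (simp add: blinfun.zero_left)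
next
  case (add c u f K)
  then obtain fs C where C: "C \<ge> 0" "\<And>x. norm (K x) \<le> C * fsum fs x" by blast
  have "norm ((c *\<^sub>R rank_one u f + K) x) \<le> (C + \<bar>c\<bar> * norm u) * fsum (f # fs) x" for x
  proof -
    have "(c *\<^sub>R rank_one u f + K) x = c *\<^sub>R (f x *\<^sub>R u) + K x"
      by (simp add: blinfun.bilinear_simps)
    then have "norm ((c *\<^sub>R rank_one u f + K) x) \<le> norm (c *\<^sub>R (f x *\<^sub>R u)) + norm (K x)"
      by (simp only: norm_triangle_ineq)
    also have "\<dots> \<le> (\<bar>c\<bar> * norm u) * \<bar>f x\<bar> + C * fsum fs x"
      using C(2)[of x] by (simp add: abs_mult mult_ac)
    also have "\<dots> \<le> (C + \<bar>c\<bar> * norm u) * \<bar>f x\<bar> + (C + \<bar>c\<bar> * norm u) * fsum fs x"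
      by (intro add_mono mult_right_mono) (use C fsum_nonneg[of fs x] in auto)
    finally show ?thesis by (simp add: algebra_simps)
  qed
  then show ?case using C(1) by (intro exI[of _ "f # fs"] exI[of _ "C + \<bar>c\<bar> * norm u"]) auto
qed

lemma finite_rank_strictly_singular: "K \<in> finite_rank \<Longrightarrow> (K :: 'a::banach \<Rightarrow>\<^sub>L 'a) \<in> strictly_singular"
  using finite_rank_range finite_range_strictly_singular by blast

lemma semi_est_finite_rank:
  fixes A :: "'a::real_normed_vector \<Rightarrow>\<^sub>L 'a"
  assumes K: "K \<in> finite_rank" and C: "C \<ge> 0" "\<And>x. x \<in> M \<Longrightarrow> norm x \<le> C * (norm (A x) + norm (K x))"
  shows "semi_est A M"
proof -
  obtain fs D where D: "D \<ge> 0" "\<And>x. norm (K x) \<le> D * fsum fs x" using finite_rank_fsum[OF K] by blast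
  have "norm x \<le> (C * (1 + D)) * (norm (A x) + fsum fs x)" if "x \<in> M" for x
  proof -
    have "norm x \<le> C * (norm (A x) + D * fsum fs x)"
      using C(2)[OF that] mult_left_mono[OF add_left_mono[OF D(2)[of x], of "norm (A x)"] C(1)] by linarith
    also have "\<dots> \<le> C * ((1 + D) * norm (A x) + (1 + D) * fsum fs x)"
    proof (intro mult_left_mono add_mono C(1) mult_right_mono)
      show "norm (A x) \<le> (1 + D) * norm (A x)" using D(1) by (simp add: mult_le_cancel_right1)
    qed (use D(1) fsum_nonneg in auto)
    finally show ?thesis by (simp add: algebra_simps)
  qed
  then show ?thesis unfolding semi_est_def using C(1) D(1) by (intro exI[of _ fs] exI[of _ "C * (1 + D)"]) auto
qed

text \<open>
  Preimages can be selected boundedly. Either a functional is nonzero on the kernel, and then it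
  can be made to vanish by moving along the kernel; or it vanishes there and, by completeness, is
  controlled by the rest of the estimate. In both cases it can be dropped.
\<close>

lemma bounded_selection:
  fixes A :: "'a::banach \<Rightarrow>\<^sub>L 'b::real_normed_vector"
  assumes "subspace M" "closed M" "semi_est A M"
  shows "\<exists>C\<ge>0. \<forall>x\<in>M. \<exists>z\<in>M. A z = A x \<and> norm z \<le> C * norm (A x)"
proof -
  have main: "\<exists>C\<ge>0. \<forall>x\<in>M. \<exists>z\<in>M. A z = A x \<and> norm z \<le> C * norm (A x)"
    if "subspace M" "closed M" "C \<ge> 0" "\<And>x. x \<in> M \<Longrightarrow> norm x \<le> C * (norm (A x) + fsum fs x)"
    for fs C M
    using that
  proof (induction fs arbitrary: M C)
    case Nil
    then show ?case by (intro exI[of _ C]) auto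
  next
    case (Cons f fs)
    note sM = Cons.prems(1) and cM = Cons.prems(2) and C = Cons.prems(3,4)
    have lin_diff: "fsum fs (x - y) \<le> fsum fs x + fsum fs y" for x y
      using fsum_triangle[of fs x "-1" y] by simp
    show ?case
    proof (cases "\<exists>k\<in>M. A k = 0 \<and> f k \<noteq> 0")
      case True
      then obtain k where k: "k \<in> M" "A k = 0" "f k \<noteq> 0" by blast
      let ?M = "{x \<in> M. f x = 0}"
      have "\<exists>C\<ge>0. \<forall>x\<in>?M. \<exists>z\<in>?M. A z = A x \<and> norm z \<le> C * norm (A x)"
      proof (rule Cons.IH)
        show "subspace ?M" using sM by (auto simp: subspace_def blinfun.bilinear_simps)
        have "closed (M \<inter> f -` {0})"
          by (intro closed_Int cM continuous_closed_vimage) (auto intro!: continuous_intros)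
        then show "closed ?M" by (simp add: Int_def vimage_def)
        show "norm x \<le> C * (norm (A x) + fsum fs x)" if "x \<in> ?M" for x
          using C(2)[of x] that by simp
      qed (rule C(1))
      then obtain D where D: "D \<ge> 0" "\<And>x. x \<in> ?M \<Longrightarrow> \<exists>z\<in>?M. A z = A x \<and> norm z \<le> D * norm (A x)"
        by blast
      have "\<exists>z\<in>M. A z = A x \<and> norm z \<le> D * norm (A x)" if x: "x \<in> M" for x
      proof -
        let ?x = "x - (f x / f k) *\<^sub>R k"
        have "?x \<in> ?M" using x k sM by (simp add: subspace_diff subspace_scale blinfun.bilinear_simps)
        moreover have "A ?x = A x" using k by (simp add: blinfun.bilinear_simps)
        ultimately show ?thesis using D(2)[of ?x] by auto
      qed
      then show ?thesis using D(1) by blast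
    next
      case False
      have "\<exists>D\<ge>0. \<forall>x\<in>M. \<bar>f x\<bar> \<le> D * (norm (A x) + fsum fs x)"
      proof (rule ccontr)
        assume no: "\<not> ?thesis"
        have "\<exists>x\<in>M. f x = 1 \<and> norm (A x) + fsum fs x < 1 / real (Suc n)" for n
        proof -
          obtain x where x: "x \<in> M" "\<not> \<bar>f x\<bar> \<le> real (Suc n) * (norm (A x) + fsum fs x)"
            using no by (metis of_nat_0_le_iff)
          have fx: "f x \<noteq> 0" using x(2) fsum_nonneg[of fs x] by (auto simp: zero_le_mult_iff)
          have sc: "fsum fs ((1 / f x) *\<^sub>R x) \<le> \<bar>1 / f x\<bar> * fsum fs x"
            using fsum_triangle[of fs 0 "1 / f x" x] fsum_eq_0[of fs 0] by (simp add: blinfun.zero_right)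
          have "norm (A ((1 / f x) *\<^sub>R x)) + fsum fs ((1 / f x) *\<^sub>R x) \<le> (norm (A x) + fsum fs x) / \<bar>f x\<bar>"
            using sc by (simp add: blinfun.scaleR_right add_divide_distrib)
          also have "\<dots> < 1 / real (Suc n)" using x(2) fx by (simp add: field_simps)
          finally show ?thesis
            using x(1) fx sM by (intro bexI[of _ "(1 / f x) *\<^sub>R x"]) (auto simp: blinfun.scaleR_right subspace_scale)
        qed
        then obtain x where x: "\<And>n. x n \<in> M" "\<And>n. f (x n) = 1"
          "\<And>n. norm (A (x n)) + fsum fs (x n) < 1 / real (Suc n)" by metis
        \<comment> \<open>The functional f takes the value 1 at every \<open>x n\<close>, so it
          drops out of the estimate for differences.\<close>
        have Cau: "norm (x m - x n) \<le> C * (1 / real (Suc m) + 1 / real (Suc n))" for m n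
        proof -
          have "norm (x m - x n) \<le> C * (norm (A (x m - x n)) + fsum (f # fs) (x m - x n))"
            using C(2) x(1) sM subspace_diff by blast
          also have "\<dots> = C * (norm (A (x m) - A (x n)) + fsum fs (x m - x n))"
            by (simp add: blinfun.diff_right x(2))
          also have "\<dots> \<le> C * (1 / real (Suc m) + 1 / real (Suc n))"
          proof (rule mult_left_mono[OF _ C(1)])
            show "norm (A (x m) - A (x n)) + fsum fs (x m - x n) \<le> 1 / real (Suc m) + 1 / real (Suc n)"
              using norm_triangle_ineq4[of "A (x m)" "A (x n)"] lin_diff[of "x m" "x n"] x(3)[of m] x(3)[of n]
              by linarith
          qed
          finally show ?thesis .
        qed
        have "Cauchy x"
        proof (rule metric_CauchyI)
          fix e :: real assume e: "e > 0"
          have "(\<lambda>n. C * (1 / real (Suc n) + 1 / real (Suc n))) \<longlonglongrightarrow> C * (0 + 0)"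
            by (intro tendsto_intros LIMSEQ_Suc[OF lim_1_over_n])
          then obtain N where N: "\<bar>C * (1 / real (Suc N) + 1 / real (Suc N))\<bar> < e"
            using e unfolding lim_sequentially dist_real_def by fastforce
          have "dist (x m) (x n) < e" if "m \<ge> N" "n \<ge> N" for m n
          proof -
            have "dist (x m) (x n) \<le> C * (1 / real (Suc m) + 1 / real (Suc n))" using Cau by (simp add: dist_norm)
            also have "\<dots> \<le> C * (1 / real (Suc N) + 1 / real (Suc N))"
              using that by (intro mult_left_mono[OF _ C(1)] add_mono) (auto simp: frac_le)
            also have "\<dots> < e" using N by linarith
            finally show ?thesis .
          qed
          then show "\<exists>M. \<forall>m\<ge>M. \<forall>n\<ge>M. dist (x m) (x n) < e" by blast
        qed
        then obtain l where l: "x \<longlonglongrightarrow> l" using Cauchy_convergent_iff convergent_def by blast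
        have "l \<in> M" using closed_sequentially[OF cM _ l] x(1) by blast
        moreover have "(\<lambda>n. f (x n)) \<longlonglongrightarrow> f l" using l by (intro tendsto_intros)
        then have "f l = 1" using x(2) LIMSEQ_unique[OF _ tendsto_const] by fastforce
        moreover have "A l = 0"
        proof -
          have "(\<lambda>n. A (x n)) \<longlonglongrightarrow> 0"
          proof (rule Lim_null_comparison[OF _ LIMSEQ_Suc[OF lim_1_over_n]])
            have "norm (A (x n)) \<le> 1 / real (Suc n)" for n using x(3)[of n] fsum_nonneg[of fs "x n"] by linarith
            then show "\<forall>\<^sub>F n in sequentially. norm (A (x n)) \<le> 1 / real (Suc n)" by simp
          qed
          moreover have "(\<lambda>n. A (x n)) \<longlonglongrightarrow> A l" using l by (intro tendsto_intros)
          ultimately show ?thesis using LIMSEQ_unique by blast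
        qed
        ultimately show False using False by auto
      qed
      then obtain D where D: "D \<ge> 0" "\<And>x. x \<in> M \<Longrightarrow> \<bar>f x\<bar> \<le> D * (norm (A x) + fsum fs x)" by blast
      show ?thesis
      proof (rule Cons.IH[OF sM cM])
        show "C * (1 + D) \<ge> 0" using C(1) D(1) by simp
        fix x assume x: "x \<in> M"
        have "norm x \<le> C * (norm (A x) + fsum fs x + \<bar>f x\<bar>)" using C(2)[OF x] by (simp add: add_ac)
        also have "\<dots> \<le> C * (norm (A x) + fsum fs x + D * (norm (A x) + fsum fs x))"
          by (intro mult_left_mono add_left_mono D(2)[OF x] C(1))
        finally show "norm x \<le> C * (1 + D) * (norm (A x) + fsum fs x)" by (simp add: algebra_simps)
      qed
    qed
  qed
  show ?thesis using assms(3) main[OF assms(1,2)] unfolding semi_est_def by blast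
qed

text \<open>A point y of the closure is approximated within norm y / 2 by some A w, whose norm is
  then at most 2 norm y. Replacing w by a selected preimage of norm at most 2 C norm y gives the
  step needed by \<open>approx_surj\<close>, with all residuals in the closure.\<close>

lemma closed_image:
  fixes A :: "'a::banach \<Rightarrow>\<^sub>L 'b::real_normed_vector"
  assumes M: "subspace M" "closed M" and "semi_est A M"
  shows "closed (A ` M)"
proof -
  obtain C where C: "C \<ge> 0" "\<And>x. x \<in> M \<Longrightarrow> \<exists>z\<in>M. A z = A x \<and> norm z \<le> C * norm (A x)"
    using bounded_selection[OF assms] by blast
  let ?Y = "closure (A ` M)"
  have sY: "subspace ?Y"
    by (intro subspace_closure linear_subspace_image M(1))
      (simp add: blinfun.bounded_linear_right bounded_linear.linear)
  have "\<exists>x\<in>M. y - A x \<in> ?Y \<and> norm x \<le> (C * 2) * norm y \<and> norm (y - A x) \<le> norm y / 2" if y: "y \<in> ?Y" for y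
  proof (cases "y = 0")
    case True
    then show ?thesis using y subspace_0[OF M(1)] by (intro bexI[of _ 0]) (auto simp: blinfun.zero_right)
  next
    case False
    then obtain w where w: "w \<in> M" "dist (A w) y < norm y / 2"
      using y closure_approachable[of y "A ` M"] by (auto dest!: spec[of _ "norm y / 2"])
    obtain z where z: "z \<in> M" "A z = A w" "norm z \<le> C * norm (A w)" using C(2)[OF w(1)] by blast
    have "norm (A w) \<le> 2 * norm y"
      using norm_triangle_ineq2[of "A w" y] w(2) norm_ge_zero[of y] unfolding dist_norm by linarith
    then have "norm z \<le> (C * 2) * norm y" using z(3) mult_left_mono[OF _ C(1)] by fastforce
    moreover have "y - A z \<in> ?Y" using z(1) closure_subset[of "A ` M"] by (intro subspace_diff[OF sY y]) auto
    ultimately show ?thesis using z w(2) by (intro bexI[of _ z]) (auto simp: dist_norm norm_minus_commute)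
  qed
  then have "\<exists>x\<in>M. A x = y \<and> norm x \<le> 2 * (C * 2) * norm y" if "y \<in> ?Y" for y
    using C(1) that by (intro approx_surj[OF M, of "C * 2" y ?Y]) auto
  then have "?Y \<subseteq> A ` M" by blast
  then show ?thesis using closure_subset_eq by blast
qed

section \<open>Invertible plus finite rank\<close>

text \<open>On a Banach space these are the Fredholm operators of index zero. Written as invertible
  plus finite rank, openness and stability under composition are immediate and no index has to be
  defined.\<close>

definition fredholm0 :: "('a::real_normed_vector \<Rightarrow>\<^sub>L 'a) set" where
  "fredholm0 = {V + K | V K. V \<in> GL \<and> K \<in> finite_rank}"

lemma fredholm0_I: "V \<in> GL \<Longrightarrow> K \<in> finite_rank \<Longrightarrow> V + K \<in> fredholm0"
  unfolding fredholm0_def by blast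

lemma GL_fredholm0: "V \<in> GL \<Longrightarrow> V \<in> fredholm0"
  using fredholm0_I[of V 0] finite_rank_zero by simp

lemma fredholm0_add_finite_rank:
  assumes "B \<in> fredholm0" "F \<in> finite_rank"
  shows "B + F \<in> fredholm0"
proof -
  obtain V K where "V \<in> GL" "K \<in> finite_rank" "B = V + K" using assms unfolding fredholm0_def by blast
  then show ?thesis
    using fredholm0_I[of V "K + F"] finite_rank_add[of K F] assms(2) by (simp only: add.assoc)
qed

lemma fredholm0_compose:
  assumes "A \<in> fredholm0" "B \<in> fredholm0"
  shows "A o\<^sub>L B \<in> fredholm0"
proof -
  obtain V K where 1: "V \<in> GL" "K \<in> finite_rank" "A = V + K" using assms unfolding fredholm0_def by blast
  obtain W L where 2: "W \<in> GL" "L \<in> finite_rank" "B = W + L" using assms unfolding fredholm0_def by blast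
  have eq: "A o\<^sub>L B = (V o\<^sub>L W) + ((V o\<^sub>L L) + (K o\<^sub>L B))"
    unfolding 1 2 by (rule blinfun_eqI) (simp add: blinfun.bilinear_simps)
  show ?thesis
    unfolding eq using 1(1,2) 2(1,2)
    by (intro fredholm0_I GL_compose finite_rank_add finite_rank_compose_left finite_rank_compose_right)
qed

lemma open_fredholm0: "open (fredholm0 :: ('a::banach \<Rightarrow>\<^sub>L 'a) set)"
  unfolding open_dist
proof
  fix B :: "'a \<Rightarrow>\<^sub>L 'a" assume "B \<in> fredholm0"
  then obtain V K where B: "V \<in> GL" "K \<in> finite_rank" "B = V + K" unfolding fredholm0_def by blast
  obtain e where e: "e > 0" "\<And>A. dist A V < e \<Longrightarrow> A \<in> GL" using open_GL B(1) unfolding open_dist by blast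
  have "A \<in> fredholm0" if "dist A B < e" for A
  proof -
    have "A - K \<in> GL" using that e(2)[of "A - K"] B(3) by (simp add: dist_norm algebra_simps)
    then show ?thesis using fredholm0_I[of "A - K" K] B(2) by simp
  qed
  then show "\<exists>e>0. \<forall>A. dist A B < e \<longrightarrow> A \<in> fredholm0" using e(1) by blast
qed

lemma fredholm0_semi_est:
  fixes B :: "'a::banach \<Rightarrow>\<^sub>L 'a"
  assumes "B \<in> fredholm0"
  shows "semi_est B M"
proof -
  obtain V K where B: "V \<in> GL" "K \<in> finite_rank" "B = V + K" using assms unfolding fredholm0_def by blast
  obtain c where c: "c > 0" "\<And>x. c * norm x \<le> norm (V x)" using GL_bounded_below[OF B(1)] by blast
  show ?thesis
  proof (rule semi_est_finite_rank[OF B(2), of "1/c"])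
    fix x
    have "c * norm x \<le> norm (B x - K x)" using c(2)[of x] by (simp add: B(3) blinfun.add_left)
    also have "\<dots> \<le> norm (B x) + norm (K x)" by (rule norm_triangle_ineq4)
    finally show "norm x \<le> 1 / c * (norm (B x) + norm (K x))" using c(1) by (simp add: field_simps)
  qed (use c(1) in simp)
qed

text \<open>Factoring out the invertible part leaves 1 + W with the range of W in a finite span.
  This span is invariant under 1 + W, so questions about kernel and range become
  finite-dimensional.\<close>

lemma fredholm0_E:
  fixes B :: "'a::real_normed_vector \<Rightarrow>\<^sub>L 'a"
  assumes "B \<in> fredholm0"
  obtains V V' W :: "'a \<Rightarrow>\<^sub>L 'a" and D where "\<And>x. V' (V x) = x" "\<And>x. V (V' x) = x"
    "finite D" "\<And>x. W x \<in> span D" "\<And>x. B x = V (x + W x)"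
proof -
  obtain V K where V: "V \<in> GL" "K \<in> finite_rank" "B = V + K" using assms unfolding fredholm0_def by blast
  obtain V' where V': "\<And>x. blinfun_apply V' (V x) = x" "\<And>x. V (V' x) = x" using GL_E[OF V(1)] by metis
  obtain D where D: "finite D" "\<And>x. (V' o\<^sub>L K) x \<in> span D"
    using finite_rank_range[OF finite_rank_compose_left[OF V(2)]] by blast
  show thesis
    by (rule that[of V' V D "V' o\<^sub>L K"]) (use V' D in \<open>auto simp: V(3) blinfun.bilinear_simps\<close>)
qed

section \<open>Injectivity and surjectivity coincide for operators of index zero\<close>

lemma linear_on_finite_span_surj:
  fixes L :: "'a::real_vector \<Rightarrow> 'a"
  assumes L: "linear L" and E: "finite B" "\<And>x. x \<in> span B \<Longrightarrow> L x \<in> span B"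
    and inj: "\<And>x. x \<in> span B \<Longrightarrow> L x = 0 \<Longrightarrow> x = 0" and y: "y \<in> span B"
  shows "\<exists>x\<in>span B. L x = y"
proof -
  obtain C where C: "C \<subseteq> span B" "independent C" "span B \<subseteq> span C" using basis_exists[of "span B"] by metis
  have fC: "finite C" using independent_span_bound[OF E(1) C(2,1)] by blast
  have spC: "span C = span B" using C(1,3) span_minimal[OF C(1)] by auto
  have injC: "inj_on L (span C)"
    using linear_injective_on_subspace_0[OF L, of "span C"] inj spC by auto
  have ind: "independent (L ` C)" by (rule linear_independent_injective_image[OF L C(2) injC])
  have card: "card (L ` C) = card C"
    by (rule card_image) (rule inj_on_subset[OF injC span_superset])
  have "y \<in> span (L ` C)"
  proof (rule ccontr)
    assume n: "y \<notin> span (L ` C)"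
    then have "independent (insert y (L ` C))" using ind independent_insertI by blast
    moreover have "insert y (L ` C) \<subseteq> span C" using y spC C(1) E(2) by auto
    ultimately have "card (insert y (L ` C)) \<le> card C" using independent_span_bound[OF fC] by blast
    moreover have "y \<notin> L ` C" using n span_base[of y "L ` C"] by auto
    ultimately show False using card fC by simp
  qed
  then have "y \<in> L ` span C" using linear_span_image[OF L, of C] by simp
  then show ?thesis using spC by blast
qed

text \<open>A nonzero kernel vector x could be extended to a basis C of the span. The images of the
  other basis vectors would still span everything, with fewer than \<open>card C\<close>
  elements.\<close>

lemma linear_on_finite_span_inj:
  fixes L :: "'a::real_vector \<Rightarrow> 'a"
  assumes L: "linear L" and B: "finite B"
    and surj: "span B \<subseteq> L ` span B" and x: "x \<in> span B" "L x = 0"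
  shows "x = 0"
proof (rule ccontr)
  assume "x \<noteq> 0"
  then have "independent {x}" by simp
  then obtain C where C: "{x} \<subseteq> C" "C \<subseteq> span B" "independent C" "span B \<subseteq> span C"
    using maximal_independent_subset_extend[of "{x}" "span B"] x(1) by auto
  have fC: "finite C" using independent_span_bound[OF B C(3,2)] by blast
  have spC: "span C = span B" using C(2,4) span_minimal[OF C(2)] by auto
  have "span B \<subseteq> span (L ` (C - {x}))"
  proof -
    have "span B \<subseteq> span (L ` C)" using surj linear_span_image[OF L, of C] spC by simp
    also have "L ` C = insert 0 (L ` (C - {x}))" using x(2) C(1) by auto
    also have "span \<dots> = span (L ` (C - {x}))" by (rule span_insert_0)
    finally show ?thesis .
  qed
  then have "C \<subseteq> span (L ` (C - {x}))" using C(2) by blast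
  then have "card C \<le> card (L ` (C - {x}))"
    using independent_span_bound[OF _ C(3), of "L ` (C - {x})"] fC by simp
  also have "\<dots> \<le> card (C - {x})" using fC by (intro card_image_le) auto
  also have "\<dots> < card C" using fC C(1) by (intro psubset_card_mono) auto
  finally show False by simp
qed

text \<open>With B = V (1 + W), the map 1 + W is injective on the invariant finite span, hence onto
  there. For arbitrary y one has (1 + W) y = y + W y, and the error W y lies in that span, so it can
  be corrected. The bound for the inverse comes from \<open>bounded_selection\<close>, since
  preimages are unique.\<close>

lemma fredholm0_injective_GL:
  fixes B :: "'a::banach \<Rightarrow>\<^sub>L 'a"
  assumes B: "B \<in> fredholm0" and inj: "\<And>x. B x = 0 \<Longrightarrow> x = 0"
  shows "B \<in> GL"
proof -
  obtain V V' W D where V': "\<And>x. blinfun_apply V' (blinfun_apply V x) = x" "\<And>x. V (V' x) = x"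
    and D: "finite D" "\<And>x. blinfun_apply W x \<in> span D" and BV: "\<And>x. B x = V (x + W x)"
    using fredholm0_E[OF B] by metis
  define L where "L = (\<lambda>x. x + W x)"
  have BL: "B x = V (L x)" for x by (simp add: BV L_def)
  have linL: "linear L"
    unfolding L_def by (rule linearI) (simp_all add: blinfun.bilinear_simps algebra_simps)
  have surj: "\<exists>x. B x = y" for y
  proof -
    let ?y = "V' y"
    have "\<exists>e\<in>span D. L e = - W ?y"
    proof (rule linear_on_finite_span_surj[OF linL D(1)])
      show "L x \<in> span D" if "x \<in> span D" for x unfolding L_def by (rule span_add[OF that D(2)])
      show "x = 0" if "L x = 0" for x by (rule inj) (simp add: BL that blinfun.zero_right)
    qed (rule span_neg[OF D(2)])
    then obtain e where e: "L e = - W ?y" by blast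
    have "L (?y + e) = ?y" using e linear_add[OF linL, of ?y e] by (simp add: L_def)
    then have "B (?y + e) = y" by (simp add: BL V')
    then show ?thesis by blast
  qed
  obtain C where C: "C \<ge> 0" "\<And>x. \<exists>z. B z = B x \<and> norm z \<le> C * norm (B x)"
    using bounded_selection[OF subspace_UNIV closed_UNIV fredholm0_semi_est[OF B]] by auto
  have "norm x \<le> C * norm (B x)" for x
  proof -
    obtain z where z: "B z = B x" "norm z \<le> C * norm (B x)" using C(2) by blast
    have "B (z - x) = 0" using z(1) by (simp add: blinfun.diff_right)
    then show ?thesis using inj[of "z - x"] z(2) by simp
  qed
  then have "norm x \<le> (C + 1) * norm (B x)" for x
    by (rule order_trans) (simp add: mult_right_mono)
  then show ?thesis
    by (intro GL_bounded_below_surj[of "1 / (C + 1)"] surj) (use C(1) in \<open>auto simp: field_simps\<close>)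
qed

text \<open>A solution z of (1 + W) z = y with y in the finite span lies in that span itself,
  because z = y - W z. So surjectivity restricts to the span, where it gives injectivity, and the
  kernel of 1 + W lies there as well.\<close>

lemma fredholm0_surj_GL:
  fixes B :: "'a::banach \<Rightarrow>\<^sub>L 'a"
  assumes B: "B \<in> fredholm0" and surj: "\<And>y. \<exists>x. B x = y"
  shows "B \<in> GL"
proof (rule fredholm0_injective_GL[OF B])
  fix x assume x: "B x = 0"
  obtain V V' W D where V': "\<And>x. blinfun_apply V' (blinfun_apply V x) = x" "\<And>x. V (V' x) = x"
    and D: "finite D" "\<And>x. blinfun_apply W x \<in> span D" and BV: "\<And>x. B x = V (x + W x)"
    using fredholm0_E[OF B] by metis
  define L where "L = (\<lambda>x. x + W x)"
  have BL: "B x = V (L x)" for x by (simp add: BV L_def)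
  have linL: "linear L"
    unfolding L_def by (rule linearI) (simp_all add: blinfun.bilinear_simps algebra_simps)
  have L0: "L x = 0" using x V'(1)[of "L x"] by (simp add: BL blinfun.zero_right)
  show "x = 0"
  proof (rule linear_on_finite_span_inj[OF linL D(1) _ _ L0])
    have "x = - W x" using L0 by (simp add: L_def add_eq_0_iff2)
    then show "x \<in> span D" using D(2)[of x] span_neg by metis
    show "span D \<subseteq> L ` span D"
    proof
      fix y assume y: "y \<in> span D"
      obtain z where "B z = V y" using surj[of "V y"] by (elim exE)
      then have "V' (V (L z)) = V' (V y)" by (simp only: BL)
      then have "L z = y" by (simp only: V'(1))
      moreover have "z = y - W z" using \<open>L z = y\<close> by (simp add: L_def algebra_simps)
      then have "z \<in> span D" using span_diff[OF y D(2)[of z]] by simp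
      ultimately show "y \<in> L ` span D" by blast
    qed
  qed
qed

text \<open>
  A functional can be removed from the estimate by adding a rank-one operator with a value outside
  the range, unless the operator is already surjective.
\<close>

lemma semi_est_reduce:
  fixes A :: "'a::banach \<Rightarrow>\<^sub>L 'a"
  assumes "semi_est A UNIV"
  shows "\<exists>F\<in>finite_rank. (\<exists>C\<ge>0. \<forall>x. norm x \<le> C * norm ((A + F) x)) \<or>
    (\<exists>C\<ge>0. \<forall>y. \<exists>x. (A + F) x = y \<and> norm x \<le> C * norm y)"
proof -
  have main: "\<exists>F\<in>finite_rank. (\<exists>C\<ge>0. \<forall>x. norm x \<le> C * norm ((A + F) x)) \<or>
    (\<exists>C\<ge>0. \<forall>y. \<exists>x. (A + F) x = y \<and> norm x \<le> C * norm y)"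
    if "C \<ge> 0" "\<And>x. norm x \<le> C * (norm (A x) + fsum fs x)" for fs C and A :: "'a \<Rightarrow>\<^sub>L 'a"
    using that
  proof (induction fs arbitrary: A C)
    case Nil
    then show ?case by (intro bexI[of _ 0] disjI1 exI[of _ C]) (auto simp: finite_rank_zero)
  next
    case (Cons f fs)
    have est: "semi_est A UNIV" unfolding semi_est_def using Cons.prems by blast
    show ?case
    proof (cases "range A = UNIV")
      case True
      obtain D where D: "D \<ge> 0" "\<And>x. \<exists>z. A z = A x \<and> norm z \<le> D * norm (A x)"
        using bounded_selection[OF subspace_UNIV closed_UNIV est] by auto
      have "\<exists>x. A x = y \<and> norm x \<le> D * norm y" for y
        using D(2) True by (metis surjD)
      then show ?thesis using D(1) by (intro bexI[of _ 0] disjI2 exI[of _ D]) (auto simp: finite_rank_zero)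
    next
      case False
      then obtain w where w: "w \<notin> range A" by blast
      have cl: "closed (range A)" by (rule closed_image[OF subspace_UNIV closed_UNIV est])
      have "open (- range A)" "w \<in> - range A" using cl w by auto
      then obtain d where d: "d > 0" "\<And>y. dist y w < d \<Longrightarrow> y \<in> - range A"
        unfolding open_dist by blast
      then have dle: "d \<le> dist w y" if "y \<in> range A" for y
        using that by (metis ComplD dist_commute not_le)
      define A' where "A' = A + rank_one w f"
      have A'x: "A' x = A x + f x *\<^sub>R w" for x by (simp add: A'_def blinfun.add_left)
      \<comment> \<open>\<open>A' x\<close> is f x times the difference of w and an element of the
        range, which has norm at least d. So \<open>A'\<close> controls f by itself, and f can leave
        the list.\<close>
      have fx: "d * \<bar>f x\<bar> \<le> norm (A' x)" for x
      proof (cases "f x = 0")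
        case False
        have "A ((- 1 / f x) *\<^sub>R x) = (- 1 / f x) *\<^sub>R A x" by (rule blinfun.scaleR_right)
        then have "A' x = f x *\<^sub>R (w - A ((- 1 / f x) *\<^sub>R x))"
          using False by (simp add: A'x algebra_simps)
        then have "norm (A' x) = \<bar>f x\<bar> * dist w (A ((- 1 / f x) *\<^sub>R x))" by (simp add: dist_norm)
        moreover have "\<bar>f x\<bar> * d \<le> \<bar>f x\<bar> * dist w (A ((- 1 / f x) *\<^sub>R x))"
          by (intro mult_left_mono dle) auto
        ultimately show ?thesis by (simp add: mult.commute)
      qed simp
      have "norm x \<le> (C * (1 + (norm w + 1) / d)) * (norm (A' x) + fsum fs x)" for x
      proof -
        have s: "fsum fs x \<ge> 0" by (rule fsum_nonneg)
        have fx': "\<bar>f x\<bar> \<le> norm (A' x) / d" using fx[of x] d(1) by (simp add: field_simps)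
        have "A x = A' x - f x *\<^sub>R w" by (simp add: A'x)
        then have "norm (A x) \<le> norm (A' x) + \<bar>f x\<bar> * norm w" by (metis norm_triangle_ineq4 norm_scaleR)
        then have "norm (A x) + fsum (f # fs) x \<le> norm (A' x) + \<bar>f x\<bar> * (norm w + 1) + fsum fs x"
          by (simp add: algebra_simps)
        also have "\<dots> \<le> norm (A' x) + (norm (A' x) / d) * (norm w + 1) + fsum fs x"
          by (intro add_mono mult_right_mono fx') auto
        also have "\<dots> = (1 + (norm w + 1) / d) * norm (A' x) + 1 * fsum fs x" by (simp add: algebra_simps)
        also have "\<dots> \<le> (1 + (norm w + 1) / d) * norm (A' x) + (1 + (norm w + 1) / d) * fsum fs x"
          using d(1) s by (intro add_mono mult_right_mono) auto
        finally have "norm (A x) + fsum (f # fs) x \<le> (1 + (norm w + 1) / d) * (norm (A' x) + fsum fs x)"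
          by (simp add: algebra_simps)
        then have "C * (norm (A x) + fsum (f # fs) x) \<le> C * ((1 + (norm w + 1) / d) * (norm (A' x) + fsum fs x))"
          by (rule mult_left_mono[OF _ Cons.prems(1)])
        then show ?thesis using Cons.prems(2)[of x] by (simp add: mult.assoc)
      qed
      moreover have "C * (1 + (norm w + 1) / d) \<ge> 0" using Cons.prems(1) d(1) by simp
      ultimately obtain F where F: "F \<in> finite_rank" "(\<exists>C\<ge>0. \<forall>x. norm x \<le> C * norm ((A' + F) x)) \<or>
          (\<exists>C\<ge>0. \<forall>y. \<exists>x. (A' + F) x = y \<and> norm x \<le> C * norm y)"
        using Cons.IH[of "C * (1 + (norm w + 1) / d)" A'] by blast
      have "A' + F = A + (rank_one w f + F)" by (simp add: A'_def)
      then show ?thesis using F finite_rank_add[OF rank_one_finite_rank F(1)] by metis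
    qed
  qed
  obtain fs C where "C \<ge> 0" "\<And>x. norm x \<le> C * (norm (A x) + fsum fs x)"
    using assms unfolding semi_est_def by auto
  then show ?thesis by (rule main)
qed

text \<open>After a finite-rank correction, A + F is bounded below or boundedly onto. A sufficiently
  close B in \<open>fredholm0\<close> inherits this property and is therefore invertible, with a
  lower bound exceeding its distance to A + F; so A + F is invertible too.\<close>

lemma fredholm0_limit:
  fixes A :: "'a::banach \<Rightarrow>\<^sub>L 'a"
  assumes est: "semi_est A UNIV" and lim: "A \<in> closure fredholm0"
  shows "A \<in> fredholm0"
proof -
  obtain F where F: "F \<in> finite_rank" and alt: "(\<exists>C\<ge>0. \<forall>x. norm x \<le> C * norm ((A + F) x)) \<or>
    (\<exists>C\<ge>0. \<forall>y. \<exists>x. (A + F) x = y \<and> norm x \<le> C * norm y)"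
    using semi_est_reduce[OF est] by blast
  have near: "\<exists>B\<in>fredholm0. norm (A + F - B) < e" if "e > 0" for e
  proof -
    obtain B where "B \<in> fredholm0" "dist B A < e" using lim \<open>e > 0\<close> unfolding closure_approachable by blast
    then show ?thesis
      using fredholm0_add_finite_rank[OF _ F] by (intro bexI[of _ "B + F"]) (auto simp: dist_norm norm_minus_commute)
  qed
  have "A + F \<in> GL"
    using alt
  proof
    assume "\<exists>C\<ge>0. \<forall>x. norm x \<le> C * norm ((A + F) x)"
    then obtain C where C: "C \<ge> 0" "\<And>x. norm x \<le> C * norm ((A + F) x)" by blast
    define c where "c = 1 / (C + 1)"
    have c: "c > 0" using C(1) by (simp add: c_def)
    have low: "c * norm x \<le> norm ((A + F) x)" for x
    proof -
      have "norm x \<le> (C + 1) * norm ((A + F) x)" by (rule order_trans[OF C(2)]) (simp add: mult_right_mono)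
      then show ?thesis using C(1) by (simp add: c_def field_simps)
    qed
    obtain B where B: "B \<in> fredholm0" "norm (A + F - B) < c / 2" using near[of "c/2"] c by auto
    have lowB: "c / 2 * norm x \<le> norm (B x)" for x
    proof -
      have "c * norm x \<le> norm (B x + (A + F - B) x)" using low[of x] by (simp add: blinfun.bilinear_simps)
      also have "\<dots> \<le> norm (B x) + norm (A + F - B) * norm x"
        by (rule order_trans[OF norm_triangle_ineq]) (intro add_left_mono norm_blinfun)
      also have "\<dots> \<le> norm (B x) + c / 2 * norm x" using B(2) by (intro add_left_mono mult_right_mono) auto
      finally show ?thesis by simp
    qed
    have "B \<in> GL"
    proof (rule fredholm0_injective_GL[OF B(1)])
      fix x assume "B x = 0"
      then show "x = 0" using lowB[of x] c by (simp add: mult_le_0_iff)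
    qed
    then have "B + (A + F - B) \<in> GL" using lowB B(2) by (rule GL_perturb)
    then show ?thesis by simp
  next
    assume "\<exists>C\<ge>0. \<forall>y. \<exists>x. (A + F) x = y \<and> norm x \<le> C * norm y"
    then obtain C0 where C0: "C0 \<ge> 0" "\<And>y. \<exists>x. (A + F) x = y \<and> norm x \<le> C0 * norm y" by blast
    define C where "C = C0 + 1"
    have C: "C > 0" using C0(1) by (simp add: C_def)
    have sel: "\<exists>x. (A + F) x = y \<and> norm x \<le> C * norm y" for y
    proof -
      obtain x where x: "(A + F) x = y" "norm x \<le> C0 * norm y" using C0(2) by blast
      have "C0 * norm y \<le> C * norm y" by (simp add: C_def mult_right_mono)
      with x show ?thesis by (intro exI[of _ x]) auto
    qed
    \<comment> \<open>This distance does two things: it makes the residuals at most norm y / 2 in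
      \<open>approx_surj\<close>, and it is below 1 / (2 * C), the lower bound that the resulting
      selection gives for B.\<close>
    obtain B where B: "B \<in> fredholm0" "norm (A + F - B) < 1 / (2 * C)" using near[of "1 / (2 * C)"] C by auto
    have app: "\<exists>x. norm x \<le> C * norm y \<and> norm (y - B x) \<le> norm y / 2" for y
    proof -
      obtain x where x: "(A + F) x = y" "norm x \<le> C * norm y" using sel by blast
      have "norm (y - B x) = norm ((A + F - B) x)" using x(1) by (simp add: blinfun.bilinear_simps)
      also have "\<dots> \<le> norm (A + F - B) * norm x" by (rule norm_blinfun)
      also have "\<dots> \<le> (1 / (2 * C)) * (C * norm y)" using B(2) x(2) C by (intro mult_mono) auto
      also have "\<dots> = norm y / 2" using C by simp
      finally show ?thesis using x(2) by blast
    qed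
    have sB: "\<exists>x. B x = y \<and> norm x \<le> 2 * C * norm y" for y
      using approx_surj[OF subspace_UNIV closed_UNIV, of C y UNIV B for y] app C by simp
    then have BG: "B \<in> GL" by (intro fredholm0_surj_GL[OF B(1)]) blast
    have "1 / (2 * C) * norm x \<le> norm (B x)" for x
    proof -
      obtain z where z: "B z = B x" "norm z \<le> 2 * C * norm (B x)" using sB by blast
      have "B (z - x) = 0" using z(1) by (simp add: blinfun.diff_right)
      then have "z = x" using GL_eq_0_iff[OF BG] by simp
      then show ?thesis using z(2) C by (simp add: field_simps)
    qed
    then have "B + (A + F - B) \<in> GL" using B(2) by (intro GL_perturb[OF BG])
    then show ?thesis by simp
  qed
  then have "A + F + - F \<in> fredholm0" by (intro fredholm0_I finite_rank_uminus F)
  then show ?thesis by simp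
qed

text \<open>Homotopy to a multiple of the identity along \<open>c + s S\<close>, \<open>0 \<le> s \<le> 1\<close>.\<close>

lemma scalar_plus_strictly_singular_fredholm0:
  fixes S :: "'a::banach \<Rightarrow>\<^sub>L 'a"
  assumes S: "S \<in> strictly_singular" and c: "c \<noteq> 0"
  shows "c *\<^sub>R id_blinfun + S \<in> fredholm0"
proof -
  define \<gamma> where "\<gamma> s = c *\<^sub>R id_blinfun + s *\<^sub>R S" for s :: real
  have cont: "continuous_on UNIV \<gamma>" unfolding \<gamma>_def by (intro continuous_intros)
  have est: "semi_est (\<gamma> s) UNIV" for s
  proof -
    have "s *\<^sub>R S \<in> strictly_singular"
      using strictly_singular_scaleR[OF S, of s] zero_strictly_singular by (cases "s = 0") auto
    then show ?thesis unfolding \<gamma>_def by (rule semi_est_scalar_plus_strictly_singular[OF _ c])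
  qed
  \<comment> \<open>The estimate holds at every s, so limits of operators of
    \<open>fredholm0\<close> along the line stay there. The parameter set is thus both open and
    closed in the real line.\<close>
  have eq: "\<gamma> -` fredholm0 = \<gamma> -` closure fredholm0"
    using fredholm0_limit[OF est] closure_subset by blast
  have "open (\<gamma> -` fredholm0)" using cont open_fredholm0 by (metis open_vimage)
  moreover have "closed (\<gamma> -` fredholm0)" unfolding eq
    using cont by (intro continuous_closed_vimage) (auto simp: continuous_on_eq_continuous_at)
  ultimately have "\<gamma> -` fredholm0 = {} \<or> \<gamma> -` fredholm0 = UNIV" by (rule clopen[THEN iffD1, OF conjI, rotated])
  moreover have "0 \<in> \<gamma> -` fredholm0"
    using GL_fredholm0[OF GL_scaleR[OF GL_id c]] by (simp add: \<gamma>_def)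
  ultimately have "\<gamma> 1 \<in> fredholm0" by blast
  then show ?thesis by (simp add: \<gamma>_def)
qed

section \<open>The scalar part of an operator\<close>

lemma op_class_eq_iff:
  fixes T T' :: "'a::banach \<Rightarrow>\<^sub>L 'a"
  shows "op_class T = op_class T' \<longleftrightarrow> T - T' \<in> strictly_singular"
proof -
  have uminus: "- S \<in> strictly_singular" if "S \<in> strictly_singular" for S :: "'a \<Rightarrow>\<^sub>L 'a"
    using strictly_singular_scaleR[OF that, of "-1"] by simp
  have mem: "A \<in> op_class T \<longleftrightarrow> A - T \<in> strictly_singular" for A T :: "'a \<Rightarrow>\<^sub>L 'a"
  proof -
    have "op_class T = (\<Union>S\<in>strictly_singular. {S + T})"
      by (auto simp: op_class_def a_r_coset_def' operator_ring_def)
    then show ?thesis by (auto intro!: bexI[of _ "A - T"])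
  qed
  show ?thesis
  proof
    assume "op_class T = op_class T'"
    moreover have "T \<in> op_class T" by (simp add: mem zero_strictly_singular)
    ultimately show "T - T' \<in> strictly_singular" using mem by blast
  next
    assume d: "T - T' \<in> strictly_singular"
    have "A - T \<in> strictly_singular \<longleftrightarrow> A - T' \<in> strictly_singular" for A
      using strictly_singular_add[OF _ d, of "A - T"] strictly_singular_add[OF _ uminus[OF d], of "A - T'"] by auto
    then show "op_class T = op_class T'" by (auto simp: mem)
  qed
qed

locale type_R_space =
  fixes space_type :: "'a::banach itself"
  assumes infinite: "infinite_dimensional (UNIV :: 'a set)"
    and type_R: "type_R TYPE('a)"
begin

lemma pi_X_strictly_singular: "T - pi_X T *\<^sub>R id_blinfun \<in> strictly_singular"
  for T :: "'a \<Rightarrow>\<^sub>L 'a"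
  using theI'[OF type_R_ex1[OF type_R, of T]] by (simp add: pi_X_def op_class_eq_iff)

lemma pi_X_eqI: "T - r *\<^sub>R id_blinfun \<in> strictly_singular \<Longrightarrow> pi_X T = r"
  for T :: "'a \<Rightarrow>\<^sub>L 'a"
  unfolding pi_X_def by (rule the1_equality[OF type_R_ex1[OF type_R]]) (simp add: op_class_eq_iff)

lemma pi_X_add: "pi_X (S + T) = pi_X S + pi_X T" for S T :: "'a \<Rightarrow>\<^sub>L 'a"
proof (rule pi_X_eqI)
  have "(S - pi_X S *\<^sub>R id_blinfun) + (T - pi_X T *\<^sub>R id_blinfun) \<in> strictly_singular"
    by (intro strictly_singular_add pi_X_strictly_singular)
  then show "S + T - (pi_X S + pi_X T) *\<^sub>R id_blinfun \<in> strictly_singular"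
    by (simp add: algebra_simps)
qed

lemma pi_X_scaleR: "pi_X (c *\<^sub>R T) = c * pi_X T" for T :: "'a \<Rightarrow>\<^sub>L 'a"
proof (rule pi_X_eqI)
  have "c *\<^sub>R (T - pi_X T *\<^sub>R id_blinfun) \<in> strictly_singular"
    using strictly_singular_scaleR[OF pi_X_strictly_singular[of T], of c] zero_strictly_singular
    by (cases "c = 0") auto
  then show "c *\<^sub>R T - (c * pi_X T) *\<^sub>R id_blinfun \<in> strictly_singular"
    by (simp add: algebra_simps)
qed

lemma pi_X_id: "pi_X (id_blinfun :: 'a \<Rightarrow>\<^sub>L 'a) = 1"
  by (rule pi_X_eqI) (simp add: zero_strictly_singular)

lemma pi_X_uminus: "pi_X (- T) = - pi_X T" for T :: "'a \<Rightarrow>\<^sub>L 'a"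
  using pi_X_scaleR[of "-1" T] by simp

lemma pi_X_finite_rank: "K \<in> finite_rank \<Longrightarrow> pi_X K = 0" for K :: "'a \<Rightarrow>\<^sub>L 'a"
  by (rule pi_X_eqI) (simp add: finite_rank_strictly_singular)

lemma pi_X_shift: "pi_X (T + t *\<^sub>R id_blinfun) = pi_X T + t" for T :: "'a \<Rightarrow>\<^sub>L 'a"
  by (simp add: pi_X_add pi_X_scaleR pi_X_id)

lemma pi_X_GL: "T \<in> GL \<Longrightarrow> pi_X T \<noteq> 0" for T :: "'a \<Rightarrow>\<^sub>L 'a"
  using pi_X_strictly_singular[of T] GL_not_strictly_singular[OF infinite, of T] by auto

text \<open>If |pi_X T| exceeded the norm, T - pi_X T would be invertible as a large shift, although
  it is strictly singular. The bound yields the continuity of \<open>pi_X\<close>.\<close>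

lemma abs_pi_X_le: "\<bar>pi_X T\<bar> \<le> norm T" for T :: "'a \<Rightarrow>\<^sub>L 'a"
proof (rule ccontr)
  assume "\<not> ?thesis"
  then have "T + (- pi_X T) *\<^sub>R id_blinfun \<in> GL" by (intro GL_large_shift) auto
  then have "T - pi_X T *\<^sub>R id_blinfun \<in> GL" by simp
  then show False using GL_not_strictly_singular[OF infinite] pi_X_strictly_singular by blast
qed

lemma continuous_on_pi_X: "continuous_on A (pi_X :: ('a \<Rightarrow>\<^sub>L 'a) \<Rightarrow> real)"
proof -
  have "bounded_linear (pi_X :: ('a \<Rightarrow>\<^sub>L 'a) \<Rightarrow> real)"
    by (rule bounded_linear_intro[where K=1]) (auto simp: pi_X_add pi_X_scaleR abs_pi_X_le)
  then show ?thesis by (rule linear_continuous_on)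
qed

lemma pi_X_fredholm0: "pi_X T \<noteq> 0 \<Longrightarrow> T \<in> fredholm0" for T :: "'a \<Rightarrow>\<^sub>L 'a"
  using scalar_plus_strictly_singular_fredholm0[OF pi_X_strictly_singular[of T], of "pi_X T"] by simp

end

section \<open>Ascent of operators\<close>

primrec opow :: "('a::real_normed_vector \<Rightarrow>\<^sub>L 'a) \<Rightarrow> nat \<Rightarrow> 'a \<Rightarrow>\<^sub>L 'a" where
  "opow A 0 = id_blinfun"
| "opow A (Suc n) = A o\<^sub>L opow A n"

lemma opow_apply: "blinfun_apply (opow A n) = (blinfun_apply A ^^ n)"
  by (induction n) (auto simp: fun_eq_iff)

lemma opow_add_apply: "opow A (m + n) x = opow A m (opow A n x)"
  by (simp add: opow_apply funpow_add)

lemma opow_commute: "opow A n (A x) = A (opow A n x)"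
  by (simp add: opow_apply funpow_swap1)

lemma fredholm0_opow: "A \<in> fredholm0 \<Longrightarrow> opow A n \<in> fredholm0"
  by (induction n) (auto simp: GL_fredholm0 GL_id fredholm0_compose)

lemma fredholm0_kernel:
  assumes "A \<in> fredholm0"
  shows "\<exists>B. finite B \<and> {x. A x = 0} \<subseteq> span B"
proof -
  obtain V V' W D where V': "\<And>x. blinfun_apply V' (blinfun_apply V x) = x"
    and D: "finite D" "\<And>x. blinfun_apply W x \<in> span D" and AV: "\<And>x. A x = V (x + W x)"
    using fredholm0_E[OF assms] by metis
  have "x \<in> span D" if "A x = 0" for x
  proof -
    have "x + W x = 0" using that V'[of "x + W x"] by (simp add: AV blinfun.zero_right)
    then have "x = - W x" by (simp add: add_eq_0_iff2)
    then show ?thesis using D(2)[of x] span_neg by metis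
  qed
  then show ?thesis using D(1) by blast
qed

text \<open>Equivalently, the kernels of the powers of A are constant from n on, or the kernel of A
  meets the range of its n-th power only in 0. The second form is the one that the proofs
  use.\<close>

definition finite_ascent :: "('a::real_normed_vector \<Rightarrow>\<^sub>L 'a) \<Rightarrow> bool" where
  "finite_ascent A \<longleftrightarrow> (\<exists>n. \<forall>x. A (opow A n x) = 0 \<longrightarrow> opow A n x = 0)"

lemma GL_finite_ascent: "A \<in> GL \<Longrightarrow> finite_ascent A"
  unfolding finite_ascent_def by (intro exI[of _ 0]) (simp add: GL_eq_0_iff)

text \<open>On the closed range R of the n-th power, A is injective, hence bounded below by bounded
  selection. An eigenvector for - s with s nonzero lies in R, being a multiple of its own image
  under that power, so |s| cannot be small. For small s the shift stays in \<open>fredholm0\<close>,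
  where injectivity suffices.\<close>

lemma finite_ascent_isolated:
  fixes A :: "'a::banach \<Rightarrow>\<^sub>L 'a"
  assumes A: "A \<in> fredholm0" and asc: "finite_ascent A"
  shows "\<exists>e>0. \<forall>s. 0 < \<bar>s\<bar> \<and> \<bar>s\<bar> < e \<longrightarrow> A + s *\<^sub>R id_blinfun \<in> GL"
proof -
  obtain n where n: "\<And>x. A (opow A n x) = 0 \<Longrightarrow> opow A n x = 0" using asc unfolding finite_ascent_def by blast
  let ?R = "range (opow A n)"
  have sR: "subspace ?R"
    by (intro linear_subspace_image subspace_UNIV) (simp add: blinfun.bounded_linear_right bounded_linear.linear)
  have cR: "closed ?R"
    by (rule closed_image[OF subspace_UNIV closed_UNIV fredholm0_semi_est[OF fredholm0_opow[OF A]]])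
  obtain C where C: "C \<ge> 0" "\<And>x. x \<in> ?R \<Longrightarrow> \<exists>z\<in>?R. A z = A x \<and> norm z \<le> C * norm (A x)"
    using bounded_selection[OF sR cR fredholm0_semi_est[OF A]] by blast
  have low: "norm x \<le> C * norm (A x)" if x: "x \<in> ?R" for x
  proof -
    obtain z where z: "z \<in> ?R" "A z = A x" "norm z \<le> C * norm (A x)" using C(2)[OF x] by blast
    have "A (z - x) = 0" using z(2) by (simp add: blinfun.diff_right)
    moreover obtain w where "z - x = opow A n w" using subspace_diff[OF sR z(1) x] by blast
    ultimately have "z - x = 0" using n[of w] by simp
    then show ?thesis using z(3) by simp
  qed
  obtain e1 where e1: "e1 > 0" "\<And>B. dist B A < e1 \<Longrightarrow> B \<in> fredholm0"
    using open_fredholm0 A unfolding open_dist by blast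
  define e where "e = min e1 (1 / (C + 1))"
  have "A + s *\<^sub>R id_blinfun \<in> GL" if s: "0 < \<bar>s\<bar>" "\<bar>s\<bar> < e" for s
  proof (rule fredholm0_injective_GL)
    have "norm (s *\<^sub>R (id_blinfun :: 'a \<Rightarrow>\<^sub>L 'a)) \<le> \<bar>s\<bar> * 1"
      unfolding norm_scaleR by (intro mult_left_mono norm_blinfun_id_le) auto
    then show "A + s *\<^sub>R id_blinfun \<in> fredholm0"
      using s(2) by (intro e1(2)) (simp add: dist_norm e_def)
    fix x assume x: "(A + s *\<^sub>R id_blinfun) x = 0"
    then have Ax: "A x = (- s) *\<^sub>R x" by (simp add: blinfun.bilinear_simps add_eq_0_iff2)
    have "opow A m x = (- s) ^ m *\<^sub>R x" for m
      by (induction m) (simp_all add: Ax blinfun.scaleR_right del: scaleR_minus_left)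
    then have "opow A n ((1 / (- s) ^ n) *\<^sub>R x) = x" using s(1) by (simp add: blinfun.scaleR_right)
    then have "x \<in> ?R" by (metis rangeI)
    then have "norm x \<le> C * (\<bar>s\<bar> * norm x)" using low[of x] Ax by simp
    then have le: "norm x \<le> (C * \<bar>s\<bar>) * norm x" by (simp add: mult.assoc)
    have "C * \<bar>s\<bar> < 1"
    proof -
      have "C * \<bar>s\<bar> \<le> (C + 1) * \<bar>s\<bar>" by (simp add: mult_right_mono)
      also have "\<dots> < 1" using s(2) C(1) by (simp add: e_def field_simps)
      finally show ?thesis .
    qed
    then show "x = 0" using le mult_le_cancel_right1[of "norm x" "C * \<bar>s\<bar>"] by auto
  qed
  moreover have "e > 0" using e1(1) C(1) by (simp add: e_def)
  ultimately show ?thesis by blast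
qed

text \<open>Containment in a finite span is what makes comparing \<open>dim\<close> meaningful,
  since \<open>dim\<close> is 0 on infinite-dimensional spaces.\<close>

lemma subspace_eq_of_dim:
  fixes D E :: "'a::real_vector set"
  assumes D: "subspace D" "D \<subseteq> E" and E: "E \<subseteq> span B" "finite B" and dim: "dim E \<le> dim D"
  shows "D = E"
proof (rule ccontr)
  assume "D \<noteq> E"
  then obtain x where x: "x \<in> E" "x \<notin> D" using D(2) by blast
  obtain C where C: "C \<subseteq> D" "independent C" "D \<subseteq> span C" "card C = dim D" using basis_exists[of D] by metis
  have fC: "finite C" using independent_span_bound[OF E(2) C(2)] C(1) D(2) E(1) by blast
  have "span C \<subseteq> D" by (rule span_minimal[OF C(1) D(1)])
  then have ind: "independent (insert x C)" using x(2) C(2) independent_insertI by blast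
  obtain C' where C': "C' \<subseteq> E" "independent C'" "E \<subseteq> span C'" "card C' = dim E" using basis_exists[of E] by metis
  have "finite C'" using independent_span_bound[OF E(2) C'(2)] C'(1) E(1) by blast
  moreover have "insert x C \<subseteq> span C'" using x(1) C(1) D(2) C'(3) by blast
  ultimately have "card (insert x C) \<le> card C'" using independent_span_bound[OF _ ind] by blast
  moreover have "x \<notin> C" using x(2) C(1) by blast
  ultimately show False using fC C(4) C'(4) dim by simp
qed

text \<open>
  If the kernel meets every range, then \<open>A\<close> maps \<open>M = (\<Inter>n. range (A ^ n))\<close> onto itself with bounded
  selections, so a nonzero kernel vector in \<open>M\<close> is the start of a power series of eigenvectors.
\<close>

lemma infinite_ascent_eigenvectors:
  fixes A :: "'a::banach \<Rightarrow>\<^sub>L 'a"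
  assumes A: "A \<in> fredholm0" and asc: "\<not> finite_ascent A"
  shows "\<exists>e>0. \<forall>s. \<bar>s\<bar> < e \<longrightarrow> (\<exists>x. x \<noteq> 0 \<and> (A + s *\<^sub>R id_blinfun) x = 0)"
proof -
  let ?R = "\<lambda>n. range (opow A n)"
  have lin: "linear (blinfun_apply (opow A n))" for n
    by (simp add: blinfun.bounded_linear_right bounded_linear.linear)
  have sR: "subspace (?R n)" for n by (intro linear_subspace_image[OF lin] subspace_UNIV)
  have cR: "closed (?R n)" for n
    by (rule closed_image[OF subspace_UNIV closed_UNIV fredholm0_semi_est[OF fredholm0_opow[OF A]]])
  have Rdec: "?R n \<subseteq> ?R m" if "m \<le> n" for m n
  proof
    fix y assume "y \<in> ?R n"
    then obtain x where "y = opow A (m + (n - m)) x" using \<open>m \<le> n\<close> by auto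
    then show "y \<in> ?R m" by (metis opow_add_apply rangeI)
  qed
  define D where "D n = {x. A x = 0} \<inter> ?R n" for n
  have sD: "subspace (D n)" for n
    unfolding D_def by (intro subspace_inter sR) (auto simp: subspace_def blinfun.bilinear_simps)
  have Ddec: "D n \<subseteq> D m" if "m \<le> n" for m n using Rdec[OF that] by (auto simp: D_def)
  obtain B where B: "finite B" "{x. A x = 0} \<subseteq> span B" using fredholm0_kernel[OF A] by blast
  \<comment> \<open>The \<open>D n\<close> decrease inside the finite-dimensional kernel of A, so
    they are constant from an index of least dimension on.\<close>
  obtain n0 where n0: "\<And>n. dim (D n0) \<le> dim (D n)"
    using ex_has_least_nat[of "\<lambda>_. True" 0 "\<lambda>n. dim (D n)"] by auto
  have Deq: "D n = D n0" if "n \<ge> n0" for n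
    by (rule subspace_eq_of_dim[OF sD Ddec[OF that] _ B(1) n0]) (use B(2) in \<open>auto simp: D_def\<close>)
  define M where "M = (\<Inter>n. ?R n)"
  have sM: "subspace M" unfolding M_def by (intro subspace_Inter) (use sR in auto)
  have cM: "closed M" unfolding M_def by (intro closed_INT ballI cR)
  have DM: "D n0 \<subseteq> M"
  proof
    fix x assume x: "x \<in> D n0"
    have "x \<in> ?R n" for n
    proof -
      have "x \<in> D (max n n0)" using Deq[of "max n n0"] x by simp
      then show ?thesis using Rdec[of n "max n n0"] by (auto simp: D_def)
    qed
    then show "x \<in> M" by (simp add: M_def)
  qed
  \<comment> \<open>Preimages of y in different ranges beyond \<open>n0\<close> differ by a kernel
    element of \<open>D n0\<close>, which lies in all ranges. So one preimage found in the range
    with index \<open>n0\<close> lies in every range.\<close>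
  have onto: "\<exists>x\<in>M. A x = y" if y: "y \<in> M" for y
  proof -
    have pre: "\<exists>x\<in>?R n. A x = y" for n
    proof -
      obtain w where "y = opow A (Suc n) w" using y unfolding M_def by blast
      then show ?thesis by (intro bexI[of _ "opow A n w"]) auto
    qed
    obtain x where x: "x \<in> ?R n0" "A x = y" using pre by blast
    have "x \<in> ?R n" for n
    proof -
      obtain x' where x': "x' \<in> ?R (max n n0)" "A x' = y" using pre by blast
      have "x' \<in> ?R n0" using x'(1) Rdec[of n0 "max n n0"] by auto
      then have "x - x' \<in> D n0" using x x' subspace_diff[OF sR] by (simp add: D_def blinfun.diff_right)
      then have "x - x' \<in> ?R n" using DM by (auto simp: M_def)
      moreover have "x' \<in> ?R n" using x'(1) Rdec[of n "max n n0"] by auto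
      ultimately have "(x - x') + x' \<in> ?R n" by (rule subspace_add[OF sR])
      then show ?thesis by simp
    qed
    then show ?thesis using x(2) by (auto simp: M_def)
  qed
  obtain C0 where C0: "C0 \<ge> 0" "\<And>x. x \<in> M \<Longrightarrow> \<exists>z\<in>M. A z = A x \<and> norm z \<le> C0 * norm (A x)"
    using bounded_selection[OF sM cM fredholm0_semi_est[OF A]] by blast
  have "\<exists>z. z \<in> M \<and> A z = y \<and> norm z \<le> C0 * norm y" if "y \<in> M" for y
    using onto[OF that] C0(2) by metis
  then obtain g where g: "\<And>y. y \<in> M \<Longrightarrow> g y \<in> M \<and> A (g y) = y \<and> norm (g y) \<le> C0 * norm y" by metis
  obtain v0 where v0: "v0 \<in> D n0" "v0 \<noteq> 0"
    using asc unfolding finite_ascent_def D_def by blast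
  define v where "v k = (g ^^ k) v0" for k
  have v_0: "v 0 = v0" and v_Suc: "v (Suc k) = g (v k)" for k by (simp_all add: v_def)
  have vM: "v k \<in> M" for k
  proof (induction k)
    case 0 then show ?case using v0 DM by (auto simp: v_0)
  next
    case (Suc k) then show ?case using g by (simp add: v_Suc)
  qed
  have Av: "A (v (Suc k)) = v k" for k using g[OF vM] by (simp add: v_Suc)
  have Av0: "A (v 0) = 0" using v0(1) by (simp add: v_0 D_def)
  have nv: "norm (v k) \<le> C0 ^ k * norm v0" for k
  proof (induction k)
    case (Suc k)
    have "norm (v (Suc k)) \<le> C0 * norm (v k)" using g[OF vM] by (simp add: v_Suc)
    also have "\<dots> \<le> C0 * (C0 ^ k * norm v0)" by (rule mult_left_mono[OF Suc C0(1)])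
    finally show ?case by (simp add: mult.assoc)
  qed (simp add: v_0)
  \<comment> \<open>Chosen so that q = |s| C0 is at most 1/3. The terms after the first then sum to
    at most 1/(1 - 1/3) - 1 = 1/2 of norm v0, and the series cannot vanish.\<close>
  define e where "e = 1 / (3 * (C0 + 1))"
  have "\<exists>x. x \<noteq> 0 \<and> (A + s *\<^sub>R id_blinfun) x = 0" if s: "\<bar>s\<bar> < e" for s
  proof -
    define q where "q = \<bar>s\<bar> * C0"
    have q0: "q \<ge> 0" using C0(1) by (simp add: q_def)
    have q: "q \<le> 1/3"
    proof -
      have "q \<le> \<bar>s\<bar> * (C0 + 1)" by (simp add: q_def mult_left_mono)
      also have "\<dots> \<le> e * (C0 + 1)" using s C0(1) by (intro mult_right_mono) auto
      also have "\<dots> = 1/3" using C0(1) by (simp add: e_def)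
      finally show ?thesis .
    qed
    \<comment> \<open>A maps each term to - s times the previous one and kills the first, so the sum
      of the series is an eigenvector of A for - s.\<close>
    define a where "a k = (- s) ^ k *\<^sub>R v k" for k
    have na: "norm (a k) \<le> q ^ k * norm v0" for k
    proof -
      have "norm (a k) = \<bar>s\<bar> ^ k * norm (v k)" by (simp add: a_def power_abs)
      also have "\<dots> \<le> \<bar>s\<bar> ^ k * (C0 ^ k * norm v0)" by (intro mult_left_mono nv) auto
      finally show ?thesis by (simp add: q_def power_mult_distrib mult.assoc)
    qed
    have geo: "(\<lambda>k. q ^ k * norm v0) sums (1 / (1 - q) * norm v0)"
      by (intro sums_mult2 geometric_sums) (use q q0 in auto)
    have sa: "summable (\<lambda>k. norm (a k))"
      by (rule summable_comparison_test[OF _ sums_summable[OF geo]]) (use na in auto)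
    then have sma: "summable a" by (rule summable_norm_cancel)
    define x where "x = suminf a"
    have xs: "a sums x" unfolding x_def using sma by (rule summable_sums)
    have tail: "(\<lambda>k. a (Suc k)) sums (x - v0)"
      using xs sums_Suc_iff[of a "x - v0"] by (simp add: a_def v_0)
    have "norm (x - v0) \<le> 1/2 * norm v0"
    proof -
      have "(\<lambda>k. q ^ Suc k * norm v0) sums (1 / (1 - q) * norm v0 - norm v0)"
        using geo sums_Suc_iff[of "\<lambda>k. q ^ k * norm v0" "1 / (1 - q) * norm v0 - norm v0"] by simp
      moreover have sn: "summable (\<lambda>k. norm (a (Suc k)))" using sa summable_Suc_iff[of "\<lambda>k. norm (a k)"] by simp
      ultimately have "(\<Sum>k. norm (a (Suc k))) \<le> 1 / (1 - q) * norm v0 - norm v0"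
        using suminf_le[OF na[of "Suc _"] sn] by (simp add: sums_iff)
      moreover have "norm (x - v0) \<le> (\<Sum>k. norm (a (Suc k)))"
        using summable_norm[OF sn] tail by (simp add: sums_iff)
      moreover have "1 / (1 - q) * norm v0 - norm v0 \<le> 1/2 * norm v0"
      proof -
        have "1 / (1 - q) \<le> 3/2" using q by (simp add: field_simps)
        then have "1 / (1 - q) * norm v0 \<le> 3/2 * norm v0" by (rule mult_right_mono) simp
        then show ?thesis by simp
      qed
      ultimately show ?thesis by linarith
    qed
    then have "x \<noteq> 0" using v0(2) by auto
    moreover have "(A + s *\<^sub>R id_blinfun) x = 0"
    proof -
      have "(\<lambda>k. A (a k)) sums A x" by (rule bounded_linear.sums[OF blinfun.bounded_linear_right xs])
      moreover have "A (a 0) = 0" using Av0 by (simp add: a_def)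
      ultimately have "(\<lambda>k. A (a (Suc k))) sums A x"
        using sums_Suc_iff[of "\<lambda>k. A (a k)" "A x"] by simp
      moreover have "A (a (Suc k)) = (- s) *\<^sub>R a k" for k
        by (simp add: a_def blinfun.scaleR_right blinfun.minus_right Av)
      ultimately have "(\<lambda>k. (- s) *\<^sub>R a k) sums A x" by simp
      moreover have "(\<lambda>k. (- s) *\<^sub>R a k) sums ((- s) *\<^sub>R x)" by (rule sums_scaleR_right[OF xs])
      ultimately have "A x = (- s) *\<^sub>R x" using sums_unique2 by blast
      then show ?thesis by (simp add: blinfun.bilinear_simps)
    qed
    ultimately show ?thesis by blast
  qed
  moreover have "e > 0" using C0(1) by (simp add: e_def)
  ultimately show ?thesis by blast
qed

section \<open>Spectral projections\<close>

definition gen_kernel :: "('a::real_normed_vector \<Rightarrow>\<^sub>L 'a) \<Rightarrow> 'a set" where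
  "gen_kernel A = {x. \<exists>n. opow A n x = 0}"

text \<open>For a new vector v, only the part w = v - P v is missing. A functional with f w = 1,
  applied to x - P x, supplies the missing multiple of w and vanishes on the vectors already
  fixed.\<close>

lemma projection_onto_finite_span:
  fixes B :: "'a::real_normed_vector set"
  assumes "finite B"
  shows "\<exists>P\<in>finite_rank. (\<forall>x. P x \<in> span B) \<and> (\<forall>x\<in>B. P x = x)"
  using assms
proof (induction B rule: finite_induct)
  case empty
  then show ?case by (intro bexI[of _ 0]) (auto simp: finite_rank_zero blinfun.zero_left)
next
  case (insert v B)
  then obtain P where P: "P \<in> finite_rank" "\<And>x. P x \<in> span B" "\<And>x. x \<in> B \<Longrightarrow> P x = x" by blast
  have mono: "span B \<subseteq> span (insert v B)" by (rule span_mono) auto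
  show ?case
  proof (cases "P v = v")
    case True
    then show ?thesis using P mono by (intro bexI[of _ P]) auto
  next
    case False
    define w where "w = v - P v"
    have "w \<noteq> 0" using False by (simp add: w_def)
    then obtain f :: "'a \<Rightarrow>\<^sub>L real" where f: "f w = 1" using functional_eq_1 by blast
    define P' where "P' = P + (rank_one w f o\<^sub>L (id_blinfun - P))"
    have P'x: "P' x = P x + f (x - P x) *\<^sub>R w" for x
      by (simp add: P'_def blinfun.bilinear_simps scaleR_diff_left)
    have w: "w \<in> span (insert v B)"
      unfolding w_def using P(2)[of v] mono by (intro span_diff) (auto intro: span_base)
    show ?thesis
    proof (intro bexI[of _ P'] conjI allI ballI)
      show "P' x \<in> span (insert v B)" for x
        unfolding P'x using P(2)[of x] mono w by (intro span_add span_scale) auto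
      show "P' x = x" if "x \<in> insert v B" for x
      proof (cases "x = v")
        case True
        then show ?thesis using f by (simp add: P'x flip: w_def) (simp add: w_def)
      next
        case False
        then show ?thesis using that P(3) by (simp add: P'x blinfun.zero_right)
      qed
      show "P' \<in> finite_rank"
        unfolding P'_def by (intro finite_rank_add P(1) finite_rank_compose_right rank_one_finite_rank)
    qed
  qed
qed

text \<open>Let B be the power of A at which the kernels stabilize, and P0 any finite-rank
  projection onto its kernel. Then W = B + P0 is injective, hence invertible, and P0 composed with
  the inverse of W fixes the kernel of B and kills its range. Every x is B z + P0 z for the
  W-preimage z, so this is the projection along the range; both pieces are A-invariant, hence it
  commutes with A.\<close>

lemma spectral_projection:
  fixes A :: "'a::banach \<Rightarrow>\<^sub>L 'a"
  assumes A: "A \<in> fredholm0" and asc: "finite_ascent A"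
  shows "\<exists>P\<in>finite_rank. (\<forall>x. P x \<in> gen_kernel A) \<and> (\<forall>x\<in>gen_kernel A. P x = x) \<and> (\<forall>x. P (A x) = A (P x))"
proof -
  obtain n where n: "\<And>x. A (opow A n x) = 0 \<Longrightarrow> opow A n x = 0" using asc unfolding finite_ascent_def by blast
  define B where "B = opow A n"
  have step: "opow A n x = 0" if "opow A (m + n) x = 0" for m x
    using that
  proof (induction m)
    case (Suc m)
    have "A (opow A n (opow A m x)) = 0" using Suc.prems by (simp add: opow_add_apply[symmetric] add.commute)
    then have "opow A n (opow A m x) = 0" by (rule n)
    then show ?case using Suc.IH by (simp add: opow_add_apply[symmetric] add.commute)
  qed simp
  have N: "gen_kernel A = {x. B x = 0}"
  proof (intro subset_antisym subsetI)
    fix x assume "x \<in> gen_kernel A"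
    then obtain m where "opow A m x = 0" unfolding gen_kernel_def by blast
    then have "opow A (n + m) x = 0" by (simp add: opow_add_apply blinfun.zero_right)
    then show "x \<in> {x. B x = 0}" using step[of m x] by (simp add: B_def add.commute)
  qed (auto simp: gen_kernel_def B_def)
  have BB: "B x = 0" if "B (B x) = 0" for x
    using step[of n x] that by (simp add: B_def opow_add_apply)
  have BF: "B \<in> fredholm0" unfolding B_def by (rule fredholm0_opow[OF A])
  have sN: "subspace {x. B x = 0}" by (auto simp: subspace_def blinfun.bilinear_simps)
  obtain C where C: "C \<subseteq> {x. B x = 0}" "independent C" "{x. B x = 0} \<subseteq> span C"
    using basis_exists[of "{x. B x = 0}"] by metis
  obtain D where "finite D" "{x. B x = 0} \<subseteq> span D" using fredholm0_kernel[OF BF] by blast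
  then have fC: "finite C" using independent_span_bound[OF _ C(2), of D] C(1) by blast
  obtain P0 where P0: "P0 \<in> finite_rank" "\<And>x. P0 x \<in> span C" "\<And>x. x \<in> C \<Longrightarrow> P0 x = x"
    using projection_onto_finite_span[OF fC] by blast
  have BP0: "B (P0 x) = 0" for x using P0(2)[of x] span_minimal[OF C(1) sN] by auto
  have P0id: "P0 x = x" if "B x = 0" for x
  proof -
    have "span C \<subseteq> {x. P0 x = x}"
      by (rule span_minimal) (use P0(3) in \<open>auto simp: subspace_def blinfun.bilinear_simps\<close>)
    then show ?thesis using C(3) that by auto
  qed
  define W where "W = B + P0"
  have Wx: "W x = B x + P0 x" for x by (simp add: W_def blinfun.add_left)
  have "W \<in> GL"
  proof (rule fredholm0_injective_GL)
    show "W \<in> fredholm0" unfolding W_def by (rule fredholm0_add_finite_rank[OF BF P0(1)])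
    fix x assume "W x = 0"
    then have Bx: "B x = - P0 x" by (simp add: Wx add_eq_0_iff2)
    then have "B (B x) = 0" by (simp add: blinfun.minus_right BP0)
    then have B0: "B x = 0" by (rule BB)
    then show "x = 0" using Bx P0id[OF B0] by simp
  qed
  then obtain W' where W': "\<And>x. blinfun_apply W' (W x) = x" "\<And>x. W (W' x) = x" using GL_E by metis
  define P where "P = P0 o\<^sub>L W'"
  have Pid: "P x = x" if "B x = 0" for x
  proof -
    have "W x = x" using that by (simp add: Wx P0id)
    then have "W' x = x" using W'(1)[of x] by simp
    then show ?thesis by (simp add: P_def P0id that)
  qed
  have PB: "P (B x) = 0" for x
  proof -
    have "W (x - P0 x) = B x" by (simp add: Wx blinfun.diff_right BP0 P0id)
    then have "W' (B x) = x - P0 x" using W'(1)[of "x - P0 x"] by simp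
    then show ?thesis by (simp add: P_def blinfun.diff_right P0id BP0)
  qed
  have AB: "A (B x) = B (A x)" for x by (simp add: B_def opow_commute)
  have comm: "P (A x) = A (P x)" for x
  proof -
    let ?z = "W' x"
    have x: "x = B ?z + P0 ?z" using W'(2)[of x] by (simp add: Wx)
    have "B (A (P0 ?z)) = 0" by (simp add: AB[symmetric] BP0 blinfun.zero_right)
    then have "P (A x) = A (P0 ?z)"
      by (subst x) (simp add: blinfun.add_right AB PB Pid)
    then show ?thesis by (simp add: P_def)
  qed
  show ?thesis
    unfolding N using Pid comm BP0
    by (intro bexI[of _ P]) (auto simp: P_def finite_rank_compose_right P0(1))
qed

lemma gen_kernel_subspace: "subspace (gen_kernel A)"
proof (rule subspaceI)
  show "0 \<in> gen_kernel A" by (auto simp: gen_kernel_def blinfun.zero_right)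
next
  fix x y assume "x \<in> gen_kernel A" "y \<in> gen_kernel A"
  then obtain m n where "opow A m x = 0" "opow A n y = 0" by (auto simp: gen_kernel_def)
  then have "opow A (n + m) x = 0" "opow A (m + n) y = 0" by (simp_all add: opow_add_apply blinfun.zero_right)
  then have "opow A (m + n) (x + y) = 0" by (simp add: blinfun.add_right add.commute)
  then show "x + y \<in> gen_kernel A" unfolding gen_kernel_def by blast
next
  fix c x assume "x \<in> gen_kernel A"
  then show "c *\<^sub>R x \<in> gen_kernel A" by (auto simp: gen_kernel_def blinfun.scaleR_right)
qed

lemma gen_kernel_eigenvector_zero:
  assumes x: "x \<in> gen_kernel A" and Ax: "A x = r *\<^sub>R x" and r: "r \<noteq> 0"
  shows "x = 0"
proof -
  obtain n where "opow A n x = 0" using x by (auto simp: gen_kernel_def)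
  moreover have "opow A n x = r ^ n *\<^sub>R x"
    by (induction n) (simp_all add: Ax blinfun.scaleR_right)
  ultimately show ?thesis using r by simp
qed

context type_R_space
begin

section \<open>Finiteness of the nonpositive spectrum\<close>

lemma shift_fredholm0: "pi_X T > 0 \<Longrightarrow> t \<ge> 0 \<Longrightarrow> T + t *\<^sub>R id_blinfun \<in> fredholm0"
  for T :: "'a \<Rightarrow>\<^sub>L 'a"
  by (rule pi_X_fredholm0) (simp add: pi_X_shift)

text \<open>Finite ascent of T + t is locally constant in t \<ge> 0. Near a point of finite ascent
  the shifts are invertible; near a point of infinite ascent none is invertible, which excludes
  finite ascent there because that would produce invertible neighbours. It holds for t = norm T + 1,
  and the half-line is connected.\<close>

lemma shift_finite_ascent:
  fixes T :: "'a \<Rightarrow>\<^sub>L 'a"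
  assumes T: "pi_X T > 0" and t: "t \<ge> 0"
  shows "finite_ascent (T + t *\<^sub>R id_blinfun)"
proof -
  have shift: "T + u *\<^sub>R id_blinfun = (T + t *\<^sub>R id_blinfun) + (u - t) *\<^sub>R id_blinfun" for u t
    by (simp add: algebra_simps)
  show ?thesis
  proof (rule connected_induction_simple[of "{0..}" "norm T + 1" t "\<lambda>t. finite_ascent (T + t *\<^sub>R id_blinfun)"])
    show "finite_ascent (T + (norm T + 1) *\<^sub>R id_blinfun)"
      by (intro GL_finite_ascent GL_large_shift) auto
    fix t :: real assume t: "t \<in> {0..}"
    then have t0: "t \<ge> 0" by simp
    have "\<exists>e>0. (\<forall>u\<in>ball t e \<inter> {0..}. finite_ascent (T + u *\<^sub>R id_blinfun)) \<or>
        (\<forall>u\<in>ball t e \<inter> {0..}. \<not> finite_ascent (T + u *\<^sub>R id_blinfun))"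
    proof (cases "finite_ascent (T + t *\<^sub>R id_blinfun)")
      case True
      then obtain e where e: "e > 0" "\<And>s. 0 < \<bar>s\<bar> \<Longrightarrow> \<bar>s\<bar> < e \<Longrightarrow> T + t *\<^sub>R id_blinfun + s *\<^sub>R id_blinfun \<in> GL"
        using finite_ascent_isolated[OF shift_fredholm0[OF T t0] True] by blast
      have "finite_ascent (T + u *\<^sub>R id_blinfun)" if u: "u \<in> ball t e" for u
      proof (cases "u = t")
        case False
        then show ?thesis
          using e(2)[of "u - t"] u by (intro GL_finite_ascent) (simp add: shift[of u t] dist_real_def abs_minus_commute)
      qed (use True in simp)
      then show ?thesis using e(1) by blast
    next
      case False
      then obtain e where e: "e > 0"
        "\<And>s. \<bar>s\<bar> < e \<Longrightarrow> \<exists>x. x \<noteq> 0 \<and> (T + t *\<^sub>R id_blinfun + s *\<^sub>R id_blinfun) x = 0"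
        using infinite_ascent_eigenvectors[OF shift_fredholm0[OF T t0] False] by blast
      have nGL: "T + u *\<^sub>R id_blinfun \<notin> GL" if u: "u \<in> ball t e" for u
      proof -
        obtain x where "x \<noteq> 0" "(T + u *\<^sub>R id_blinfun) x = 0"
          using e(2)[of "u - t"] u shift[of u t] by (auto simp: dist_real_def abs_minus_commute)
        then show ?thesis using GL_eq_0_iff by blast
      qed
      have "\<not> finite_ascent (T + u *\<^sub>R id_blinfun)" if u: "u \<in> ball t e \<inter> {0..}" for u
      proof
        assume fa: "finite_ascent (T + u *\<^sub>R id_blinfun)"
        obtain d where d: "d > 0" "\<And>s. 0 < \<bar>s\<bar> \<Longrightarrow> \<bar>s\<bar> < d \<Longrightarrow> T + u *\<^sub>R id_blinfun + s *\<^sub>R id_blinfun \<in> GL"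
          using finite_ascent_isolated[OF shift_fredholm0[OF T] fa] u by (metis IntE atLeast_iff)
        \<comment> \<open>Small enough for u + s to remain in the ball around t without invertible
          shifts, and to be one of the invertible shifts near u.\<close>
        define s where "s = min d (e - dist t u) / 2"
        have s: "0 < s" "s < d" "s < e - dist t u" using d(1) u by (auto simp: s_def min_def)
        have "u + s \<in> ball t e" using s u dist_triangle[of t "u + s" u] by (simp add: dist_real_def)
        then show False using nGL[of "u + s"] d(2)[of s] s by (simp add: algebra_simps)
      qed
      then show ?thesis using e(1) by blast
    qed
    then obtain e where "e > 0" "(\<forall>u\<in>ball t e \<inter> {0..}. finite_ascent (T + u *\<^sub>R id_blinfun)) \<or>
        (\<forall>u\<in>ball t e \<inter> {0..}. \<not> finite_ascent (T + u *\<^sub>R id_blinfun))" by blast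
    then show "\<exists>U. openin (top_of_set {0..}) U \<and> t \<in> U \<and> (\<forall>x\<in>U. \<forall>y\<in>U.
        finite_ascent (T + x *\<^sub>R id_blinfun) \<longrightarrow> finite_ascent (T + y *\<^sub>R id_blinfun))"
      using t by (intro exI[of _ "ball t e \<inter> {0..}"]) (auto simp: openin_open)
  qed (use t in auto)
qed

text \<open>Records the nonpositive real spectral points with reversed sign: t stands for the
  spectral point - t.\<close>

definition sing_shifts :: "('a \<Rightarrow>\<^sub>L 'a) \<Rightarrow> real set" where
  "sing_shifts T = {t. t \<ge> 0 \<and> T + t *\<^sub>R id_blinfun \<notin> GL}"

lemma finite_sing_shifts:
  assumes T: "pi_X T > 0"
  shows "finite (sing_shifts T)"
proof -
  have "finite ({0..norm T} \<inter> sing_shifts T)"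
  proof (rule finite_not_islimpt_in_compact)
    fix t assume "t \<in> {0..norm T}"
    then have t: "t \<ge> 0" by simp
    obtain e where e: "e > 0" "\<And>s. 0 < \<bar>s\<bar> \<Longrightarrow> \<bar>s\<bar> < e \<Longrightarrow> T + t *\<^sub>R id_blinfun + s *\<^sub>R id_blinfun \<in> GL"
      using finite_ascent_isolated[OF shift_fredholm0[OF T t] shift_finite_ascent[OF T t]] by blast
    have "u \<notin> sing_shifts T" if "u \<noteq> t" "dist u t < e" for u
      using e(2)[of "u - t"] that by (simp add: sing_shifts_def dist_real_def algebra_simps)
    then show "\<not> t islimpt sing_shifts T" using e(1) unfolding islimpt_approachable by blast
  qed simp
  moreover have "sing_shifts T \<subseteq> {0..norm T}"
    using GL_large_shift[of T] by (force simp: sing_shifts_def)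
  ultimately show ?thesis by (simp add: inf_absorb2)
qed

end

section \<open>Products of rank-one reflections\<close>

definition reflection :: "'a::real_normed_vector \<Rightarrow> ('a \<Rightarrow>\<^sub>L real) \<Rightarrow> 'a \<Rightarrow>\<^sub>L 'a" where
  "reflection v f = id_blinfun - 2 *\<^sub>R rank_one v f"

lemma reflection_apply [simp]: "reflection v f x = x - (2 * f x) *\<^sub>R v"
  by (simp add: reflection_def blinfun.bilinear_simps)

lemma reflection_involution: "blinfun_apply f v = 1 \<Longrightarrow> reflection v f o\<^sub>L reflection v f = id_blinfun"
  by (rule blinfun_eqI) (simp add: blinfun.bilinear_simps algebra_simps scaleR_2)

lemma reflection_GL: "blinfun_apply f v = 1 \<Longrightarrow> reflection v f \<in> GL"
  unfolding GL_def using reflection_involution by blast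

primrec reflection_product :: "('a::real_normed_vector \<times> ('a \<Rightarrow>\<^sub>L real)) list \<Rightarrow> 'a \<Rightarrow>\<^sub>L 'a" where
  "reflection_product [] = id_blinfun"
| "reflection_product (p # ps) = reflection (fst p) (snd p) o\<^sub>L reflection_product ps"

definition normalized :: "('a::real_normed_vector \<times> ('a \<Rightarrow>\<^sub>L real)) list \<Rightarrow> bool" where
  "normalized ps \<longleftrightarrow> (\<forall>p\<in>set ps. blinfun_apply (snd p) (fst p) = 1)"

lemma reflection_product_append: "reflection_product (ps @ qs) = reflection_product ps o\<^sub>L reflection_product qs"
  by (induction ps) (auto intro!: blinfun_eqI)

lemma reflection_product_GL: "normalized ps \<Longrightarrow> reflection_product ps \<in> GL"
  by (induction ps) (auto simp: normalized_def GL_id intro!: GL_compose reflection_GL)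

lemma reflection_product_rev:
  assumes "normalized ps"
  shows "reflection_product ps o\<^sub>L reflection_product (rev ps) = id_blinfun"
  using assms
proof (induction ps)
  case Nil then show ?case by (auto intro!: blinfun_eqI)
next
  case (Cons p ps)
  have "reflection_product ps o\<^sub>L reflection_product (rev ps) = id_blinfun"
    using Cons by (simp add: normalized_def)
  then have IH: "reflection_product ps (reflection_product (rev ps) x) = x" for x
    by (metis blinfun_apply_blinfun_compose blinfun_apply_id_blinfun)
  have "reflection (fst p) (snd p) o\<^sub>L reflection (fst p) (snd p) = id_blinfun"
    using Cons.prems by (intro reflection_involution) (simp add: normalized_def)
  then have R: "reflection (fst p) (snd p) (reflection (fst p) (snd p) x) = x" for x
    by (metis blinfun_apply_blinfun_compose blinfun_apply_id_blinfun)
  show ?case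
    by (rule blinfun_eqI) (simp add: reflection_product_append IH R del: reflection_apply)
qed

lemma reflection_product_fixes:
  "(\<And>p. p \<in> set ps \<Longrightarrow> blinfun_apply (snd p) x = 0) \<Longrightarrow> reflection_product ps x = x"
  by (induction ps) auto

lemma dim_zero_subspace: "dim {0 :: 'a::real_vector} = 0"
  using dim_eq_card[of "{}" "{0 :: 'a}"] independent_empty by simp

text \<open>Induction on the rank. For v in the range with f v = 1 and g = f o P, the operator Q = P
  - g(.) v is a projection of rank one less with g o Q = 0. Hence 1 - 2 P is the reflection of v and
  g composed with 1 - 2 Q.\<close>

lemma reflection_of_projection:
  fixes P :: "'a::real_normed_vector \<Rightarrow>\<^sub>L 'a"
  assumes "P \<in> finite_rank" "\<And>x. P (P x) = P x"
  shows "\<exists>ps. normalized ps \<and> length ps = dim (range P) \<and> id_blinfun - 2 *\<^sub>R P = reflection_product ps"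
  using assms
proof (induction "dim (range P)" arbitrary: P)
  case 0
  obtain B where B: "finite B" "\<And>x. P x \<in> span B" using finite_rank_range[OF 0(2)] by blast
  have "{0} = range P"
    by (rule subspace_eq_of_dim[OF _ _ _ B(1)])
      (use B(2) 0(1) in \<open>auto simp: dim_zero_subspace subspace_def intro!: image_eqI[of _ _ 0] simp: blinfun.zero_right\<close>)
  then have "P x = 0" for x by blast
  then have "P = 0" by (intro blinfun_eqI) (simp add: blinfun.zero_left)
  then show ?case using 0(1) by (intro exI[of _ "[]"]) (simp add: normalized_def)
next
  case (Suc k)
  have "range P \<noteq> {0}" using Suc.hyps(2) by (auto simp: dim_zero_subspace)
  then have "\<exists>v\<in>range P. v \<noteq> 0" using blinfun.zero_right[of P] by auto
  then obtain v where v: "v \<in> range P" "v \<noteq> 0" by blast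
  have Pv: "P v = v" using v(1) Suc.prems(2) by auto
  obtain f :: "'a \<Rightarrow>\<^sub>L real" where f: "f v = 1" using functional_eq_1[OF v(2)] by blast
  define g where "g = f o\<^sub>L P"
  define Q where "Q = P - rank_one v g"
  have Qx: "Q x = P x - f (P x) *\<^sub>R v" for x by (simp add: Q_def g_def blinfun.bilinear_simps)
  have PQ: "P (Q x) = Q x" for x
    by (simp add: Qx blinfun.bilinear_simps Suc.prems(2) Pv)
  have fQ: "f (Q x) = 0" for x by (simp add: Qx blinfun.bilinear_simps f)
  have QF: "Q \<in> finite_rank"
    unfolding Q_def by (intro finite_rank_diff Suc.prems(1) rank_one_finite_rank)
  have QQ: "Q (Q x) = Q x" for x by (subst Qx) (simp add: PQ fQ)
  have dimP: "dim (range P) = Suc (dim (range Q))"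
  proof -
    obtain B where B: "finite B" "\<And>x. Q x \<in> span B" using finite_rank_range[OF QF] by blast
    obtain C where C: "C \<subseteq> range Q" "independent C" "range Q \<subseteq> span C" "card C = dim (range Q)"
      using basis_exists[of "range Q"] by metis
    have fC: "finite C" using independent_span_bound[OF B(1) C(2)] C(1) B(2) by blast
    have "subspace {x. f x = 0}" by (auto simp: subspace_def blinfun.bilinear_simps)
    then have "span C \<subseteq> {x. f x = 0}" using C(1) fQ by (intro span_minimal) auto
    then have vC: "v \<notin> span C" using f by auto
    show ?thesis
    proof (rule dim_unique[of "insert v C"])
      show "insert v C \<subseteq> range P" 
      proof -
        have "y \<in> range P" if y: "y \<in> range Q" for y
        proof -
          obtain x where "y = Q x" using y by blast
          then have "y = P (Q x)" by (simp add: PQ)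
          then show ?thesis by (rule image_eqI) simp
        qed
        then show ?thesis using v(1) C(1) by blast
      qed
      show "range P \<subseteq> span (insert v C)"
      proof
        fix y assume "y \<in> range P"
        then obtain x where x: "y = P x" by blast
        have "y = Q x + f (P x) *\<^sub>R v" by (simp add: x Qx)
        moreover have "Q x \<in> span (insert v C)" using C(3) span_mono[of C "insert v C"] by auto
        ultimately show "y \<in> span (insert v C)" by (simp add: span_add span_scale span_base)
      qed
      show "independent (insert v C)" by (rule independent_insertI[OF vC C(2)])
      show "card (insert v C) = Suc (dim (range Q))"
        using fC vC span_base[of v C] C(4) by (auto simp: card_insert_if)
    qed
  qed
  then have "k = dim (range Q)" using Suc.hyps(2) by simp
  then obtain ps where ps: "normalized ps" "length ps = dim (range Q)" "id_blinfun - 2 *\<^sub>R Q = reflection_product ps"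
    using Suc.hyps(1)[OF _ QF QQ] by blast
  have gQ: "g (Q x) = 0" for x by (simp add: g_def PQ fQ)
  have "id_blinfun - 2 *\<^sub>R P = reflection v g o\<^sub>L (id_blinfun - 2 *\<^sub>R Q)"
  proof (rule blinfun_eqI)
    fix x
    have "reflection v g (x - 2 *\<^sub>R Q x) = x - 2 *\<^sub>R Q x - (2 * g x) *\<^sub>R v"
      by (simp add: blinfun.diff_right blinfun.scaleR_right gQ)
    also have "\<dots> = x - 2 *\<^sub>R P x" by (simp add: Qx g_def scaleR_diff_right)
    finally show "(id_blinfun - 2 *\<^sub>R P) x = (reflection v g o\<^sub>L (id_blinfun - 2 *\<^sub>R Q)) x"
      by (simp add: blinfun.diff_left blinfun.scaleR_left)
  qed
  then show ?case
    using ps dimP f by (intro exI[of _ "(v, g) # ps"]) (simp add: normalized_def g_def Pv)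
qed

section \<open>Splitting off the nonpositive spectrum\<close>

text \<open>Invertible operators without spectrum on the negative half-axis; t = 0 gives the
  invertibility of T itself.\<close>

definition GL0 :: "('a::real_normed_vector \<Rightarrow>\<^sub>L 'a) set" where
  "GL0 = {T. \<forall>t\<ge>0. T + t *\<^sub>R id_blinfun \<in> GL}"

lemma gen_kernel_injective:
  fixes S :: "'a::real_normed_vector \<Rightarrow>\<^sub>L 'a"
  assumes "\<And>z. z \<in> N \<Longrightarrow> S z \<in> N" "\<And>z. z \<in> N \<Longrightarrow> S z = 0 \<Longrightarrow> z = 0"
    and y: "y \<in> N" "y \<in> gen_kernel S"
  shows "y = 0"
proof -
  obtain n where n: "opow S n y = 0" using y(2) by (auto simp: gen_kernel_def)
  have inv: "opow S n y \<in> N" for n by (induction n) (use assms(1) y(1) in auto)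
  have "opow S n y = 0 \<Longrightarrow> y = 0" for n by (induction n) (use inv assms(2) in auto)
  then show ?thesis using n by blast
qed

lemma gen_kernel_cong:
  fixes P S S' :: "'a::real_normed_vector \<Rightarrow>\<^sub>L 'a"
  assumes "\<And>z. P z = 0 \<Longrightarrow> S z = S' z" "\<And>z. P z = 0 \<Longrightarrow> P (S z) = 0" and "P x = 0"
  shows "x \<in> gen_kernel S \<longleftrightarrow> x \<in> gen_kernel S'"
proof -
  have "P (opow S n x) = 0 \<and> opow S n x = opow S' n x" for n
    by (induction n) (use assms in auto)
  then show ?thesis by (simp add: gen_kernel_def)
qed

lemma gen_kernel_commuting:
  fixes P S :: "'a::real_normed_vector \<Rightarrow>\<^sub>L 'a"
  assumes "\<And>x. P (S x) = S (P x)" "x \<in> gen_kernel S"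
  shows "P x \<in> gen_kernel S"
proof -
  have "P (opow S n x) = opow S n (P x)" for n by (induction n) (auto simp: assms(1))
  then have "opow S n x = 0 \<Longrightarrow> opow S n (P x) = 0" for n by (metis blinfun.zero_right)
  then show ?thesis using assms(2) by (auto simp: gen_kernel_def)
qed

lemma kernel_gen_kernel: "blinfun_apply S x = 0 \<Longrightarrow> x \<in> gen_kernel S"
  unfolding gen_kernel_def by (auto intro!: exI[of _ 1])

lemma gen_kernel_zero_iff:
  fixes S :: "'a::real_normed_vector \<Rightarrow>\<^sub>L 'a"
  assumes "\<And>x. S x = 0 \<Longrightarrow> x = 0"
  shows "x \<in> gen_kernel S \<longleftrightarrow> x = 0"
proof
  assume "x \<in> gen_kernel S"
  then show "x = 0" using gen_kernel_injective[of UNIV S x] assms by simp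
qed (simp add: kernel_gen_kernel blinfun.zero_right)

context type_R_space
begin

text \<open>The total multiplicity of the nonpositive spectrum, counted by real dimensions in the
  space itself. It is compared with the complex multiplicities only in
  \<open>eigen_parity_eq\<close>; up to there no complexification is involved.\<close>

definition shift_multiplicity :: "('a \<Rightarrow>\<^sub>L 'a) \<Rightarrow> nat" where
  "shift_multiplicity T = (\<Sum>t\<in>sing_shifts T. dim (gen_kernel (T + t *\<^sub>R id_blinfun)))"

lemma sing_shifts_iff:
  assumes "pi_X T > 0"
  shows "t \<in> sing_shifts T \<longleftrightarrow> t \<ge> 0 \<and> (\<exists>x. x \<noteq> 0 \<and> x \<in> gen_kernel (T + t *\<^sub>R id_blinfun))"
proof (cases "t \<ge> 0")
  case True
  let ?A = "T + t *\<^sub>R id_blinfun"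
  have "?A \<in> GL \<longleftrightarrow> (\<forall>x. ?A x = 0 \<longrightarrow> x = 0)"
    using fredholm0_injective_GL[OF shift_fredholm0[OF assms True]] GL_eq_0_iff by blast
  also have "\<dots> \<longleftrightarrow> (\<forall>x. x \<in> gen_kernel ?A \<longrightarrow> x = 0)"
    using gen_kernel_zero_iff[of ?A] kernel_gen_kernel by blast
  finally show ?thesis using True by (auto simp: sing_shifts_def)
qed (simp add: sing_shifts_def)

text \<open>Reflecting the generalized eigenspace of \<open>-t\<close> moves that eigenvalue to \<open>t\<close> and leaves the others in place.\<close>

lemma remove_shift:
  assumes T: "T \<in> GL" "pi_X T > 0" and t: "t \<in> sing_shifts T"
  shows "\<exists>T1 ps. T1 \<in> GL \<and> pi_X T1 > 0 \<and> normalized ps \<and> T = T1 o\<^sub>L reflection_product ps \<and>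
    sing_shifts T1 = sing_shifts T - {t} \<and> shift_multiplicity T = length ps + shift_multiplicity T1"
proof -
  let ?A = "\<lambda>s. T + s *\<^sub>R id_blinfun"
  have Ax: "?A s x = T x + s *\<^sub>R x" for s x by (simp add: blinfun.bilinear_simps)
  have t0: "t \<ge> 0" using t by (simp add: sing_shifts_def)
  have "t \<noteq> 0" using t T(1) by (auto simp: sing_shifts_def)
  then have tpos: "t > 0" using t0 by simp
  let ?N = "gen_kernel (?A t)"
  obtain P where P: "P \<in> finite_rank" "\<And>x. P x \<in> ?N" "\<And>x. x \<in> ?N \<Longrightarrow> P x = x"
      and PA: "\<And>x. P (?A t x) = ?A t (P x)"
    using spectral_projection[OF shift_fredholm0[OF T(2) t0] shift_finite_ascent[OF T(2) t0]] by blast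
  have PT: "P (T x) = T (P x)" for x using PA[of x] by (simp add: Ax blinfun.bilinear_simps)
  have PP: "P (P x) = P x" for x by (rule P(3)[OF P(2)])
  have rP: "range P = ?N" 
  proof (intro subset_antisym subsetI)
    show "x \<in> range P" if "x \<in> ?N" for x by (rule image_eqI[of _ _ x]) (simp_all add: P(3) that)
  qed (use P(2) in auto)
  define J where "J = id_blinfun - 2 *\<^sub>R P"
  define T1 where "T1 = T o\<^sub>L J"
  have T1x: "T1 x = T x - 2 *\<^sub>R T (P x)" for x by (simp add: T1_def J_def blinfun.bilinear_simps)
  let ?B = "\<lambda>s. T1 + s *\<^sub>R id_blinfun"
  have Bx: "?B s x = T x - 2 *\<^sub>R T (P x) + s *\<^sub>R x" for s x by (simp add: blinfun.bilinear_simps T1x)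
  obtain ps where ps: "normalized ps" "length ps = dim (range P)" "J = reflection_product ps"
    using reflection_of_projection[OF P(1) PP] unfolding J_def by blast
  have piT1: "pi_X T1 > 0"
  proof -
    have "T1 = T + (- 2) *\<^sub>R (T o\<^sub>L P)" by (rule blinfun_eqI) (simp add: T1x blinfun.bilinear_simps)
    then have "pi_X T1 = pi_X T + (- 2) * pi_X (T o\<^sub>L P)" by (simp only: pi_X_add pi_X_scaleR)
    then show ?thesis using T(2) pi_X_finite_rank[OF finite_rank_compose_left[OF P(1)]] by simp
  qed
  have TN: "T z \<in> ?N" if "z \<in> ?N" for z using P(2)[of "T z"] PT[of z] P(3)[OF that] by simp
  have scN: "c *\<^sub>R z \<in> ?N" if "z \<in> ?N" for z c using gen_kernel_subspace that by (rule subspace_scale)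
  have PNA: "P x = 0" if "x \<in> gen_kernel (?A s)" "s \<noteq> t" for x s
  proof (rule gen_kernel_injective[of ?N "?A s"])
    show "?A s z \<in> ?N" if "z \<in> ?N" for z
      unfolding Ax using TN[OF that] scN[OF that] by (intro subspace_add[OF gen_kernel_subspace])
    show "z = 0" if "z \<in> ?N" "?A s z = 0" for z
    proof (rule gen_kernel_eigenvector_zero[OF that(1), of "t - s"])
      have "T z = - (s *\<^sub>R z)" using that(2) by (simp add: Ax add_eq_0_iff2)
      then show "?A t z = (t - s) *\<^sub>R z" by (simp add: Ax algebra_simps)
    qed (use \<open>s \<noteq> t\<close> in simp)
    show "P x \<in> gen_kernel (?A s)"
      by (rule gen_kernel_commuting[OF _ that(1)]) (simp add: Ax blinfun.bilinear_simps PT)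
  qed (rule P(2))
  \<comment> \<open>On \<open>?N\<close> the operator T1 equals - T, whose only eigenvalue there is
    t > 0. So T1 + s is injective on \<open>?N\<close> for every s \<ge> 0, including s = t.\<close>
  have PNB: "P x = 0" if "x \<in> gen_kernel (?B s)" "s \<ge> 0" for x s
  proof (rule gen_kernel_injective[of ?N "?B s"])
    have BN: "?B s z = s *\<^sub>R z - T z" if "z \<in> ?N" for z
      by (simp add: Bx P(3)[OF that] scaleR_2)
    show "?B s z \<in> ?N" if "z \<in> ?N" for z
      unfolding BN[OF that] using TN[OF that] scN[OF that] by (intro subspace_diff[OF gen_kernel_subspace])
    show "z = 0" if "z \<in> ?N" "?B s z = 0" for z
    proof (rule gen_kernel_eigenvector_zero[OF that(1), of "t + s"])
      have "T z = s *\<^sub>R z" using that(2) BN[OF that(1)] by simp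
      then show "?A t z = (t + s) *\<^sub>R z" by (simp add: Ax algebra_simps)
    qed (use \<open>s \<ge> 0\<close> tpos in simp)
    show "P x \<in> gen_kernel (?B s)"
      by (rule gen_kernel_commuting[OF _ that(1)]) (simp add: T1x blinfun.bilinear_simps PT PP)
  qed (rule P(2))
  \<comment> \<open>On the kernel of P, which both operators leave invariant, T and T1
    agree.\<close>
  have AB: "x \<in> gen_kernel (?A s) \<longleftrightarrow> x \<in> gen_kernel (?B s)" if "P x = 0" for x s
    by (rule gen_kernel_cong[of P, OF _ _ that]) (auto simp: T1x blinfun.bilinear_simps PT)
  have eq: "gen_kernel (?A s) = gen_kernel (?B s)" if "s \<ge> 0" "s \<noteq> t" for s
    using PNA[OF _ that(2)] PNB[OF _ that(1)] AB by blast
  have Bt: "x = 0" if "x \<in> gen_kernel (?B t)" for x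
  proof -
    have "P x = 0" by (rule PNB[OF that t0])
    then show ?thesis using AB[of x t] that P(3)[of x] by simp
  qed
  have sing: "sing_shifts T1 = sing_shifts T - {t}"
  proof (intro subset_antisym subsetI)
    fix s assume "s \<in> sing_shifts T1"
    then obtain x where s: "s \<ge> 0" "x \<noteq> 0" "x \<in> gen_kernel (?B s)" using sing_shifts_iff[OF piT1] by blast
    then have "s \<noteq> t" using Bt by blast
    then show "s \<in> sing_shifts T - {t}" using s eq[of s] sing_shifts_iff[OF T(2)] by blast
  next
    fix s assume "s \<in> sing_shifts T - {t}"
    then obtain x where s: "s \<ge> 0" "x \<noteq> 0" "x \<in> gen_kernel (?A s)" "s \<noteq> t" using sing_shifts_iff[OF T(2)] by blast
    then show "s \<in> sing_shifts T1" using eq[of s] sing_shifts_iff[OF piT1] by blast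
  qed
  have "T1 \<in> GL"
  proof -
    have "0 \<notin> sing_shifts T" using T(1) by (simp add: sing_shifts_def)
    then have "0 \<notin> sing_shifts T1" by (simp add: sing)
    then show ?thesis by (simp add: sing_shifts_def)
  qed
  moreover have "T = T1 o\<^sub>L reflection_product ps"
    unfolding ps(3)[symmetric]
    by (rule blinfun_eqI) (simp add: T1_def J_def blinfun.bilinear_simps PP algebra_simps scaleR_2)
  moreover have "shift_multiplicity T = length ps + shift_multiplicity T1"
  proof -
    have "shift_multiplicity T = dim ?N + (\<Sum>s\<in>sing_shifts T - {t}. dim (gen_kernel (?A s)))"
      unfolding shift_multiplicity_def by (rule sum.remove[OF finite_sing_shifts[OF T(2)] t])
    also have "(\<Sum>s\<in>sing_shifts T - {t}. dim (gen_kernel (?A s))) = shift_multiplicity T1"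
      unfolding shift_multiplicity_def sing
      by (rule sum.cong) (use eq in \<open>auto simp: sing_shifts_def\<close>)
    finally show ?thesis using ps(2) rP by simp
  qed
  ultimately show ?thesis using piT1 ps(1) sing by blast
qed

lemma reflection_factorization:
  assumes "T \<in> GL" "pi_X T > 0"
  shows "\<exists>T' ps. T' \<in> GL0 \<and> normalized ps \<and> T = T' o\<^sub>L reflection_product ps \<and> length ps = shift_multiplicity T"
  using assms
proof (induction "card (sing_shifts T)" arbitrary: T)
  case 0
  then have e: "sing_shifts T = {}" using finite_sing_shifts by simp
  then have "T \<in> GL0" by (auto simp: GL0_def sing_shifts_def)
  moreover have "T = T o\<^sub>L reflection_product []" by (rule blinfun_eqI) simp
  moreover have "length [] = shift_multiplicity T" by (simp add: shift_multiplicity_def e)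
  moreover have "normalized []" by (simp add: normalized_def)
  ultimately show ?case by blast
next
  case (Suc k)
  then obtain t where t: "t \<in> sing_shifts T" by (metis card.empty ex_in_conv nat.distinct(1))
  obtain T1 qs where T1: "T1 \<in> GL" "pi_X T1 > 0" "normalized qs" "T = T1 o\<^sub>L reflection_product qs"
    "sing_shifts T1 = sing_shifts T - {t}" "shift_multiplicity T = length qs + shift_multiplicity T1"
    using remove_shift[OF Suc.prems t] by blast
  have "k = card (sing_shifts T1)"
    using Suc.hyps(2) t finite_sing_shifts[OF Suc.prems(2)] by (simp add: T1(5))
  then obtain T' ps where T': "T' \<in> GL0" "normalized ps" "T1 = T' o\<^sub>L reflection_product ps" "length ps = shift_multiplicity T1"
    using Suc.hyps(1)[OF _ T1(1,2)] by blast
  have "T = T' o\<^sub>L reflection_product (ps @ qs)"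
    unfolding T1(4) T'(3) reflection_product_append by (rule blinfun_eqI) simp
  then show ?case
    using T' T1 by (intro exI[of _ T'] exI[of _ "ps @ qs"]) (auto simp: normalized_def)
qed

end

section \<open>The sign of a product of reflections\<close>

text \<open>A biorthogonalization: g is the part of the new functional not expressed by the earlier
  f i. If it is nonzero, it is added together with a vector w at which g is 1 and the earlier
  functionals vanish; the old functionals vanish at w, so their expansions persist.\<close>

lemma biorthogonal_system:
  fixes \<phi>s :: "('a::real_normed_vector \<Rightarrow>\<^sub>L real) list"
  shows "\<exists>n (u :: nat \<Rightarrow> 'a) (f :: nat \<Rightarrow> 'a \<Rightarrow>\<^sub>L real).
    (\<forall>i<n. \<forall>j<n. f i (u j) = (if i = j then 1 else 0)) \<and>
    (\<forall>\<phi>\<in>set \<phi>s. \<forall>x. blinfun_apply \<phi> x = (\<Sum>i<n. blinfun_apply \<phi> (u i) * f i x))"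
proof (induction \<phi>s)
  case Nil
  then show ?case by (intro exI[of _ 0]) auto
next
  case (Cons \<phi> \<phi>s)
  then obtain n and u :: "nat \<Rightarrow> 'a" and f :: "nat \<Rightarrow> 'a \<Rightarrow>\<^sub>L real" where
    uf: "\<And>i j. i < n \<Longrightarrow> j < n \<Longrightarrow> f i (u j) = (if i = j then 1 else 0)"
    and ex: "\<And>\<psi> x. \<psi> \<in> set \<phi>s \<Longrightarrow> blinfun_apply \<psi> x = (\<Sum>i<n. blinfun_apply \<psi> (u i) * f i x)" by blast
  define g where "g = \<phi> - (\<Sum>i<n. \<phi> (u i) *\<^sub>R f i)"
  have gx: "g x = \<phi> x - (\<Sum>i<n. \<phi> (u i) * f i x)" for x
    by (simp add: g_def blinfun.bilinear_simps blinfun.sum_left)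
  show ?case
  proof (cases "\<exists>x. g x \<noteq> 0")
    case False
    then have new: "\<phi> x = (\<Sum>i<n. \<phi> (u i) * f i x)" for x using gx[of x] by simp
    have "blinfun_apply \<psi> x = (\<Sum>i<n. blinfun_apply \<psi> (u i) * f i x)" if \<psi>: "\<psi> \<in> set (\<phi> # \<phi>s)" for \<psi> x
    proof (cases "\<psi> = \<phi>")
      case True
      show ?thesis unfolding True by (rule new)
    next
      case False
      then show ?thesis using \<psi> by (intro ex) simp
    qed
    then show ?thesis using uf by blast
  next
    case True
    then obtain x0 where x0: "g x0 \<noteq> 0" by blast
    define x where "x = (1 / g x0) *\<^sub>R x0"
    have gx1: "g x = 1" using x0 by (simp add: x_def blinfun.scaleR_right)
    define w where "w = x - (\<Sum>i<n. f i x *\<^sub>R u i)"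
    have gu: "g (u j) = 0" if "j < n" for j
    proof -
      have "(\<Sum>i<n. \<phi> (u i) * f i (u j)) = (\<Sum>i<n. if i = j then \<phi> (u j) else 0)"
        by (rule sum.cong) (use uf that in auto)
      then show ?thesis using that by (simp add: gx)
    qed
    have fw: "f i w = 0" if "i < n" for i
    proof -
      have "(\<Sum>j<n. f j x * f i (u j)) = (\<Sum>j<n. if j = i then f i x else 0)"
        by (rule sum.cong) (use uf that in auto)
      then show ?thesis using that by (simp add: w_def blinfun.diff_right blinfun.sum_right blinfun.scaleR_right)
    qed
    have gw: "g w = 1"
      by (simp add: w_def blinfun.diff_right blinfun.sum_right blinfun.scaleR_right gx1 gu)
    define f' where "f' = f(n := g)"
    define u' where "u' = u(n := w)"
    have 1: "f' i (u' j) = (if i = j then 1 else 0)" if "i < Suc n" "j < Suc n" for i j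
      using that uf gu fw gw by (auto simp: f'_def u'_def less_Suc_eq)
    have S: "(\<Sum>i<Suc n. blinfun_apply \<psi> (u' i) * f' i y) = (\<Sum>i<n. \<psi> (u i) * f i y) + \<psi> w * g y" for \<psi> :: "'a \<Rightarrow>\<^sub>L real" and y
      by (simp add: f'_def u'_def)
    have old: "\<psi> w = 0" if "\<psi> \<in> set \<phi>s" for \<psi> using ex[OF that, of w] fw by simp
    have "\<phi> w = 1" using gx[of w] gw fw by simp
    then have "blinfun_apply \<psi> y = (\<Sum>i<Suc n. blinfun_apply \<psi> (u' i) * f' i y)" if "\<psi> \<in> set (\<phi> # \<phi>s)" for \<psi> y
      unfolding S using that ex[of \<psi> y] old[of \<psi>] gx[of y] by auto
    with 1 show ?thesis by (intro exI[of _ "Suc n"] exI[of _ u'] exI[of _ f']) blast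
  qed
qed

text \<open>If the f i are biorthogonal to the u j and B fixes their common kernel, this is the
  matrix of the operator that B induces on the quotient by that kernel.\<close>

definition compression :: "nat \<Rightarrow> (nat \<Rightarrow> 'a) \<Rightarrow> (nat \<Rightarrow> 'a \<Rightarrow>\<^sub>L real) \<Rightarrow> ('a::real_normed_vector \<Rightarrow>\<^sub>L 'a) \<Rightarrow> real mat" where
  "compression n u f B = mat n n (\<lambda>(i, j). f i (B (u j)))"

lemma compression_carrier: "compression n u f B \<in> carrier_mat n n"
  by (simp add: compression_def)

lemma compression_id:
  assumes "\<And>i j. i < n \<Longrightarrow> j < n \<Longrightarrow> blinfun_apply (f i) (u j) = (if i = j then 1 else 0)"
  shows "compression n u f id_blinfun = 1\<^sub>m n"
  by (rule eq_matI) (use assms in \<open>auto simp: compression_def\<close>)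

text \<open>The part of B' (u j) outside the span of the u k lies in the common kernel of the f i. B
  fixes that part, so it contributes nothing to the coordinates. B' may be arbitrary.\<close>

lemma compression_compose:
  assumes uf: "\<And>i j. i < n \<Longrightarrow> j < n \<Longrightarrow> blinfun_apply (f i) (u j) = (if i = j then 1 else 0)"
    and B: "\<And>x. (\<And>i. i < n \<Longrightarrow> blinfun_apply (f i) x = 0) \<Longrightarrow> blinfun_apply B x = x"
  shows "compression n u f (B o\<^sub>L B') = compression n u f B * compression n u f B'"
proof (rule eq_matI)
  fix i j assume "i < dim_row (compression n u f B * compression n u f B')"
    "j < dim_col (compression n u f B * compression n u f B')"
  then have ij: "i < n" "j < n" by (auto simp: compression_def)
  let ?y = "B' (u j)"
  let ?q = "?y - (\<Sum>k<n. f k ?y *\<^sub>R u k)"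
  have fq: "f i ?q = 0" if "i < n" for i
  proof -
    have "(\<Sum>k<n. f k ?y * f i (u k)) = (\<Sum>k<n. if k = i then f i ?y else 0)"
      by (rule sum.cong) (use uf that in auto)
    then show ?thesis using that by (simp add: blinfun.diff_right blinfun.sum_right blinfun.scaleR_right)
  qed
  have "B ?y = B ?q + B (\<Sum>k<n. f k ?y *\<^sub>R u k)" by (simp add: blinfun.diff_right)
  also have "B ?q = ?q" by (rule B[OF fq])
  finally have "f i (B ?y) = f i (B (\<Sum>k<n. f k ?y *\<^sub>R u k))"
    using fq[OF ij(1)] by (simp add: blinfun.add_right)
  also have "\<dots> = (\<Sum>k<n. f i (B (u k)) * f k ?y)"
    by (simp add: blinfun.sum_right blinfun.scaleR_right mult.commute)
  also have "\<dots> = (compression n u f B * compression n u f B') $$ (i, j)"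
    using ij by (simp add: compression_def scalar_prod_def lessThan_atLeast0)
  finally show "compression n u f (B o\<^sub>L B') $$ (i, j) = (compression n u f B * compression n u f B') $$ (i, j)"
    using ij by (simp add: compression_def)
qed (auto simp: compression_def)

text \<open>Compares two block triangular factorizations of the matrix with rows \<open>(1, a)\<close> and \<open>(2 b, 1)\<close>.\<close>

lemma det_rank_one_reflection:
  fixes a b :: "nat \<Rightarrow> real"
  assumes ab: "(\<Sum>i<n. a i * b i) = 1"
  shows "Determinant.det (mat n n (\<lambda>(i, j). (if i = j then 1 else 0) - 2 * a i * b j)) = -1"
proof -
  define c where "c = mat n 1 (\<lambda>(i, j). a i)"
  define r where "r = mat 1 n (\<lambda>(i, j). 2 * b j)"
  define M where "M = mat n n (\<lambda>(i, j). (if i = j then 1 else 0) - 2 * a i * b j)"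
  have cc: "c \<in> carrier_mat n 1" and rr: "r \<in> carrier_mat 1 n" and MM: "M \<in> carrier_mat n n"
    by (auto simp: c_def r_def M_def)
  let ?I = "1\<^sub>m n :: real mat" and ?J = "1\<^sub>m 1 :: real mat"
  let ?Z1 = "0\<^sub>m n 1 :: real mat" and ?Z2 = "0\<^sub>m 1 n :: real mat"
  let ?L = "four_block_mat ?I ?Z1 r ?J"
  have rc: "?J - r * c \<in> carrier_mat 1 1" using cc rr by auto
  have 1: "?L * four_block_mat ?I c ?Z2 (?J - r * c) = four_block_mat ?I c r ?J"
    by (subst mult_four_block_mat[OF _ _ _ _ _ _ _ rc]) (use cc rr in \<open>auto intro!: cong_four_block_mat eq_matI\<close>)
  have 2: "four_block_mat M c ?Z2 ?J * ?L = four_block_mat ?I c r ?J"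
  proof -
    have "M * ?I + c * r = ?I"
      by (rule eq_matI) (use cc rr MM in \<open>auto simp: M_def c_def r_def scalar_prod_def\<close>)
    then show ?thesis
      by (subst mult_four_block_mat[OF MM cc _ _ _ _ rr]) (use cc rr MM in \<open>auto intro!: cong_four_block_mat eq_matI\<close>)
  qed
  have dL: "Determinant.det ?L = 1"
    by (subst det_four_block_mat_upper_right_zero) (use rr in auto)
  have "Determinant.det M = Determinant.det (four_block_mat M c ?Z2 ?J)"
    by (subst det_four_block_mat_lower_left_zero[OF MM cc]) auto
  also have "\<dots> = Determinant.det (four_block_mat M c ?Z2 ?J * ?L)"
    by (subst det_mult[of _ "n + 1"]) (use MM cc rr dL in auto)
  also have "\<dots> = Determinant.det (?L * four_block_mat ?I c ?Z2 (?J - r * c))" by (simp only: 1 2)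
  also have "\<dots> = Determinant.det (four_block_mat ?I c ?Z2 (?J - r * c))"
    by (subst det_mult[of _ "n + 1"]) (use cc rr rc dL in auto)
  also have "\<dots> = Determinant.det (?J - r * c)"
    by (subst det_four_block_mat_lower_left_zero[OF _ cc _ rc]) auto
  also have "\<dots> = 1 - (\<Sum>i<n. 2 * b i * a i)"
    by (subst det_single[OF rc]) (simp add: r_def c_def scalar_prod_def lessThan_atLeast0)
  also have "(\<Sum>i<n. 2 * b i * a i) = 2 * (\<Sum>i<n. a i * b i)"
    unfolding sum_distrib_left by (rule sum.cong) auto
  finally show ?thesis using ab by (simp add: M_def)
qed

text \<open>The inverses S s are merely chosen pointwise. Near s the operators A r have the common
  lower bound c/2, and A r maps the difference of the two values to y r - A r (S s (y s)), which
  tends to 0.\<close>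

lemma continuous_on_GL_inverse_apply:
  fixes A :: "real \<Rightarrow> 'a::banach \<Rightarrow>\<^sub>L 'a" and S :: "real \<Rightarrow> 'a \<Rightarrow>\<^sub>L 'a"
  assumes A: "continuous_on X A" and y: "continuous_on X y"
    and GL: "\<And>s. s \<in> X \<Longrightarrow> A s \<in> GL"
    and S: "\<And>s x. s \<in> X \<Longrightarrow> S s (A s x) = x" "\<And>s x. s \<in> X \<Longrightarrow> A s (S s x) = x"
  shows "continuous_on X (\<lambda>s. S s (y s))"
  unfolding continuous_on_def
proof
  fix s assume s: "s \<in> X"
  obtain c where c: "c > 0" "\<And>x. c * norm x \<le> norm (A s x)" using GL_bounded_below[OF GL[OF s]] by blast
  have tA: "(A \<longlongrightarrow> A s) (at s within X)" using A s by (simp add: continuous_on_def)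
  have ty: "(y \<longlongrightarrow> y s) (at s within X)" using y s by (simp add: continuous_on_def)
  have ev: "eventually (\<lambda>r. r \<in> X \<and> norm (A r - A s) < c / 2) (at s within X)"
    using tendstoD[OF tA, of "c/2"] c(1) by (auto simp: eventually_at_filter dist_norm elim: eventually_mono)
  have "((\<lambda>r. S r (y r) - S s (y s)) \<longlongrightarrow> 0) (at s within X)"
  proof (rule Lim_null_comparison)
    show "eventually (\<lambda>r. norm (S r (y r) - S s (y s)) \<le> 2 / c * norm (y r - A r (S s (y s)))) (at s within X)"
      using ev
    proof (rule eventually_mono)
      fix r assume r: "r \<in> X \<and> norm (A r - A s) < c / 2"
      let ?d = "S r (y r) - S s (y s)"
      have "c * norm ?d \<le> norm (A r ?d - (A r - A s) ?d)" using c(2)[of ?d] by (simp add: blinfun.diff_left)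
      also have "\<dots> \<le> norm (A r ?d) + norm (A r - A s) * norm ?d"
        by (rule order_trans[OF norm_triangle_ineq4]) (intro add_left_mono norm_blinfun)
      also have "\<dots> \<le> norm (A r ?d) + c / 2 * norm ?d" using r by (intro add_left_mono mult_right_mono) auto
      finally have "norm ?d \<le> 2 / c * norm (A r ?d)" using c(1) by (simp add: field_simps)
      then show "norm ?d \<le> 2 / c * norm (y r - A r (S s (y s)))"
        using r by (simp add: blinfun.diff_right S(2))
    qed
    have "((\<lambda>r. 2 / c * norm (y r - A r (S s (y s)))) \<longlongrightarrow> 2 / c * norm (y s - A s (S s (y s)))) (at s within X)"
      by (intro tendsto_intros tA ty)
    then show "((\<lambda>r. 2 / c * norm (y r - A r (S s (y s)))) \<longlongrightarrow> 0) (at s within X)" by (simp add: S(2) s)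
  qed
  then show "((\<lambda>s. S s (y s)) \<longlongrightarrow> S s (y s)) (at s within X)" by (rule LIM_zero_cancel)
qed

text \<open>For s < 1, dividing by 1 - s turns a point of the segment into the shift of T by s / (1
  - s) \<ge> 0.\<close>

lemma GL0_segment:
  assumes T: "T \<in> GL0" and s: "0 \<le> s" "s \<le> (1::real)"
  shows "(1 - s) *\<^sub>R T + s *\<^sub>R id_blinfun \<in> GL"
proof (cases "s = 1")
  case False
  then have "s < 1" using s by simp
  then have "(1 - s) *\<^sub>R (T + (s / (1 - s)) *\<^sub>R id_blinfun) \<in> GL"
    using T s unfolding GL0_def by (intro GL_scaleR) auto
  then show ?thesis using \<open>s < 1\<close> by (simp add: scaleR_add_right)
qed (simp add: GL_id)

text \<open>
  Along the segments from \<open>T\<close> and \<open>T'\<close> to the identity, \<open>T\<^sub>s - T'\<^sub>s\<close> vanishes on the common kernel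
  of the functionals of the reflections, so \<open>T'\<^sub>s\<close> inverse times \<open>T\<^sub>s\<close> has a determinant, which never vanishes.
\<close>

lemma even_reflections:
  fixes T T' :: "'a::banach \<Rightarrow>\<^sub>L 'a"
  assumes T: "T \<in> GL0" "T' \<in> GL0" and ps: "normalized ps" and eq: "T = T' o\<^sub>L reflection_product ps"
  shows "even (length ps)"
proof (rule ccontr)
  assume odd: "odd (length ps)"
  obtain n and u :: "nat \<Rightarrow> 'a" and f :: "nat \<Rightarrow> 'a \<Rightarrow>\<^sub>L real" where
    uf: "\<And>i j. i < n \<Longrightarrow> j < n \<Longrightarrow> f i (u j) = (if i = j then 1 else 0)"
    and ex: "\<And>\<phi> x. \<phi> \<in> set (map snd ps) \<Longrightarrow> blinfun_apply \<phi> x = (\<Sum>i<n. blinfun_apply \<phi> (u i) * f i x)"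
    using biorthogonal_system[of "map snd ps"] by blast
  define D where "D B = Determinant.det (compression n u f B)" for B
  have D_mult: "D (B o\<^sub>L B') = D B * D B'" if "\<And>x. (\<And>i. i < n \<Longrightarrow> f i x = 0) \<Longrightarrow> blinfun_apply B x = x" for B B'
  proof -
    have "compression n u f (B o\<^sub>L B') = compression n u f B * compression n u f B'"
      by (rule compression_compose[OF uf that])
    then show ?thesis unfolding D_def using det_mult[OF compression_carrier compression_carrier] by metis
  qed
  have D_id: "D id_blinfun = 1" using compression_id[of n f u] uf by (simp add: D_def)
  have D_refl: "D (reflection_product qs) = (- 1) ^ length qs" if "set qs \<subseteq> set ps" for qs
    using that
  proof (induction qs)
    case (Cons p qs)
    obtain v \<phi> where p: "p = (v, \<phi>)" by (cases p)
    have \<phi>: "\<phi> \<in> set (map snd ps)" "\<phi> v = 1" using Cons.prems p ps by (force simp: normalized_def)+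
    have fx: "reflection v \<phi> x = x" if "\<And>i. i < n \<Longrightarrow> f i x = 0" for x using ex[OF \<phi>(1), of x] that by simp
    have "(\<Sum>i<n. f i v * \<phi> (u i)) = 1" using ex[OF \<phi>(1), of v] \<phi>(2) by (simp add: mult.commute)
    then have "Determinant.det (mat n n (\<lambda>(i, j). (if i = j then 1 else 0) - 2 * f i v * \<phi> (u j))) = -1"
      by (rule det_rank_one_reflection)
    moreover have "compression n u f (reflection v \<phi>) = mat n n (\<lambda>(i, j). (if i = j then 1 else 0) - 2 * f i v * \<phi> (u j))"
      by (rule eq_matI) (auto simp: compression_def blinfun.bilinear_simps uf)
    ultimately have "D (reflection v \<phi>) = -1" by (simp add: D_def)
    then show ?case using Cons D_mult[OF fx, of "reflection_product qs"] by (simp add: p)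
  qed (simp add: D_id)
  define A where "A s = (1 - s) *\<^sub>R T + s *\<^sub>R id_blinfun" for s :: real
  define A' where "A' s = (1 - s) *\<^sub>R T' + s *\<^sub>R id_blinfun" for s :: real
  have AGL: "A s \<in> GL" "A' s \<in> GL" if "s \<in> {0..1}" for s
    using GL0_segment[of _ s] T that by (auto simp: A_def A'_def)
  have "\<exists>S. (\<forall>x. blinfun_apply S (A' s x) = x) \<and> (\<forall>x. A' s (S x) = x)" if "s \<in> {0..1}" for s
    using GL_E[OF AGL(2)[OF that]] by metis
  then obtain S where S: "\<And>s x. s \<in> {0..1} \<Longrightarrow> blinfun_apply (S s) (A' s x) = x"
      "\<And>s x. s \<in> {0..1} \<Longrightarrow> A' s (S s x) = x" by metis
  define B where "B s = S s o\<^sub>L A s" for s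
  have fixB: "B s x = x" if s: "s \<in> {0..1}" and x: "\<And>i. i < n \<Longrightarrow> f i x = 0" for s x
  proof -
    have "snd p x = 0" if "p \<in> set ps" for p using ex[of "snd p" x] that x by simp
    then have "reflection_product ps x = x" by (rule reflection_product_fixes)
    then have "T x = T' x" by (simp add: eq)
    then have "A s x = A' s x" by (simp add: A_def A'_def blinfun.bilinear_simps)
    then show ?thesis using S(1)[OF s] by (simp add: B_def)
  qed
  \<comment> \<open>Multiplicativity asks only the left factor \<open>B s\<close> to fix the common
    kernel, so nothing has to be known about its inverse.\<close>
  have Dnz: "D (B s) \<noteq> 0" if s: "s \<in> {0..1}" for s
  proof -
    obtain R where R: "\<And>x. A s (blinfun_apply R x) = x" using GL_E[OF AGL(1)[OF s]] by metis
    have "B s o\<^sub>L (R o\<^sub>L A' s) = id_blinfun" by (rule blinfun_eqI) (simp add: B_def R S(1)[OF s])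
    then have "D (B s) * D (R o\<^sub>L A' s) = 1" using D_mult[of "B s" "R o\<^sub>L A' s"] fixB[OF s] D_id by simp
    then show ?thesis by auto
  qed
  have "continuous_on {0..1} (\<lambda>s. D (B s))"
  proof -
    have entry: "continuous_on {0..1} (\<lambda>s. f i (B s (u j)))" for i j
    proof -
      have "continuous_on {0..1} (\<lambda>s. S s (A s (u j)))"
        by (rule continuous_on_GL_inverse_apply[of _ A'])
          (use AGL S in \<open>auto simp: A_def A'_def intro!: continuous_intros\<close>)
      then show ?thesis by (auto simp: B_def intro!: continuous_intros)
    qed
    \<comment> \<open>The Leibniz formula reduces continuity of the determinant to continuity of the
      entries.\<close>
    have "D (B s) = (\<Sum>p\<in>{p. p permutes {0..<n}}. signof p * (\<Prod>i = 0..<n. f i (B s (u (p i)))))" for s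
      unfolding D_def det_def'[OF compression_carrier]
      by (intro sum.cong refl arg_cong2[where f="(*)"] prod.cong) (auto simp: compression_def permutes_in_image)
    then show ?thesis by (simp only:) (intro continuous_intros entry)
  qed
  moreover have "D (B 0) \<le> 0"
  proof -
    have "B 0 = reflection_product ps"
      by (rule blinfun_eqI) (use S(1)[of 0] in \<open>simp add: B_def A_def A'_def eq\<close>)
    then show ?thesis using D_refl[of ps] odd by simp
  qed
  moreover have "D (B 1) \<ge> 0"
  proof -
    have "B 1 = id_blinfun"
      by (rule blinfun_eqI) (use S(1)[of 1] in \<open>simp add: B_def A_def A'_def\<close>)
    then show ?thesis by (simp add: D_id)
  qed
  ultimately obtain s where "0 \<le> s" "s \<le> 1" "D (B s) = 0" using IVT'[of "\<lambda>s. D (B s)" 0 0 1] by auto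
  then show False using Dnz[of s] by simp
qed

section \<open>Parity is locally constant\<close>

text \<open>For t up to norm T + 1 the shifts of T form a compact subset of the open set
  \<open>GL\<close>, so a uniform distance e works. For larger t, an operator within distance 1 of T
  has norm below t, so its shift is invertible anyway.\<close>

lemma open_GL0: "open (GL0 :: ('a::banach \<Rightarrow>\<^sub>L 'a) set)"
  unfolding open_dist
proof
  fix T :: "'a \<Rightarrow>\<^sub>L 'a" assume T: "T \<in> GL0"
  have cmp: "compact ((\<lambda>t. T + t *\<^sub>R id_blinfun) ` {0..norm T + 1})"
    by (intro compact_continuous_image continuous_intros) simp
  have sub: "(\<lambda>t. T + t *\<^sub>R id_blinfun) ` {0..norm T + 1} \<subseteq> GL" using T by (auto simp: GL0_def)
  obtain e where e: "e > 0" "(\<Union>A\<in>(\<lambda>t. T + t *\<^sub>R id_blinfun) ` {0..norm T + 1}. ball A e) \<subseteq> GL"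
    using compact_subset_open_imp_ball_epsilon_subset[OF cmp open_GL sub] by blast
  have "B \<in> GL0" if B: "dist B T < min e 1" for B
    unfolding GL0_def
  proof (intro CollectI allI impI)
    fix t :: real assume t: "t \<ge> 0"
    show "B + t *\<^sub>R id_blinfun \<in> GL"
    proof (cases "t \<le> norm T + 1")
      case True
      have "B + t *\<^sub>R id_blinfun \<in> ball (T + t *\<^sub>R id_blinfun) e" using B by (simp add: dist_norm norm_minus_commute)
      then show ?thesis using e(2) True t by fastforce
    next
      case False
      have "norm B \<le> norm T + norm (B - T)" using norm_triangle_ineq[of T "B - T"] by simp
      then show ?thesis using False B by (intro GL_large_shift) (simp add: dist_norm; linarith)
    qed
  qed
  then show "\<exists>e>0. \<forall>B. dist B T < e \<longrightarrow> B \<in> GL0" using e(1) by (intro exI[of _ "min e 1"]) auto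
qed

lemma id_GL0: "id_blinfun \<in> GL0"
proof -
  have "id_blinfun + t *\<^sub>R id_blinfun = (1 + t) *\<^sub>R (id_blinfun :: 'a \<Rightarrow>\<^sub>L 'a)" for t
    by (simp add: algebra_simps)
  then show ?thesis by (auto simp: GL0_def GL_id intro!: GL_scaleR)
qed

context type_R_space
begin

text \<open>This frees the parity from the spectrum: any factorization computes it. The given
  factorization is compared with the spectral one, whose reflections are undone by the reversed
  product, and \<open>even_reflections\<close> applies to the concatenated list.\<close>

lemma shift_multiplicity_parity:
  assumes T: "T \<in> GL" "pi_X T > 0" and T': "T' \<in> GL0" and ps: "normalized ps"
    and eq: "T = T' o\<^sub>L reflection_product ps"
  shows "even (shift_multiplicity T) \<longleftrightarrow> even (length ps)"
proof -
  obtain S qs where S: "S \<in> GL0" "normalized qs" "T = S o\<^sub>L reflection_product qs" "length qs = shift_multiplicity T"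
    using reflection_factorization[OF T] by blast
  have q: "reflection_product qs (reflection_product (rev qs) x) = x" for x
    using reflection_product_rev[OF S(2)] by (metis blinfun_apply_blinfun_compose blinfun_apply_id_blinfun)
  have "S = T' o\<^sub>L reflection_product (ps @ rev qs)"
  proof (rule blinfun_eqI)
    fix x
    have "S x = T (reflection_product (rev qs) x)" by (simp add: S(3) q)
    then show "S x = (T' o\<^sub>L reflection_product (ps @ rev qs)) x" by (simp add: eq reflection_product_append)
  qed
  then have "even (length (ps @ rev qs))"
    using ps S(2) by (intro even_reflections[OF S(1) T']) (auto simp: normalized_def)
  then show ?thesis by (simp flip: S(4))
qed

text \<open>A nearby operator B can use the same reflections as T: with K the inverse of their
  product, B K is close to T K = T', hence still in the open set \<open>GL0\<close>. The Boolean b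
  selects the parity.\<close>

lemma open_positive_parity: "open {T \<in> GL. pi_X T > 0 \<and> (even (shift_multiplicity T) \<longleftrightarrow> b)}"
  unfolding open_dist
proof
  fix T assume "T \<in> {T \<in> GL. pi_X T > 0 \<and> (even (shift_multiplicity T) \<longleftrightarrow> b)}"
  then have T: "T \<in> GL" "pi_X T > 0" "even (shift_multiplicity T) \<longleftrightarrow> b" by auto
  obtain T' ps where T': "T' \<in> GL0" "normalized ps" "T = T' o\<^sub>L reflection_product ps" "length ps = shift_multiplicity T"
    using reflection_factorization[OF T(1,2)] by blast
  obtain K where K: "\<And>x. blinfun_apply K (reflection_product ps x) = x" "\<And>x. reflection_product ps (K x) = x"
    using GL_E[OF reflection_product_GL[OF T'(2)]] by metis
  have TK: "T o\<^sub>L K = T'" by (rule blinfun_eqI) (simp add: T'(3) K)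
  let ?U = "GL \<inter> {B. pi_X B > 0} \<inter> (\<lambda>B. B o\<^sub>L K) -` GL0"
  have "open {B :: 'a \<Rightarrow>\<^sub>L 'a. pi_X B > 0}"
    using continuous_on_pi_X by (intro open_Collect_less continuous_intros) auto
  moreover have "open ((\<lambda>B. B o\<^sub>L K) -` GL0)"
    by (intro open_vimage open_GL0 continuous_intros)
  ultimately have "open ?U" using open_GL by (intro open_Int)
  moreover have "T \<in> ?U" using T T'(1) by (simp add: TK)
  ultimately obtain e where e: "e > 0" "\<And>B. dist B T < e \<Longrightarrow> B \<in> ?U" unfolding open_dist by blast
  have "B \<in> {T \<in> GL. pi_X T > 0 \<and> (even (shift_multiplicity T) \<longleftrightarrow> b)}" if "dist B T < e" for B
  proof -
    have B: "B \<in> GL" "pi_X B > 0" "B o\<^sub>L K \<in> GL0" using e(2)[OF that] by auto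
    have "B = (B o\<^sub>L K) o\<^sub>L reflection_product ps" by (rule blinfun_eqI) (simp add: K)
    then have "even (shift_multiplicity B) \<longleftrightarrow> even (length ps)"
      by (rule shift_multiplicity_parity[OF B(1,2,3) T'(2)])
    then show ?thesis using B T T'(4) by simp
  qed
  then show "\<exists>e>0. \<forall>B. dist B T < e \<longrightarrow> B \<in> {T \<in> GL. pi_X T > 0 \<and> (even (shift_multiplicity T) \<longleftrightarrow> b)}"
    using e(1) by blast
qed

end

section \<open>Connecting invertible operators\<close>

lemma connected_component_segment:
  fixes A B :: "'a::real_normed_vector"
  assumes "\<And>s. 0 \<le> s \<Longrightarrow> s \<le> 1 \<Longrightarrow> (1 - s) *\<^sub>R A + s *\<^sub>R B \<in> S"
  shows "connected_component S A B"
  unfolding connected_component_def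
proof (intro exI conjI)
  let ?g = "\<lambda>s::real. (1 - s) *\<^sub>R A + s *\<^sub>R B"
  show "connected (?g ` {0..1})" by (intro connected_continuous_image continuous_intros) simp
  show "?g ` {0..1} \<subseteq> S" using assms by auto
  show "A \<in> ?g ` {0..1}" by (rule image_eqI[of _ _ 0]) auto
  show "B \<in> ?g ` {0..1}" by (rule image_eqI[of _ _ 1]) auto
qed

lemma connected_component_map:
  assumes "connected_component S a b" "continuous_on S h" "h ` S \<subseteq> S'"
  shows "connected_component S' (h a) (h b)"
proof -
  obtain C where C: "connected C" "C \<subseteq> S" "a \<in> C" "b \<in> C" using assms(1) unfolding connected_component_def by blast
  have "connected (h ` C)" using C(1,2) assms(2) by (intro connected_continuous_image) (rule continuous_on_subset)
  then show ?thesis unfolding connected_component_def using C assms(3) by (intro exI[of _ "h ` C"]) blast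
qed

lemma connected_component_GL_right:
  assumes "connected_component GL A B" "C \<in> GL"
  shows "connected_component GL (A o\<^sub>L C) (B o\<^sub>L C)"
  by (rule connected_component_map[OF assms(1)]) (auto intro!: continuous_intros GL_compose assms(2))

lemma connected_component_GL_left:
  assumes "connected_component GL A B" "C \<in> GL"
  shows "connected_component GL (C o\<^sub>L A) (C o\<^sub>L B)"
  by (rule connected_component_map[OF assms(1)]) (auto intro!: continuous_intros GL_compose assms(2))

lemma connected_component_reflection_vector:
  assumes "blinfun_apply f v = 1" "blinfun_apply f w = 1"
  shows "connected_component GL (reflection v f) (reflection w f)"
proof (rule connected_component_segment)
  fix s :: real
  have "(1 - s) *\<^sub>R reflection v f + s *\<^sub>R reflection w f = reflection ((1 - s) *\<^sub>R v + s *\<^sub>R w) f"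
    by (rule blinfun_eqI) (simp add: blinfun.bilinear_simps algebra_simps)
  moreover have "f ((1 - s) *\<^sub>R v + s *\<^sub>R w) = 1" using assms by (simp add: blinfun.bilinear_simps)
  ultimately show "(1 - s) *\<^sub>R reflection v f + s *\<^sub>R reflection w f \<in> GL" using reflection_GL by metis
qed

lemma connected_component_reflection_functional:
  assumes "blinfun_apply f v = 1" "blinfun_apply g v = 1"
  shows "connected_component GL (reflection v f) (reflection v g)"
proof (rule connected_component_segment)
  fix s :: real
  have "(1 - s) *\<^sub>R reflection v f + s *\<^sub>R reflection v g = reflection v ((1 - s) *\<^sub>R f + s *\<^sub>R g)"
    by (rule blinfun_eqI) (simp add: blinfun.bilinear_simps algebra_simps)
  moreover have "((1 - s) *\<^sub>R f + s *\<^sub>R g) v = 1" using assms by (simp add: blinfun.bilinear_simps)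
  ultimately show "(1 - s) *\<^sub>R reflection v f + s *\<^sub>R reflection v g \<in> GL" using reflection_GL by metis
qed

text \<open>A functional h nonzero at both v and w links the two: f is moved to a multiple of h with
  v fixed, then the vector is moved with h fixed, then the functional is moved to g. If f w and g v
  both vanish, h = f + g is 1 at both vectors.\<close>

lemma connected_component_reflections:
  fixes f g :: "'a::real_normed_vector \<Rightarrow>\<^sub>L real"
  assumes f: "f v = 1" and g: "g w = 1"
  shows "connected_component GL (reflection v f) (reflection w g)"
proof -
  obtain h :: "'a \<Rightarrow>\<^sub>L real" where h: "h v \<noteq> 0" "h w \<noteq> 0"
  proof (cases "f w \<noteq> 0 \<or> g v \<noteq> 0")
    case True
    then show ?thesis using that[of f] that[of g] f g by auto
  next
    case False
    then show ?thesis using that[of "f + g"] f g by (simp add: blinfun.add_left)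
  qed
  have rescale: "reflection x ((1 / h x) *\<^sub>R h) = reflection ((1 / h x) *\<^sub>R x) h" for x
    by (rule blinfun_eqI) (simp add: blinfun.bilinear_simps)
  have "connected_component GL (reflection v f) (reflection v ((1 / h v) *\<^sub>R h))"
    by (rule connected_component_reflection_functional[OF f]) (use h in \<open>simp add: blinfun.scaleR_left\<close>)
  moreover have "connected_component GL (reflection ((1 / h v) *\<^sub>R v) h) (reflection ((1 / h w) *\<^sub>R w) h)"
    by (rule connected_component_reflection_vector) (use h in \<open>simp_all add: blinfun.scaleR_right\<close>)
  moreover have "connected_component GL (reflection w ((1 / h w) *\<^sub>R h)) (reflection w g)"
    by (rule connected_component_reflection_functional[OF _ g]) (use h in \<open>simp add: blinfun.scaleR_left\<close>)
  ultimately show ?thesis unfolding rescale using connected_component_trans by blast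
qed

lemma connected_component_reflection_product:
  fixes f :: "'a::real_normed_vector \<Rightarrow>\<^sub>L real"
  assumes f: "f v = 1" and ps: "normalized ps"
  shows "connected_component GL (reflection_product ps) (if even (length ps) then id_blinfun else reflection v f)"
  using ps
proof (induction ps)
  case Nil
  show ?case using GL_id by (simp add: connected_component_refl)
next
  case (Cons p ps)
  obtain w g where p: "p = (w, g)" by (cases p)
  have g: "g w = 1" using Cons.prems by (simp add: normalized_def p)
  have IH: "connected_component GL (reflection_product ps) (if even (length ps) then id_blinfun else reflection v f)"
    using Cons by (simp add: normalized_def)
  have step: "connected_component GL (reflection_product (p # ps))
      (reflection w g o\<^sub>L (if even (length ps) then id_blinfun else reflection v f))"
    using connected_component_GL_left[OF IH reflection_GL[of g w, OF g]] by (simp add: p)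
  have wv: "connected_component GL (reflection w g) (reflection v f)" by (rule connected_component_reflections[OF g f])
  show ?case
  proof (cases "even (length ps)")
    case True
    have "reflection w g o\<^sub>L id_blinfun = reflection w g" by (rule blinfun_eqI) simp
    then show ?thesis using True step wv connected_component_trans by fastforce
  next
    case False
    have "connected_component GL (reflection w g o\<^sub>L reflection v f) (reflection v f o\<^sub>L reflection v f)"
      by (rule connected_component_GL_right[OF wv reflection_GL[OF f]])
    then show ?thesis using False step connected_component_trans reflection_involution[OF f] by fastforce
  qed
qed

lemma GL0_connected_to_id: "T \<in> GL0 \<Longrightarrow> connected_component GL T id_blinfun"
  using GL0_segment by (intro connected_component_segment) auto

section \<open>Components from a partition into open connected sets\<close>

lemma components_of_open_partition:
  assumes op: "\<And>C. C \<in> F \<Longrightarrow> open C" and con: "\<And>C. C \<in> F \<Longrightarrow> connected C"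
    and ne: "\<And>C. C \<in> F \<Longrightarrow> C \<noteq> {}" and dis: "\<And>C D. C \<in> F \<Longrightarrow> D \<in> F \<Longrightarrow> C \<noteq> D \<Longrightarrow> C \<inter> D = {}"
    and S: "\<Union>F = S"
  shows "components S = F"
proof -
  have comp: "C \<in> components S" if C: "C \<in> F" for C
    unfolding in_components_maximal
  proof (intro conjI allI impI)
    fix D assume D: "D \<noteq> {} \<and> C \<subseteq> D \<and> D \<subseteq> S \<and> connected D"
    let ?E = "\<Union>(F - {C})"
    have "open ?E" using op by (intro open_Union) auto
    moreover have "C \<inter> ?E = {}" using dis[OF C] by blast
    moreover have "D \<subseteq> C \<union> ?E" using D S by blast
    ultimately have "C \<inter> D = {} \<or> ?E \<inter> D = {}"
      using D op[OF C] by (intro connectedD[of D C ?E]) auto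
    moreover have "C \<inter> D \<noteq> {}" using D ne[OF C] by (simp add: inf_absorb1)
    ultimately have "?E \<inter> D = {}" by simp
    then have "D \<subseteq> C" using \<open>D \<subseteq> C \<union> ?E\<close> by (simp add: subset_iff disjoint_iff) metis
    then show "D = C" using D by (simp add: subset_antisym)
  qed (use C ne con S in auto)
  show ?thesis
  proof (intro subset_antisym subsetI)
    fix X assume X: "X \<in> components S"
    obtain x where "x \<in> X" "x \<in> S" using in_components_nonempty[OF X] in_components_subset[OF X] by blast
    then obtain C where C: "C \<in> F" "x \<in> C" using S by blast
    then have "X = C" using components_eq[OF X comp[OF C(1)]] \<open>x \<in> X\<close> by blast
    then show "X \<in> F" using C(1) by simp
  qed (rule comp)
qed

text \<open>The connecting sets are only known to lie in S, not in C. But C and S - C are both open,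
  so the component of a in S cannot leave C and therefore equals C.\<close>

lemma connected_of_common_point:
  assumes "\<And>x. x \<in> C \<Longrightarrow> connected_component S x a" and "a \<in> C" "open C" "C \<subseteq> S" "open (S - C)"
  shows "connected C"
proof -
  have "connected_component_set S a \<subseteq> C"
  proof (rule ccontr)
    assume n: "\<not> ?thesis"
    let ?D = "connected_component_set S a"
    have DS: "?D \<subseteq> C \<union> (S - C)" using connected_component_subset by blast
    have "C \<inter> ?D = {} \<or> (S - C) \<inter> ?D = {}"
      by (rule connectedD[OF connected_connected_component assms(3,5) _ DS]) blast
    moreover have "a \<in> ?D" using assms(2,4) by (auto intro: connected_component_refl)
    ultimately show False using n DS assms(2) by blast
  qed
  moreover have "C \<subseteq> connected_component_set S a" using assms(1) connected_component_sym by blast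
  ultimately show ?thesis using connected_connected_component[of S a] by (metis subset_antisym)
qed

section \<open>Multiplicities in the complexification\<close>

lemma eigenvalue_of_real_iff:
  "eigenvalue T (of_real r) \<longleftrightarrow> (\<exists>x. x \<noteq> 0 \<and> (T + (- r) *\<^sub>R id_blinfun) x = 0)"
  by (auto simp: eigenvalue_def complexify_def cscale_def prod_eq_iff blinfun.bilinear_simps zero_prod_def)

lemma opow_zero_mono: "opow A m x = 0 \<Longrightarrow> m \<le> n \<Longrightarrow> opow A n x = 0"
  by (metis opow_add_apply blinfun.zero_right le_add_diff_inverse2)

text \<open>A real shift acts on the two components separately; the larger of two exponents serves
  for both.\<close>

lemma generalized_eigenspace_of_real:
  "{z. \<exists>n. (shifted T (of_real r) ^^ n) z = 0} =
    gen_kernel (T + (- r) *\<^sub>R id_blinfun) \<times> gen_kernel (T + (- r) *\<^sub>R id_blinfun)"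
proof -
  let ?A = "T + (- r) *\<^sub>R id_blinfun"
  have pw: "(shifted T (of_real r) ^^ n) z = (opow ?A n (fst z), opow ?A n (snd z))" for n z
    by (induction n)
      (auto simp: shifted_def complexify_def cscale_def blinfun.bilinear_simps)
  show ?thesis
  proof (intro subset_antisym subsetI)
    fix z assume "z \<in> gen_kernel ?A \<times> gen_kernel ?A"
    then obtain m n where "opow ?A m (fst z) = 0" "opow ?A n (snd z) = 0" by (auto simp: gen_kernel_def)
    then have "opow ?A (max m n) (fst z) = 0" "opow ?A (max m n) (snd z) = 0"
      by (auto intro: opow_zero_mono)
    then show "z \<in> {z. \<exists>n. (shifted T (of_real r) ^^ n) z = 0}" by (auto simp: pw zero_prod_def)
  qed (auto simp: pw gen_kernel_def zero_prod_def)
qed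

text \<open>A real basis of N, embedded by x \<mapsto> (x, 0), is a complex basis of the
  complexification N \<times> N: real and imaginary parts of a vanishing combination are real
  combinations of the basis.\<close>

lemma complex_dim_square:
  fixes N :: "'a::real_vector set"
  assumes N: "subspace N" "N \<subseteq> span B" "finite B"
  shows "vector_space.dim cscale (N \<times> N) = dim N"
proof -
  interpret C: vector_space "cscale :: complex \<Rightarrow> 'a \<times> 'a \<Rightarrow> 'a \<times> 'a" by (rule vector_space_cscale)
  obtain E where E: "E \<subseteq> N" "independent E" "N \<subseteq> span E" "card E = dim N" using basis_exists[of N] by metis
  have fE: "finite E" using independent_span_bound[OF N(3) E(2)] E(1) N(2) by blast
  let ?j = "\<lambda>x::'a. (x, 0::'a)"
  have injj: "inj_on ?j E" by (simp add: inj_on_def)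
  show ?thesis
  proof (rule C.dim_unique[of "?j ` E"])
    show "?j ` E \<subseteq> N \<times> N" using E(1) subspace_0[OF N(1)] by auto
    have real: "?j x \<in> C.span (?j ` E)" if "x \<in> span E" for x
      using that
    proof (induction rule: span_induct_alt)
      case base then show ?case using C.span_zero by (simp add: zero_prod_def)
    next
      case (step c x y)
      have "?j (c *\<^sub>R x + y) = cscale (of_real c) (?j x) + ?j y" by (simp add: cscale_def)
      moreover have "?j x \<in> C.span (?j ` E)" using step(1) by (intro C.span_base) blast
      ultimately show ?case using step(2) by (simp only: C.span_add C.span_scale)
    qed
    show "N \<times> N \<subseteq> C.span (?j ` E)"
    proof
      fix z assume "z \<in> N \<times> N"
      then have "fst z \<in> span E" "snd z \<in> span E" using E(3) by auto
      moreover have "z = ?j (fst z) + cscale \<i> (?j (snd z))" by (simp add: cscale_def)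
      ultimately show "z \<in> C.span (?j ` E)" using real by (metis C.span_add C.span_scale)
    qed
    show "C.independent (?j ` E)"
    proof (rule C.independent_if_scalars_zero)
      fix c z assume s: "(\<Sum>z\<in>?j ` E. cscale (c z) z) = 0" and z: "z \<in> ?j ` E"
      have s': "(\<Sum>x\<in>E. cscale (c (?j x)) (?j x)) = 0"
        using s by (subst (asm) sum.reindex[OF injj]) (simp add: o_def)
      have "(\<Sum>x\<in>E. Re (c (?j x)) *\<^sub>R x) = fst (\<Sum>x\<in>E. cscale (c (?j x)) (?j x))"
        "(\<Sum>x\<in>E. Im (c (?j x)) *\<^sub>R x) = snd (\<Sum>x\<in>E. cscale (c (?j x)) (?j x))"
        by (simp_all add: fst_sum snd_sum cscale_def)
      then have 0: "(\<Sum>x\<in>E. Re (c (?j x)) *\<^sub>R x) = 0" "(\<Sum>x\<in>E. Im (c (?j x)) *\<^sub>R x) = 0"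
        unfolding s' by simp_all
      have "Re (c (?j x)) = 0" "Im (c (?j x)) = 0" if "x \<in> E" for x
        using independentD[OF E(2) fE order_refl _ that, of "\<lambda>x. Re (c (?j x))"]
          independentD[OF E(2) fE order_refl _ that, of "\<lambda>x. Im (c (?j x))"] 0 by simp_all
      then show "c z = 0" using z by (auto simp: complex_eq_iff)
    qed (use fE in simp)
    show "card (?j ` E) = dim N" using card_image[OF injj] E(4) by simp
  qed
qed

lemma of_nat_bit: "(of_nat n :: bit) = (if even n then 0 else 1)"
  by (induction n) auto

context type_R_space
begin

text \<open>The bridge from the defining parity to the real count. Eigenvalues in the open half-line
  correspond to singular shifts by t \<mapsto> - t, with t = 0 excluded because T is invertible, and
  noninvertible shifts have eigenvectors because they lie in \<open>fredholm0\<close>.\<close>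

lemma eigen_parity_eq:
  assumes T: "T \<in> GL" "pi_X T > 0"
  shows "eigen_parity {..<0} T = of_nat (shift_multiplicity T)"
proof -
  let ?A = "\<lambda>t. T + t *\<^sub>R id_blinfun"
  let ?h = "\<lambda>t::real. complex_of_real (- t)"
  have GLiff: "?A t \<in> GL \<longleftrightarrow> (\<forall>x. ?A t x = 0 \<longrightarrow> x = 0)" if "t \<ge> 0" for t
    using fredholm0_injective_GL[OF shift_fredholm0[OF T(2) that]] GL_eq_0_iff by blast
  have "{\<mu>. eigenvalue T \<mu> \<and> \<mu> \<in> complex_of_real ` {..<0}} = ?h ` sing_shifts T"
  proof (intro subset_antisym subsetI)
    fix \<mu> assume "\<mu> \<in> {\<mu>. eigenvalue T \<mu> \<and> \<mu> \<in> complex_of_real ` {..<0}}"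
    then obtain r where r: "r < 0" "\<mu> = complex_of_real r" "eigenvalue T (of_real r)" by auto
    have "- r \<in> sing_shifts T"
      using r(1,3) GLiff[of "- r"] unfolding eigenvalue_of_real_iff sing_shifts_def by auto
    then show "\<mu> \<in> ?h ` sing_shifts T" using r(2) by (intro image_eqI[of _ _ "- r"]) auto
  next
    fix \<mu> assume "\<mu> \<in> ?h ` sing_shifts T"
    then obtain t where t: "t \<ge> 0" "?A t \<notin> GL" "\<mu> = ?h t" by (auto simp: sing_shifts_def)
    have "t \<noteq> 0" using t(2) T(1) by auto
    moreover have "eigenvalue T (?h t)"
      unfolding eigenvalue_of_real_iff using GLiff[OF t(1)] t(2) by auto
    ultimately show "\<mu> \<in> {\<mu>. eigenvalue T \<mu> \<and> \<mu> \<in> complex_of_real ` {..<0}}"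
      using t by (auto intro!: imageI)
  qed
  moreover have "inj_on ?h (sing_shifts T)" by (simp add: inj_on_def)
  moreover have "alg_multiplicity T (?h t) = dim (gen_kernel (?A t))" if "t \<in> sing_shifts T" for t
  proof -
    have t: "t \<ge> 0" using that by (simp add: sing_shifts_def)
    obtain P where P: "P \<in> finite_rank" "\<And>x. x \<in> gen_kernel (?A t) \<Longrightarrow> P x = x"
      using spectral_projection[OF shift_fredholm0[OF T(2) t] shift_finite_ascent[OF T(2) t]] by blast
    obtain B where B: "finite B" "\<And>x. P x \<in> span B" using finite_rank_range[OF P(1)] by blast
    have "gen_kernel (?A t) \<subseteq> span B" using P(2) B(2) by (metis subsetI)
    then show ?thesis
      unfolding alg_multiplicity_def generalized_eigenspace_of_real
      using complex_dim_square[OF gen_kernel_subspace _ B(1)] by simp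
  qed
  ultimately show ?thesis
    unfolding eigen_parity_def shift_multiplicity_def by (simp add: sum.reindex)
qed

lemma GL_plus_eq: "GL_plus k = {T \<in> GL. pi_X T > 0 \<and> (even (shift_multiplicity T) \<longleftrightarrow> k = (0::bit))}"
  unfolding GL_plus_def using eigen_parity_eq by (cases k) (auto simp: of_nat_bit split: if_splits)

lemma open_GL_plus: "open (GL_plus k :: ('a \<Rightarrow>\<^sub>L 'a) set)"
  unfolding GL_plus_eq by (rule open_positive_parity)

lemma GL_plus_connected_component:
  fixes f :: "'a \<Rightarrow>\<^sub>L real"
  assumes f: "f v = 1" and T: "T \<in> GL_plus k"
  shows "connected_component GL T (if k = 0 then id_blinfun else reflection v f)"
proof -
  have T: "T \<in> GL" "pi_X T > 0" "even (shift_multiplicity T) \<longleftrightarrow> k = 0" using T by (auto simp: GL_plus_eq)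
  obtain T' ps where T': "T' \<in> GL0" "normalized ps" "T = T' o\<^sub>L reflection_product ps" "length ps = shift_multiplicity T"
    using reflection_factorization[OF T(1,2)] by blast
  have "id_blinfun o\<^sub>L reflection_product ps = reflection_product ps" by (rule blinfun_eqI) simp
  then have "connected_component GL T (reflection_product ps)"
    using connected_component_GL_right[OF GL0_connected_to_id[OF T'(1)] reflection_product_GL[OF T'(2)]]
    by (simp flip: T'(3))
  then show ?thesis
    using connected_component_reflection_product[OF f T'(2)] T(3) T'(4) connected_component_trans by fastforce
qed

lemma id_GL_plus: "(id_blinfun :: 'a \<Rightarrow>\<^sub>L 'a) \<in> GL_plus 0"
proof -
  have "even (shift_multiplicity id_blinfun) \<longleftrightarrow> even (length ([] :: ('a \<times> ('a \<Rightarrow>\<^sub>L real)) list))"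
    by (rule shift_multiplicity_parity[OF GL_id _ id_GL0])
      (auto simp: pi_X_id normalized_def intro: blinfun_eqI)
  then show ?thesis by (simp add: GL_plus_eq GL_id pi_X_id)
qed

text \<open>The parity is read off from the factorization as the identity times one reflection,
  without computing any eigenspace.\<close>

lemma reflection_GL_plus:
  fixes f :: "'a \<Rightarrow>\<^sub>L real"
  assumes f: "f v = 1"
  shows "reflection v f \<in> GL_plus 1"
proof -
  have pi: "pi_X (reflection v f) = 1"
    using pi_X_add[of id_blinfun "(- 2) *\<^sub>R rank_one v f"] pi_X_scaleR[of "- 2" "rank_one v f"]
    by (simp add: reflection_def pi_X_id pi_X_finite_rank[OF rank_one_finite_rank])
  have "even (shift_multiplicity (reflection v f)) \<longleftrightarrow> even (length [(v, f)])"
    by (rule shift_multiplicity_parity[OF reflection_GL[OF f] _ id_GL0])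
      (auto simp: pi normalized_def f intro!: blinfun_eqI)
  then show ?thesis by (simp add: GL_plus_eq reflection_GL[OF f] pi)
qed

lemma ex_normalized: "\<exists>(v :: 'a) (f :: 'a \<Rightarrow>\<^sub>L real). f v = 1"
proof -
  have "\<exists>v :: 'a. v \<noteq> 0"
  proof (rule ccontr)
    assume "\<not> ?thesis"
    then have "(UNIV :: 'a set) \<subseteq> span {}" by auto
    then show False using infinite unfolding infinite_dimensional_def by blast
  qed
  then obtain v :: 'a where "v \<noteq> 0" by blast
  then obtain f :: "'a \<Rightarrow>\<^sub>L real" where "f v = 1" using functional_eq_1 by blast
  then show ?thesis by blast
qed

lemma GL_plus_nonempty: "(GL_plus k :: ('a \<Rightarrow>\<^sub>L 'a) set) \<noteq> {}"
  using id_GL_plus ex_normalized reflection_GL_plus by (cases k) auto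

end

section \<open>Operators with negative scalar part\<close>

lemma complexify_uminus: "complexify (- T) z = - complexify T z"
  by (simp add: complexify_def blinfun.minus_left)

lemma cscale_minus_left: "cscale (- c) z = - cscale c z"
  by (simp add: cscale_def)

lemma eigenvalue_uminus: "eigenvalue (- T) (- \<mu>) \<longleftrightarrow> eigenvalue T \<mu>"
  by (simp add: eigenvalue_def complexify_uminus cscale_minus_left)

text \<open>Changing both signs negates the shifted operator, so its powers agree up to sign and
  have the same kernels.\<close>

lemma alg_multiplicity_uminus: "alg_multiplicity (- T) (- \<mu>) = alg_multiplicity T \<mu>"
proof -
  have neg: "shifted T \<mu> (- z) = - shifted T \<mu> z" for z
    by (simp add: shifted_def complexify_def cscale_def blinfun.minus_right)
  have eq: "shifted (- T) (- \<mu>) z = - shifted T \<mu> z" for z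
    by (simp add: shifted_def complexify_uminus cscale_minus_left)
  have "(shifted (- T) (- \<mu>) ^^ n) z = (shifted T \<mu> ^^ n) z \<or> (shifted (- T) (- \<mu>) ^^ n) z = - (shifted T \<mu> ^^ n) z" for n z
    by (induction n) (auto simp: eq neg)
  then have "(shifted (- T) (- \<mu>) ^^ n) z = 0 \<longleftrightarrow> (shifted T \<mu> ^^ n) z = 0" for n z
    by (metis neg_equal_0_iff_equal)
  then show ?thesis by (simp add: alg_multiplicity_def)
qed

lemma eigen_parity_uminus: "eigen_parity {0<..} (- T) = eigen_parity {..<0} T"
proof -
  have "{\<mu>. eigenvalue (- T) \<mu> \<and> \<mu> \<in> complex_of_real ` {0<..}} =
      uminus ` {\<mu>. eigenvalue T \<mu> \<and> \<mu> \<in> complex_of_real ` {..<0}}"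
  proof (intro subset_antisym subsetI)
    fix \<mu> assume "\<mu> \<in> {\<mu>. eigenvalue (- T) \<mu> \<and> \<mu> \<in> complex_of_real ` {0<..}}"
    then obtain r where r: "r > 0" "\<mu> = of_real r" "eigenvalue (- T) \<mu>" by auto
    have "eigenvalue T (- \<mu>)" using r(3) eigenvalue_uminus[of T "- \<mu>"] by simp
    moreover have "- \<mu> \<in> complex_of_real ` {..<0}" using r by (intro image_eqI[of _ _ "- r"]) auto
    ultimately show "\<mu> \<in> uminus ` {\<mu>. eigenvalue T \<mu> \<and> \<mu> \<in> complex_of_real ` {..<0}}"
      by (intro image_eqI[of _ _ "- \<mu>"]) auto
  next
    fix \<mu> assume "\<mu> \<in> uminus ` {\<mu>. eigenvalue T \<mu> \<and> \<mu> \<in> complex_of_real ` {..<0}}"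
    then obtain r where r: "r < 0" "\<mu> = - of_real r" "eigenvalue T (of_real r)" by auto
    have "\<mu> \<in> complex_of_real ` {0<..}" using r by (intro image_eqI[of _ _ "- r"]) auto
    then show "\<mu> \<in> {\<mu>. eigenvalue (- T) \<mu> \<and> \<mu> \<in> complex_of_real ` {0<..}}"
      using r eigenvalue_uminus by auto
  qed
  then show ?thesis
    unfolding eigen_parity_def by (simp add: sum.reindex alg_multiplicity_uminus)
qed

text \<open>Since x0 is not in H, every x is an element of H plus some c x0, and then x - R x = 2 c
  x0. So the coefficient c is f (x - R x) / 2 for a bounded f with f x0 = 1, which shows directly
  that it is a bounded functional of x.\<close>

lemma reflections_eq:
  assumes "R \<in> reflections"
  shows "\<exists>v f. blinfun_apply f v = 1 \<and> R = reflection v f"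
proof -
  obtain H x0 where H: "is_hyperplane H" "x0 \<noteq> 0" "\<And>x. x \<in> H \<Longrightarrow> R x = x" "R x0 = - x0"
    using assms unfolding reflections_def by blast
  obtain v where v: "span (insert v H) = UNIV" and sH: "subspace H" using H(1) unfolding is_hyperplane_def by blast
  have spH: "span H = H" using sH by (rule span_eq_iff[THEN iffD2])
  have dec: "\<exists>k. x - k *\<^sub>R v \<in> H" for x
    using span_breakdown_eq[of x v H] v spH by auto
  have "x0 \<notin> H"
  proof
    assume "x0 \<in> H"
    then have "x0 = - x0" using H(3)[of x0] H(4) by simp
    then have "2 *\<^sub>R x0 = 0" by (simp add: scaleR_2 eq_neg_iff_add_eq_0)
    then show False using H(2) by simp
  qed
  obtain k0 where k0: "x0 - k0 *\<^sub>R v \<in> H" using dec by blast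
  have "k0 \<noteq> 0" using k0 \<open>x0 \<notin> H\<close> by auto
  have dec': "\<exists>c. x - c *\<^sub>R x0 \<in> H" for x
  proof -
    obtain k where k: "x - k *\<^sub>R v \<in> H" using dec by blast
    have "(x - k *\<^sub>R v) - (k / k0) *\<^sub>R (x0 - k0 *\<^sub>R v) \<in> H"
      by (intro subspace_diff[OF sH k] subspace_scale[OF sH k0])
    then show ?thesis using \<open>k0 \<noteq> 0\<close> by (intro exI[of _ "k / k0"]) (simp add: scaleR_diff_right)
  qed
  obtain f :: "'a \<Rightarrow>\<^sub>L real" where f: "f x0 = 1" using functional_eq_1[OF H(2)] by blast
  define g where "g = (1/2) *\<^sub>R (f o\<^sub>L (id_blinfun - R))"
  have gx: "g x = f (x - R x) / 2" for x by (simp add: g_def blinfun.bilinear_simps)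
  have "R x = reflection x0 g x" for x
  proof -
    obtain c where "x - c *\<^sub>R x0 \<in> H" using dec' by blast
    then have "R (x - c *\<^sub>R x0) = x - c *\<^sub>R x0" by (rule H(3))
    then have R: "R x = x - (2 * c) *\<^sub>R x0"
      by (simp add: blinfun.bilinear_simps H(4) algebra_simps flip: scaleR_2)
    then have "g x = c" by (simp add: gx blinfun.scaleR_right f)
    then show ?thesis using R by simp
  qed
  then have "R = reflection x0 g" by (intro blinfun_eqI)
  moreover have "g x0 = 1" using f by (simp add: gx H(4) blinfun.add_right)
  ultimately show ?thesis by blast
qed

context type_R_space
begin

lemma GL_minus_iff: "T \<in> GL_minus k \<longleftrightarrow> - T \<in> GL_plus k" for T :: "'a \<Rightarrow>\<^sub>L 'a"
  using eigen_parity_uminus[of "- T"]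
  by (simp add: GL_minus_def GL_plus_def GL_uminus_iff pi_X_uminus)

lemma GL_minus_eq: "GL_minus k = uminus ` (GL_plus k :: ('a \<Rightarrow>\<^sub>L 'a) set)"
  by (auto simp: GL_minus_iff intro!: image_eqI[of _ _ "- _"])

lemma GL_disjoint:
  "GL_plus 0 \<inter> (GL_plus 1 :: ('a \<Rightarrow>\<^sub>L 'a) set) = {}" "GL_minus 0 \<inter> (GL_minus 1 :: ('a \<Rightarrow>\<^sub>L 'a) set) = {}"
  "GL_plus j \<inter> (GL_minus k :: ('a \<Rightarrow>\<^sub>L 'a) set) = {}"
  by (auto simp: GL_plus_def GL_minus_def)

lemma GL_cover: "GL_plus 0 \<union> GL_plus 1 \<union> GL_minus 0 \<union> GL_minus 1 = (GL :: ('a \<Rightarrow>\<^sub>L 'a) set)"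
proof -
  have bit: "b = 0 \<or> b = 1" for b :: bit by (cases b) auto
  show ?thesis
    unfolding GL_plus_def GL_minus_def using pi_X_GL bit by (auto simp: not_less_iff_gr_or_eq)
qed

lemma open_GL_minus: "open (GL_minus k :: ('a \<Rightarrow>\<^sub>L 'a) set)"
  unfolding GL_minus_eq by (rule open_negations[OF open_GL_plus])

lemma connected_GL_plus: "connected (GL_plus k :: ('a \<Rightarrow>\<^sub>L 'a) set)"
proof -
  obtain v and f :: "'a \<Rightarrow>\<^sub>L real" where f: "f v = 1" using ex_normalized by blast
  have bit: "k = 0 \<or> k = 1" by (cases k) auto
  let ?a = "if k = 0 then id_blinfun else reflection v f"
  \<comment> \<open>In \<open>bit\<close>, \<open>k + 1\<close> is the other parity. The complement
    is thus a union of three open sets, as \<open>connected_of_common_point\<close>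
    requires.\<close>
  have "GL - GL_plus k = GL_plus (k + 1) \<union> GL_minus 0 \<union> (GL_minus 1 :: ('a \<Rightarrow>\<^sub>L 'a) set)"
    using bit GL_cover GL_disjoint by fastforce
  then have "open (GL - GL_plus k :: ('a \<Rightarrow>\<^sub>L 'a) set)" using open_GL_plus open_GL_minus by (metis open_Un)
  moreover have "?a \<in> GL_plus k" using bit id_GL_plus reflection_GL_plus[OF f] by auto
  moreover have "GL_plus k \<subseteq> (GL :: ('a \<Rightarrow>\<^sub>L 'a) set)" by (auto simp: GL_plus_def)
  ultimately show ?thesis
    using GL_plus_connected_component[OF f] open_GL_plus by (intro connected_of_common_point[of _ GL ?a])
qed

lemma connected_GL_minus: "connected (GL_minus k :: ('a \<Rightarrow>\<^sub>L 'a) set)"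
  unfolding GL_minus_eq by (intro connected_continuous_image connected_GL_plus continuous_intros)

lemma components_GL:
  "components (GL :: ('a \<Rightarrow>\<^sub>L 'a) set) = {GL_plus 0, GL_plus 1, GL_minus 0, GL_minus 1}"
  "card (components (GL :: ('a \<Rightarrow>\<^sub>L 'a) set)) = 4"
proof -
  have nm: "(GL_minus k :: ('a \<Rightarrow>\<^sub>L 'a) set) \<noteq> {}" for k using GL_plus_nonempty by (simp add: GL_minus_eq)
  let ?F = "{GL_plus 0, GL_plus 1, GL_minus 0, GL_minus 1} :: ('a \<Rightarrow>\<^sub>L 'a) set set"
  show 1: "components (GL :: ('a \<Rightarrow>\<^sub>L 'a) set) = ?F"
  proof (rule components_of_open_partition)
    show "open C" if "C \<in> ?F" for C using that open_GL_plus open_GL_minus by auto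
    show "connected C" if "C \<in> ?F" for C using that connected_GL_plus connected_GL_minus by auto
    show "C \<noteq> {}" if "C \<in> ?F" for C using that GL_plus_nonempty nm by auto
    show "C \<inter> D = {}" if "C \<in> ?F" "D \<in> ?F" "C \<noteq> D" for C D
    proof -
      have "GL_plus 1 \<inter> (GL_plus 0 :: ('a \<Rightarrow>\<^sub>L 'a) set) = {}" "GL_minus 1 \<inter> (GL_minus 0 :: ('a \<Rightarrow>\<^sub>L 'a) set) = {}"
        "GL_minus k \<inter> (GL_plus j :: ('a \<Rightarrow>\<^sub>L 'a) set) = {}" for j k
        using GL_disjoint by blast+
      with GL_disjoint that show ?thesis by (elim insertE emptyE) simp_all
    qed
    show "\<Union>?F = GL" using GL_cover by (simp add: Un_assoc)
  qed
  have "GL_plus 0 \<noteq> (GL_plus 1 :: ('a \<Rightarrow>\<^sub>L 'a) set)" "GL_minus 0 \<noteq> (GL_minus 1 :: ('a \<Rightarrow>\<^sub>L 'a) set)"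
    "GL_plus j \<noteq> (GL_minus k :: ('a \<Rightarrow>\<^sub>L 'a) set)" for j k
    using GL_disjoint GL_plus_nonempty nm by (metis inf.idem)+
  then show "card (components (GL :: ('a \<Rightarrow>\<^sub>L 'a) set)) = 4" unfolding 1 by simp
qed

end

theorem theorem4p4:
  assumes "infinite_dimensional (UNIV :: 'a::banach set)"
    and "hereditarily_indecomposable TYPE('a)"
    and "type_R TYPE('a)"
  shows "card (components (GL :: ('a \<Rightarrow>\<^sub>L 'a) set)) = 4
    \<and> components (GL :: ('a \<Rightarrow>\<^sub>L 'a) set) = {GL_plus 0, GL_plus 1, GL_minus 0, GL_minus 1}
    \<and> (id_blinfun :: 'a \<Rightarrow>\<^sub>L 'a) \<in> GL_plus 0
    \<and> (reflections :: ('a \<Rightarrow>\<^sub>L 'a) set) \<subseteq> GL_plus 1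
    \<and> - (id_blinfun :: 'a \<Rightarrow>\<^sub>L 'a) \<in> GL_minus 0
    \<and> (antireflections :: ('a \<Rightarrow>\<^sub>L 'a) set) \<subseteq> GL_minus 1"
proof -
  interpret type_R_space "TYPE('a)" by unfold_locales (fact assms(1), fact assms(3))
  have refl: "(reflections :: ('a \<Rightarrow>\<^sub>L 'a) set) \<subseteq> GL_plus 1"
    using reflections_eq reflection_GL_plus by blast
  then have "(antireflections :: ('a \<Rightarrow>\<^sub>L 'a) set) \<subseteq> GL_minus 1"
    unfolding antireflections_def GL_minus_eq by (rule image_mono)
  moreover have "- (id_blinfun :: 'a \<Rightarrow>\<^sub>L 'a) \<in> GL_minus 0" using id_GL_plus by (simp add: GL_minus_iff)
  ultimately show ?thesis using components_GL id_GL_plus refl by blast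
qed

end
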